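(* Let $n\ge2$, let $D\subset\mathbb{R}^n$ be a regular domain, let $\mu\ge0$, and let $f:\partial D\to\mathbb{R}$ be bounded and continuous. (1) The function $$u(x)=\mathbb{E}^x\left[e^{-\frac{\mu^2}{2}\tau_D}f(W(\tau_D))\,;\,\tau_D<\infty\right]$$ is a solution of the Yukawa--Dirichlet problem $\Delta u=\mu^2u$ on $D$, $u=f$ on $\partial D$. (2) If moreover $D$ is small, then the function in (1) is the only bounded solution of this Yukawa--Dirichlet problem. (3) Consequently, for $x\in D$, the $\mu$-panharmonic measure admits the representation $$H^x_\mu(D;\mathrm{d}y)=\int_0^\infty e^{-\frac{\mu^2}{2}t}\,h^x(D;\mathrm{d}y,t)\,\mathrm{d}t,$$ where $h^x(D;\cdot,\cdot)$ is the harmonic kernel.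
   Context: $W$ is standard $n$-dimensional Brownian motion (generator $\frac12\Delta$), starting from $x$ under $\mathbb{P}^x$ (expectation $\mathbb{E}^x$; $\mathbb{E}^x[X;A]=\mathbb{E}^x[X\mathbf{1}_A]$). For a domain $D\subset\mathbb{R}^n$, $\tau_D=\inf\{t>0: W(t)\in D^c\}$, with $\inf\emptyset=\infty$. $D$ is regular if $\mathbb{P}^x[\tau_D=0]=1$ for all $x\in\partial D$. A regular domain $D$ is small if $\mathbb{P}^x[\tau_D<\infty]=1$ for all $x\in D$. A function is $\mu$-panharmonic on $D$ if it is $C^2$ on $D$ and satisfies the Yukawa equation $\Delta u=\mu^2u$ there. A solution of the Yukawa--Dirichlet problem with data $f$ is a continuous function on $\overline D$ which is $\mu$-panharmonic on $D$ and equals $f$ on $\partial D$. Harmonic measure ($\mu=0$) is the hitting measure $H^x(D;\mathrm{d}y)=H^x_0(D;\mathrm{d}y)=\mathbb{P}^x[W(\tau_D)\in\mathrm{d}y,\ \tau_D<\infty]$. The $\mu$-panharmonic measure on $\partial D$ with pole $x\in D$ (for $D$ small, or for $D$ regular and $\mu>0$) is the Borel measure $H^x_\mu(D;\cdot)$ on $\partial D$ such that $u(x)=\int_{\partial D}u(y)\,H^x_\mu(D;\mathrm{d}y)$ for every bounded continuous $u:\overline D\to\mathbb{R}$ that is $\mu$-panharmonic on $D$; for small $D$ and $\mu=0$ this agrees with the hitting measure. The harmonic kernel is $h^x(D;\mathrm{d}y,t)=\mathbb{P}^x[W(\tau_D)\in\mathrm{d}y\mid\tau_D=t]\cdot\frac{\mathrm{d}}{\mathrm{d}t}\mathbb{P}^x[\tau_D\le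 t]$, the product of a regular conditional distribution of $W(\tau_D)$ given $\tau_D=t$ and the Lebesgue density of the law of $\tau_D$ on $(0,\infty)$. *)

theory Defs
  imports "HOL-Probability.Probability"
begin

section \<open>Brownian motion and exit times\<close>

text \<open>Time is the half-line \<open>{0..}\<close>; values of \<open>W\<close> at negative times are irrelevant. The initial value
  is prescribed only almost surely, since one and the same \<open>W\<close> is to start from every \<open>x\<close> when the
  measure varies. Continuity holds for all paths, which makes exit times measurable without
  completing the \<open>\<sigma>\<close>-algebra. Each coordinate of \<open>W t - W s\<close> has variance \<open>t - s\<close>, so that the
  generator is one half of the Laplacian.\<close>

definition brownian_motion ::
  "'w measure \<Rightarrow> (real \<Rightarrow> 'w \<Rightarrow> 'a::euclidean_space) \<Rightarrow> 'a \<Rightarrow> bool" where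
  "brownian_motion M W x \<longleftrightarrow>
     prob_space M \<and>
     (\<forall>t\<ge>0. W t \<in> borel_measurable M) \<and>
     (AE \<omega> in M. W 0 \<omega> = x) \<and>
     (\<forall>\<omega>\<in>space M. continuous_on {0..} (\<lambda>t. W t \<omega>)) \<and>
     (\<forall>s t. 0 \<le> s \<and> s < t \<longrightarrow>
        distributed M lborel (\<lambda>\<omega>. W t \<omega> - W s \<omega>)
          (\<lambda>y. ennreal (\<Prod>b\<in>Basis. normal_density 0 (sqrt (t - s)) (y \<bullet> b)))) \<and>
     (\<forall>(t::nat \<Rightarrow> real) k. 0 \<le> t 0 \<and> incseq t \<longrightarrow>
        prob_space.indep_vars M (\<lambda>_. borel) (\<lambda>i \<omega>. W (t (Suc i)) \<omega> - W (t i) \<omega>) {..<k})"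

definition brownian_family ::
  "('a::euclidean_space \<Rightarrow> 'w measure) \<Rightarrow> (real \<Rightarrow> 'w \<Rightarrow> 'a) \<Rightarrow> bool" where
  "brownian_family P W \<longleftrightarrow> (\<forall>x. brownian_motion (P x) W x)"

text \<open>The infimum is taken in \<^typ>\<open>ennreal\<close>, where \<open>Inf {} = \<infinity>\<close>.\<close>

definition exit_time :: "(real \<Rightarrow> 'w \<Rightarrow> 'a) \<Rightarrow> 'a set \<Rightarrow> 'w \<Rightarrow> ennreal" where
  "exit_time W D \<omega> = Inf {ennreal t | t. 0 < t \<and> W t \<omega> \<notin> D}"

text \<open>Only meaningful where \<^const>\<open>exit_time\<close> is finite.\<close>

definition exit_point :: "(real \<Rightarrow> 'w \<Rightarrow> 'a) \<Rightarrow> 'a set \<Rightarrow> 'w \<Rightarrow> 'a" where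
  "exit_point W D \<omega> = W (enn2real (exit_time W D \<omega>)) \<omega>"


section \<open>Domains\<close>

definition domain :: "'a::topological_space set \<Rightarrow> bool" where
  "domain D \<longleftrightarrow> open D \<and> connected D \<and> D \<noteq> {}"

definition regular_domain ::
  "('a::topological_space \<Rightarrow> 'w measure) \<Rightarrow> (real \<Rightarrow> 'w \<Rightarrow> 'a) \<Rightarrow> 'a set \<Rightarrow> bool" where
  "regular_domain P W D \<longleftrightarrow>
     domain D \<and> (\<forall>x\<in>frontier D. \<P>(\<omega> in P x. exit_time W D \<omega> = 0) = 1)"

definition small_domain ::
  "('a::topological_space \<Rightarrow> 'w measure) \<Rightarrow> (real \<Rightarrow> 'w \<Rightarrow> 'a) \<Rightarrow> 'a set \<Rightarrow> bool" where
  "small_domain P W D \<longleftrightarrow>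
     regular_domain P W D \<and> (\<forall>x\<in>D. \<P>(\<omega> in P x. exit_time W D \<omega> < \<infinity>) = 1)"


section \<open>The Yukawa--Dirichlet problem\<close>

definition partial_deriv ::
  "'a::euclidean_space \<Rightarrow> ('a \<Rightarrow> real) \<Rightarrow> 'a \<Rightarrow> real" where
  "partial_deriv b u x = deriv (\<lambda>s. u (x + s *\<^sub>R b)) 0"

definition C1_on :: "'a::euclidean_space set \<Rightarrow> ('a \<Rightarrow> real) \<Rightarrow> bool" where
  "C1_on D u \<longleftrightarrow> continuous_on D u \<and>
     (\<forall>b\<in>Basis. (\<forall>x\<in>D. (\<lambda>s. u (x + s *\<^sub>R b)) differentiable (at 0)) \<and>
                continuous_on D (partial_deriv b u))"

definition C2_on :: "'a::euclidean_space set \<Rightarrow> ('a \<Rightarrow> real) \<Rightarrow> bool" where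
  "C2_on D u \<longleftrightarrow> C1_on D u \<and> (\<forall>b\<in>Basis. C1_on D (partial_deriv b u))"

definition laplacian :: "('a::euclidean_space \<Rightarrow> real) \<Rightarrow> 'a \<Rightarrow> real" where
  "laplacian u x = (\<Sum>b\<in>Basis. partial_deriv b (partial_deriv b u) x)"

definition panharmonic_on :: "real \<Rightarrow> 'a::euclidean_space set \<Rightarrow> ('a \<Rightarrow> real) \<Rightarrow> bool" where
  "panharmonic_on \<mu> D u \<longleftrightarrow> C2_on D u \<and> (\<forall>x\<in>D. laplacian u x = \<mu>\<^sup>2 * u x)"

definition yukawa_dirichlet_solution ::
  "real \<Rightarrow> 'a::euclidean_space set \<Rightarrow> ('a \<Rightarrow> real) \<Rightarrow> ('a \<Rightarrow> real) \<Rightarrow> bool" where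
  "yukawa_dirichlet_solution \<mu> D f u \<longleftrightarrow>
     continuous_on (closure D) u \<and> panharmonic_on \<mu> D u \<and> (\<forall>y\<in>frontier D. u y = f y)"

text \<open>Boundary data are functions on \<open>frontier D\<close>, while a HOL function \<open>f\<close> has unconstrained,
  possibly non-measurable values elsewhere. For \<open>x\<close> in the closure of \<open>D\<close> the exit point lies on
  the boundary almost surely on \<open>\<tau> < \<infinity>\<close>, so requiring this in the integrand only discards a null
  set, but without it the integrand need not be measurable and the Bochner integral could be
  spuriously zero.\<close>

definition yukawa_expectation ::
  "('a::euclidean_space \<Rightarrow> 'w measure) \<Rightarrow> (real \<Rightarrow> 'w \<Rightarrow> 'a) \<Rightarrow> real \<Rightarrow> 'a set \<Rightarrow> ('a \<Rightarrow> real) \<Rightarrow> 'a \<Rightarrow> real" where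
  "yukawa_expectation P W \<mu> D f x =
     (\<integral>\<omega>. (if exit_time W D \<omega> < \<infinity> \<and> exit_point W D \<omega> \<in> frontier D
           then exp (- (\<mu>\<^sup>2 / 2) * enn2real (exit_time W D \<omega>)) * f (exit_point W D \<omega>)
           else 0) \<partial>P x)"


section \<open>Panharmonic measures\<close>

text \<open>Measures on \<open>frontier D\<close> live on its Borel sets. As above, restricting to paths whose
  exit point is on the boundary discards only a null set when the motion starts in \<open>D\<close>.\<close>

definition hitting_measure ::
  "('a::topological_space \<Rightarrow> 'w measure) \<Rightarrow> (real \<Rightarrow> 'w \<Rightarrow> 'a) \<Rightarrow> 'a set \<Rightarrow> 'a \<Rightarrow> 'a measure" where
  "hitting_measure P W D x =
     distr (restrict_space (P x)
              {\<omega> \<in> space (P x). exit_time W D \<omega> < \<infinity> \<and> exit_point W D \<omega> \<in> frontier D})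
           (restrict_space borel (frontier D)) (exit_point W D)"

definition represents_panharmonic ::
  "real \<Rightarrow> 'a::euclidean_space set \<Rightarrow> 'a \<Rightarrow> 'a measure \<Rightarrow> bool" where
  "represents_panharmonic \<mu> D x H \<longleftrightarrow>
     sets H = sets (restrict_space borel (frontier D)) \<and>
     (\<forall>u. continuous_on (closure D) u \<and> bounded (u ` closure D) \<and> panharmonic_on \<mu> D u \<longrightarrow>
        integrable H u \<and> u x = (\<integral>y. u y \<partial>H))"

text \<open>If \<open>\<mu> = 0\<close> and \<open>D\<close> is not small, then bounded harmonic functions are not determined by
  their boundary values; harmonic measure is then the hitting measure by definition. If \<open>\<mu> = 0\<close> and
  \<open>D\<close> is small, the representing measure is used, and its being the hitting measure is a theorem.\<close>

definition panharmonic_measure ::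
  "('a::euclidean_space \<Rightarrow> 'w measure) \<Rightarrow> (real \<Rightarrow> 'w \<Rightarrow> 'a) \<Rightarrow> real \<Rightarrow> 'a set \<Rightarrow> 'a \<Rightarrow> 'a measure" where
  "panharmonic_measure P W \<mu> D x =
     (if small_domain P W D \<or> \<mu> > 0 then (THE H. represents_panharmonic \<mu> D x H)
      else hitting_measure P W D x)"


section \<open>The harmonic kernel\<close>

text \<open>The law of the exit time on the open half-line; mass at \<open>0\<close> and at \<open>\<infinity>\<close> is left out.\<close>

definition exit_time_law :: "'w measure \<Rightarrow> (real \<Rightarrow> 'w \<Rightarrow> 'a) \<Rightarrow> 'a set \<Rightarrow> real measure" where
  "exit_time_law M W D =
     distr (restrict_space M {\<omega> \<in> space M. 0 < exit_time W D \<omega> \<and> exit_time W D \<omega> < \<infinity>})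
           borel (\<lambda>\<omega>. enn2real (exit_time W D \<omega>))"

definition exit_time_density ::
  "'w measure \<Rightarrow> (real \<Rightarrow> 'w \<Rightarrow> 'a) \<Rightarrow> 'a set \<Rightarrow> (real \<Rightarrow> ennreal) \<Rightarrow> bool" where
  "exit_time_density M W D q \<longleftrightarrow>
     q \<in> borel_measurable borel \<and>
     exit_time_law M W D = density lborel (\<lambda>t. q t * indicator {0<..} t)"

text \<open>\<open>\<kappa> t\<close> is a version of the conditional law of the exit point given that the exit time is \<open>t\<close>.\<close>

definition exit_point_rcd ::
  "'w measure \<Rightarrow> (real \<Rightarrow> 'w \<Rightarrow> 'a::topological_space) \<Rightarrow> 'a set \<Rightarrow> (real \<Rightarrow> 'a measure) \<Rightarrow> bool" where
  "exit_point_rcd M W D \<kappa> \<longleftrightarrow>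
     \<kappa> \<in> borel \<rightarrow>\<^sub>M prob_algebra borel \<and>
     (\<forall>A\<in>sets borel. \<forall>B\<in>sets borel. B \<subseteq> {0<..} \<longrightarrow>
        emeasure M {\<omega> \<in> space M. exit_time W D \<omega> < \<infinity> \<and>
                      enn2real (exit_time W D \<omega>) \<in> B \<and> exit_point W D \<omega> \<in> A} =
        (\<integral>\<^sup>+t\<in>B. emeasure (\<kappa> t) A \<partial>exit_time_law M W D))"

text \<open>\<open>h t\<close> is the measure \<open>h(D; dy, t)\<close>. Both factors are determined only for almost every \<open>t\<close>,
  so the harmonic kernel is a predicate satisfied by all its versions.\<close>

definition harmonic_kernel ::
  "'w measure \<Rightarrow> (real \<Rightarrow> 'w \<Rightarrow> 'a::topological_space) \<Rightarrow> 'a set \<Rightarrow> (real \<Rightarrow> 'a measure) \<Rightarrow> bool" where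
  "harmonic_kernel M W D h \<longleftrightarrow>
     (\<exists>\<kappa> q. exit_point_rcd M W D \<kappa> \<and> exit_time_density M W D q \<and>
            (\<forall>t>0. h t = scale_measure (q t) (\<kappa> t)))"

end

theory Submission
  imports Defs
begin

text \<open>Write \<open>c = \<mu>\<^sup>2 / 2\<close> and \<open>P\<^sub>t\<close> for the heat semigroup. By the Markov property at the fixed time \<open>t\<close>,
  the function \<open>u\<close> differs from \<open>e\<^sup>-\<^sup>c\<^sup>t P\<^sub>t u\<close> at a point of \<open>D\<close> by at most a multiple of the probability of
  leaving \<open>D\<close> before \<open>t\<close>, and Ottaviani's inequality shows that this is \<open>O(t\<^sup>2)\<close>, locally uniformly.
  Since \<open>P\<^sub>t\<close> smooths, such an approximate eigenfunction is twice continuously differentiable with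
  \<open>\<Delta> u = 2 c u\<close>; neither the strong Markov property nor mean values over spheres are needed. The strong
  Feller property gives continuity at regular boundary points. Bounded solutions for \<open>\<mu> > 0\<close> are
  unique by the maximum principle with barrier \<open>\<Sum>\<^sub>b cosh (\<mu> x\<^sub>b)\<close>, and \<open>\<mu> = 0\<close> is the limit from
  positive parameters, smallness of \<open>D\<close> making the error vanish. Existence and uniqueness for all bounded
  continuous data determine the panharmonic measure, and conditioning on \<open>\<tau>\<close> turns it into the kernel
  representation.\<close>

section \<open>The heat semigroup\<close>

text \<open>The square in the exit bound drives the argument. Two derivatives of the heat operator
  at time \<open>t\<close> cost a factor \<open>1 / t\<close>, so an error of order
  \<open>t\<^sup>2\<close> leaves order \<open>t\<close>, which is summable along
  \<open>t = 2 ^ - n\<close>; an error of order \<open>t\<close> would leave no decay. The square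
  comes from fourth moments of Gaussian increments. The other obstacle is measurability in the
  starting point. The measures \<open>P x\<close> are not assumed to depend measurably on
  \<open>x\<close>, so the heat operator cannot be applied to the expectation directly. However, the
  increments after a fixed time have a law that depends neither on \<open>x\<close> nor on that
  time. On \<open>D\<close> the expectation is therefore rewritten as \<open>U\<close>, the integral
  over this one law of a jointly measurable function of starting point and increments; Fubini makes
  \<open>U\<close> Borel, and outside \<open>D\<close> it is 0. That function reads the path at
  rational times only, because a product sigma-algebra over all times would not contain the event of
  staying in \<open>D\<close>; continuity of the paths recovers the exit.\<close>

lemma has_real_derivative_integral:
  fixes F F' :: "real \<Rightarrow> 'b \<Rightarrow> real"
  assumes e: "e > 0"
    and int: "\<And>s. \<bar>s - s0\<bar> < e \<Longrightarrow> integrable M (F s)"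
    and der: "\<And>s z. \<bar>s - s0\<bar> < e \<Longrightarrow> z \<in> space M \<Longrightarrow> ((\<lambda>r. F r z) has_real_derivative F' s z) (at s)"
    and bnd: "\<And>s z. \<bar>s - s0\<bar> < e \<Longrightarrow> z \<in> space M \<Longrightarrow> \<bar>F' s z\<bar> \<le> w z"
    and w: "integrable M w"
    and meas: "F' s0 \<in> borel_measurable M"
  shows "((\<lambda>s. \<integral>z. F s z \<partial>M) has_real_derivative (\<integral>z. F' s0 z \<partial>M)) (at s0)"
  unfolding DERIV_def tendsto_at_iff_sequentially
proof (intro allI impI)
  fix X :: "nat \<Rightarrow> real"
  assume X0: "\<forall>i. X i \<in> UNIV - {0}" and X: "X \<longlonglongrightarrow> 0"
  from X e have "\<forall>\<^sub>F i in sequentially. \<bar>X i\<bar> < e"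
    by (simp add: tendsto_iff dist_real_def)
  then obtain N where N: "\<And>i. i \<ge> N \<Longrightarrow> \<bar>X i\<bar> < e"
    by (auto simp: eventually_sequentially)
  let ?Y = "\<lambda>i. X (i + N)"
  have Y: "\<bar>?Y i\<bar> < e" "?Y i \<noteq> 0" for i using N X0 by auto
  have Ylim: "?Y \<longlonglongrightarrow> 0" using X by (rule LIMSEQ_ignore_initial_segment)
  have "(\<lambda>i. \<integral>z. (F (s0 + ?Y i) z - F s0 z) / ?Y i \<partial>M) \<longlonglongrightarrow> (\<integral>z. F' s0 z \<partial>M)"
  proof (rule integral_dominated_convergence[where w=w])
    show "F' s0 \<in> borel_measurable M" by fact
    have "F (s0 + ?Y i) \<in> borel_measurable M" for i
      using int[of "s0 + ?Y i"] Y[of i] by auto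
    moreover have "F s0 \<in> borel_measurable M" using int[of s0] e by auto
    ultimately show "(\<lambda>z. (F (s0 + ?Y i) z - F s0 z) / ?Y i) \<in> borel_measurable M" for i
      by auto
    show "integrable M w" by fact
    show "AE z in M. (\<lambda>i. (F (s0 + ?Y i) z - F s0 z) / ?Y i) \<longlonglongrightarrow> F' s0 z"
    proof (rule AE_I2)
      fix z assume z: "z \<in> space M"
      have "((\<lambda>r. F r z) has_real_derivative F' s0 z) (at s0)" using der[of s0 z] e z by auto
      then have "(\<lambda>h. (F (s0 + h) z - F s0 z) / h) \<midarrow>0\<rightarrow> F' s0 z" by (simp add: DERIV_def)
      then show "(\<lambda>i. (F (s0 + ?Y i) z - F s0 z) / ?Y i) \<longlonglongrightarrow> F' s0 z"
        unfolding tendsto_at_iff_sequentially using Ylim Y by (auto simp: comp_def)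
    qed
    show "AE z in M. norm ((F (s0 + ?Y i) z - F s0 z) / ?Y i) \<le> w z" for i
    proof (rule AE_I2)
      fix z assume z: "z \<in> space M"
      \<comment> \<open>The mean value inequality turns the bound on the derivative, valid on a
        whole interval around \<open>s0\<close>, into a dominating function for the difference
        quotients.\<close>
      have "norm (F (s0 + ?Y i) z - F s0 z) \<le> w z * norm (s0 + ?Y i - s0)"
      proof (rule field_differentiable_bound[where S="ball s0 e" and f'="\<lambda>s. F' s z"])
        show "convex (ball s0 e)" by simp
        fix s assume "s \<in> ball s0 e"
        then have s: "\<bar>s - s0\<bar> < e" by (simp add: dist_real_def abs_minus_commute)
        show "((\<lambda>s. F s z) has_field_derivative F' s z) (at s within ball s0 e)"
          using der[OF s z] by (rule has_field_derivative_at_within)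
        show "norm (F' s z) \<le> w z" using bnd[OF s z] by simp
      qed (use Y[of i] e in \<open>auto simp: dist_real_def\<close>)
      then show "norm ((F (s0 + ?Y i) z - F s0 z) / ?Y i) \<le> w z"
        using Y(2)[of i] by (simp add: field_simps abs_divide)
    qed
  qed
  also have "(\<lambda>i. \<integral>z. (F (s0 + ?Y i) z - F s0 z) / ?Y i \<partial>M) =
      (\<lambda>i. ((\<integral>z. F (s0 + ?Y i) z \<partial>M) - (\<integral>z. F s0 z \<partial>M)) / ?Y i)"
    using int Y(1) e by (auto simp: Bochner_Integration.integral_diff)
  finally have "(\<lambda>i. ((\<integral>z. F (s0 + ?Y i) z \<partial>M) - (\<integral>z. F s0 z \<partial>M)) / ?Y i) \<longlonglongrightarrow> (\<integral>z. F' s0 z \<partial>M)" .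
  then show "((\<lambda>h. ((\<integral>z. F (s0 + h) z \<partial>M) - (\<integral>z. F s0 z \<partial>M)) / h) \<circ> X) \<longlonglongrightarrow> (\<integral>z. F' s0 z \<partial>M)"
    unfolding comp_def by (rule LIMSEQ_offset)
qed

section \<open>Gaussian measures: translation, moments, scaling, convolution\<close>

definition gauss :: "real \<Rightarrow> 'a::euclidean_space \<Rightarrow> real" where
  "gauss t z = (\<Prod>b\<in>Basis. normal_density 0 (sqrt t) (z \<bullet> b))"

definition normal_dist :: "real \<Rightarrow> 'a::euclidean_space measure" where
  "normal_dist t = density lborel (\<lambda>z. ennreal (gauss t z))"

lemma gauss_eq:
  fixes z :: "'a::euclidean_space"
  assumes "t > 0"
  shows "gauss t z = (1 / sqrt (2 * pi * t)) ^ DIM('a) * exp (- (z \<bullet> z) / (2 * t))"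
proof -
  have "gauss t z = (\<Prod>b\<in>(Basis::'a set). 1 / sqrt (2 * pi * t)) * (\<Prod>b\<in>Basis. exp (- (z \<bullet> b)\<^sup>2 / (2 * t)))"
    using assms unfolding gauss_def normal_density_def
    by (subst prod.distrib[symmetric]) simp
  also have "(\<Prod>b\<in>Basis. exp (- (z \<bullet> b)\<^sup>2 / (2 * t))) = exp (\<Sum>b\<in>Basis. - (z \<bullet> b)\<^sup>2 / (2 * t))"
    by (simp add: exp_sum)
  also have "(\<Sum>b\<in>Basis. - (z \<bullet> b)\<^sup>2 / (2 * t)) = - (z \<bullet> z) / (2 * t)"
    by (simp add: euclidean_inner[of z z] sum_divide_distrib sum_negf power2_eq_square)
  finally show ?thesis by simp
qed

lemma gauss_nonneg [simp]: "0 \<le> gauss t z"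
  unfolding gauss_def by (intro prod_nonneg) auto

lemma gauss_measurable [measurable]: "gauss t \<in> borel_measurable borel"
  unfolding gauss_def by measurable

lemma sets_normal_dist [measurable_cong, simp]: "sets (normal_dist t) = sets borel"
  by (simp add: normal_dist_def)

lemma space_normal_dist [simp]: "space (normal_dist t) = UNIV"
  by (simp add: normal_dist_def)

lemma nn_integral_gauss:
  assumes "t > 0"
  shows "(\<integral>\<^sup>+z. ennreal (gauss t z) \<partial>(lborel :: 'a::euclidean_space measure)) = 1"
proof -
  have "(\<integral>\<^sup>+z. ennreal (gauss t z) \<partial>(lborel :: 'a measure)) =
      (\<integral>\<^sup>+z. (\<Prod>b\<in>Basis. ennreal (normal_density 0 (sqrt t) (z \<bullet> b))) \<partial>(lborel :: 'a measure))"
    unfolding gauss_def by (simp add: prod_ennreal)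
  also have "\<dots> = (\<Prod>b\<in>(Basis::'a set). \<integral>\<^sup>+x. ennreal (normal_density 0 (sqrt t) x) \<partial>lborel)"
    by (rule nn_integral_lborel_prod) auto
  also have "(\<integral>\<^sup>+x. ennreal (normal_density 0 (sqrt t) x) \<partial>lborel) = 1"
    using assms by (subst nn_integral_eq_integral) auto
  finally show ?thesis by simp
qed

lemma prob_space_normal_dist: "t > 0 \<Longrightarrow> prob_space (normal_dist t :: 'a::euclidean_space measure)"
  by (rule prob_spaceI) (simp add: normal_dist_def emeasure_density nn_integral_gauss)

lemma integral_normal_dist:
  fixes F :: "'a::euclidean_space \<Rightarrow> real"
  assumes [measurable]: "F \<in> borel_measurable borel"
  shows "(\<integral>z. F z \<partial>normal_dist t) = (\<integral>z. gauss t z * F z \<partial>lborel)"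
  unfolding normal_dist_def by (subst integral_density) auto

lemma integrable_normal_dist:
  fixes F :: "'a::euclidean_space \<Rightarrow> real"
  assumes [measurable]: "F \<in> borel_measurable borel"
  shows "integrable (normal_dist t) F \<longleftrightarrow> integrable lborel (\<lambda>z. gauss t z * F z)"
  unfolding normal_dist_def by (subst integrable_density) auto

lemma gauss_shift:
  assumes "t > 0"
  shows "gauss t (z - w) = gauss t z * exp (z \<bullet> w / t - w \<bullet> w / (2 * t))"
proof -
  have "- ((z - w) \<bullet> (z - w)) / (2 * t) = - (z \<bullet> z) / (2 * t) + (z \<bullet> w / t - w \<bullet> w / (2 * t))"
    using assms by (simp add: inner_diff inner_commute field_simps)
  then show ?thesis using assms unfolding gauss_eq[OF assms] by (simp add: exp_add[symmetric])
qed

lemma lborel_integral_translation: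
  fixes F :: "'a::euclidean_space \<Rightarrow> real"
  assumes [measurable]: "F \<in> borel_measurable borel"
  shows "(\<integral>z. F (z + w) \<partial>lborel) = (\<integral>z. F z \<partial>lborel)"
    and "integrable lborel (\<lambda>z. F (z + w)) \<longleftrightarrow> integrable lborel F"
proof -
  have eq: "lborel = distr lborel borel (\<lambda>z. z + w)"
    using lborel_distr_plus[of w, symmetric] by (simp add: add.commute[of _ w])
  show "(\<integral>z. F (z + w) \<partial>lborel) = (\<integral>z. F z \<partial>lborel)"
    by (subst (2) eq) (simp add: integral_distr)
  show "integrable lborel (\<lambda>z. F (z + w)) \<longleftrightarrow> integrable lborel F"
    by (subst (2) eq) (simp add: integrable_distr_eq)
qed

text \<open>The Cameron-Martin formula in finite dimensions: translating the function amounts to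
  weighting the measure. It makes functions differentiable that are merely bounded and Borel, since
  the shift \<open>w\<close> then occurs only in a smooth weight.\<close>

lemma
  fixes F :: "'a::euclidean_space \<Rightarrow> real"
  assumes t: "t > 0" and [measurable]: "F \<in> borel_measurable borel"
  shows integral_normal_shift:
      "(\<integral>z. F (z + w) \<partial>normal_dist t) = (\<integral>z. F z * exp (z \<bullet> w / t - w \<bullet> w / (2 * t)) \<partial>normal_dist t)"
    and integrable_normal_shift:
      "integrable (normal_dist t) (\<lambda>z. F (z + w)) \<longleftrightarrow>
       integrable (normal_dist t) (\<lambda>z. F z * exp (z \<bullet> w / t - w \<bullet> w / (2 * t)))"
  using lborel_integral_translation[of "\<lambda>z. gauss t (z - w) * F z" w]
  by (simp_all add: integral_normal_dist integrable_normal_dist gauss_shift[OF t] ac_simps)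

text \<open>The shift formula for the constant 1 and the vector \<open>t *\<^sub>R w\<close> already
  contains this exponential, so no integral has to be computed.\<close>

lemma integrable_normal_exp:
  fixes w :: "'a::euclidean_space"
  assumes t: "t > 0"
  shows "integrable (normal_dist t) (\<lambda>z. exp (z \<bullet> w))"
proof -
  interpret prob_space "normal_dist t :: 'a measure" by (rule prob_space_normal_dist[OF t])
  have "integrable (normal_dist t) (\<lambda>z. exp (z \<bullet> (t *\<^sub>R w) / t - (t *\<^sub>R w) \<bullet> (t *\<^sub>R w) / (2 * t)))"
    using integrable_normal_shift[OF t, of "\<lambda>_. 1" "t *\<^sub>R w"] by simp
  then have "integrable (normal_dist t)
      (\<lambda>z. exp ((t *\<^sub>R w) \<bullet> (t *\<^sub>R w) / (2 * t)) * exp (z \<bullet> (t *\<^sub>R w) / t - (t *\<^sub>R w) \<bullet> (t *\<^sub>R w) / (2 * t)))"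
    by (rule integrable_mult_right)
  then show ?thesis using t by (simp add: exp_diff)
qed

text \<open>One term of the exponential series bounds \<open>norm z ^ (2 * k)\<close> by a multiple
  of \<open>exp ((norm z)\<^sup>2 / (4 * t))\<close>, and this exponential times the density of
  variance \<open>t\<close> is a multiple of the density of variance \<open>2 * t\<close>. The power
  \<open>k\<close> itself lies below 1 plus the power \<open>2 * k\<close>.\<close>

lemma integrable_normal_norm_power:
  assumes t: "t > 0"
  shows "integrable (normal_dist t) (\<lambda>z::'a::euclidean_space. norm z ^ k)"
proof -
  interpret prob_space "normal_dist t :: 'a measure" by (rule prob_space_normal_dist[OF t])
  have t2: "2 * t > 0" using t by simp
  have even: "integrable (normal_dist t) (\<lambda>z::'a. norm z ^ (2 * k))"
  proof (subst integrable_normal_dist, simp, rule Bochner_Integration.integrable_bound)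
    \<comment> \<open>The last factor is the ratio of the normalizing constants for the variances
      \<open>t\<close> and \<open>2 * t\<close>.\<close>
    let ?K = "fact k * (4 * t) ^ k * sqrt 2 ^ DIM('a)"
    show "integrable lborel (\<lambda>z::'a. ?K * gauss (2 * t) z)"
      using t by (intro integrable_mult_right integrableI_nonneg) (auto simp: nn_integral_gauss)
    show "AE z::'a in lborel. norm (gauss t z * norm z ^ (2 * k)) \<le> norm (?K * gauss (2 * t) z)"
    proof (rule AE_I2)
      fix z :: 'a
      let ?x = "(norm z)\<^sup>2 / (4 * t)"
      have x: "?x \<ge> 0" using t by simp
      have "(\<Sum>i\<in>{k}. ?x ^ i /\<^sub>R fact i) \<le> exp ?x"
        unfolding exp_def using x by (intro sum_le_suminf summable_exp_generic) auto
      then have *: "(norm z)\<^sup>2 ^ k \<le> fact k * (4 * t) ^ k * exp ?x"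
        using t by (simp add: field_simps power_divide)
      have e: "exp ?x * exp (- (z \<bullet> z) / (2 * t)) = exp (- (z \<bullet> z) / (2 * (2 * t)))"
        by (simp add: exp_add[symmetric] power2_norm_eq_inner field_simps)
      have s: "1 / sqrt (2 * pi * t) = sqrt 2 * (1 / sqrt (2 * pi * (2 * t)))"
        using t by (simp add: real_sqrt_mult field_simps)
      have "gauss t z * (norm z)\<^sup>2 ^ k \<le> gauss t z * (fact k * (4 * t) ^ k * exp ?x)"
        by (rule mult_left_mono[OF *]) simp
      also have "\<dots> = fact k * (4 * t) ^ k * ((1 / sqrt (2 * pi * t)) ^ DIM('a) * (exp ?x * exp (- (z \<bullet> z) / (2 * t))))"
        unfolding gauss_eq[OF t] by (simp only: ac_simps)
      also have "\<dots> = ?K * gauss (2 * t) z"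
        unfolding e s gauss_eq[OF t2] power_mult_distrib by (simp only: ac_simps)
      finally show "norm (gauss t z * norm z ^ (2 * k)) \<le> norm (?K * gauss (2 * t) z)"
        by (simp add: power_mult)
    qed
  qed simp
  show ?thesis
  proof (rule Bochner_Integration.integrable_bound)
    show "integrable (normal_dist t) (\<lambda>z::'a. 1 + norm z ^ (2 * k))" using even by simp
    have "r ^ k \<le> 1 + r ^ (2 * k)" if "r \<ge> 0" for r :: real
    proof -
      have "r ^ (2 * k) = (r ^ k)\<^sup>2" by (simp add: power_mult[symmetric] mult.commute)
      then have "2 * r ^ k \<le> 1 + r ^ (2 * k)"
        using zero_le_power2[of "r ^ k - 1"] by (simp add: power2_diff)
      moreover have "0 \<le> r ^ k" using that by simp
      ultimately show ?thesis by linarith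
    qed
    then show "AE z::'a in normal_dist t. norm (norm z ^ k) \<le> norm (1 + norm z ^ (2 * k))"
      by (auto intro!: AE_I2)
  qed simp
qed

lemma abs_integral_le:
  fixes f g :: "'b \<Rightarrow> real"
  assumes f: "integrable M f" and g: "integrable M g" and le: "\<And>x. x \<in> space M \<Longrightarrow> \<bar>f x\<bar> \<le> g x"
  shows "\<bar>\<integral>x. f x \<partial>M\<bar> \<le> (\<integral>x. g x \<partial>M)"
proof -
  have "\<bar>\<integral>x. f x \<partial>M\<bar> \<le> (\<integral>x. \<bar>f x\<bar> \<partial>M)"
    by (rule integral_abs_bound)
  also have "\<dots> \<le> (\<integral>x. g x \<partial>M)"
    by (rule integral_mono) (use f g le in auto)
  finally show ?thesis .
qed

text \<open>Time 1 suffices: Brownian scaling gives the moments at time \<open>t\<close> with the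
  factor \<open>sqrt t ^ k\<close>. The type argument names the space, which the real value does not
  show.\<close>

definition moment :: "'a::euclidean_space itself \<Rightarrow> nat \<Rightarrow> real" where
  "moment _ k = (\<integral>z. norm (z::'a) ^ k \<partial>normal_dist 1)"

lemma moment_nonneg: "0 \<le> moment TYPE('a::euclidean_space) k"
  unfolding moment_def by (rule Bochner_Integration.integral_nonneg) simp

lemma normal_dist_scale:
  assumes t: "t > 0"
  shows "(normal_dist t :: 'a::euclidean_space measure) = distr (normal_dist 1) borel (\<lambda>z. sqrt t *\<^sub>R z)"
proof (rule measure_eqI)
  fix A :: "'a set" assume "A \<in> sets (normal_dist t)"
  then have [measurable]: "A \<in> sets borel" by simp
  have st: "sqrt t \<noteq> 0" using t by simp
  have pre: "(\<lambda>z. sqrt t *\<^sub>R z) -` A \<in> sets borel"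
    by (rule measurable_sets_borel[of _ borel]) simp_all
  have g: "ennreal (gauss t (sqrt t *\<^sub>R z)) * ennreal (\<bar>sqrt t\<bar> ^ DIM('a)) = ennreal (gauss 1 z)" for z :: 'a
    using t by (subst ennreal_mult'[symmetric])
      (simp_all add: gauss_eq real_sqrt_mult power_divide power_mult_distrib mult.assoc[symmetric])
  have "emeasure (normal_dist t) A = (\<integral>\<^sup>+z. ennreal (gauss t z) * indicator A z \<partial>lborel)"
    by (simp add: normal_dist_def emeasure_density)
  also have "\<dots> = (\<integral>\<^sup>+z. ennreal (gauss t (sqrt t *\<^sub>R z)) * ennreal (\<bar>sqrt t\<bar> ^ DIM('a)) * indicator A (sqrt t *\<^sub>R z) \<partial>lborel)"
    by (subst lborel_affine[OF st, of 0]) (simp add: nn_integral_density nn_integral_distr ac_simps)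
  also have "\<dots> = (\<integral>\<^sup>+z. ennreal (gauss 1 z) * indicator ((\<lambda>z. sqrt t *\<^sub>R z) -` A) z \<partial>lborel)"
    unfolding g by (simp add: indicator_def)
  also have "\<dots> = emeasure (distr (normal_dist 1) borel (\<lambda>z. sqrt t *\<^sub>R z)) A"
    using pre by (subst emeasure_distr) (simp_all add: normal_dist_def emeasure_density)
  finally show "emeasure (normal_dist t) A = emeasure (distr (normal_dist 1) borel (\<lambda>z. sqrt t *\<^sub>R z)) A" .
qed simp

lemma integral_normal_scale:
  fixes F :: "'a::euclidean_space \<Rightarrow> real"
  assumes t: "t > 0" and [measurable]: "F \<in> borel_measurable borel"
  shows "(\<integral>z. F z \<partial>normal_dist t) = (\<integral>z. F (sqrt t *\<^sub>R z) \<partial>normal_dist 1)"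
  unfolding normal_dist_scale[OF t] by (simp add: integral_distr)

lemma normal_moment:
  assumes "t > 0"
  shows "(\<integral>z. norm (z::'a::euclidean_space) ^ k \<partial>normal_dist t) = sqrt t ^ k * moment TYPE('a) k"
  using assms by (subst integral_normal_scale) (simp_all add: moment_def power_mult_distrib)

text \<open>Given the sum \<open>z\<close>, the first summand is again Gaussian, as in a Brownian
  bridge, with mean \<open>(s / (s + t)) *\<^sub>R z\<close> and variance
  \<open>r = s * t / (s + t)\<close>. Completing the square thus splits the joint density into the
  density of the sum and a conditional density, and the latter integrates to 1.\<close>

lemma normal_dist_conv:
  assumes s: "s > 0" and t: "t > 0"
  shows "distr (normal_dist s \<Otimes>\<^sub>M normal_dist t) borel (\<lambda>(y, z). y + z) =
    (normal_dist (s + t) :: 'a::euclidean_space measure)"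
proof (rule measure_eqI)
  interpret S: prob_space "normal_dist s :: 'a measure" by (rule prob_space_normal_dist[OF s])
  interpret T: prob_space "normal_dist t :: 'a measure" by (rule prob_space_normal_dist[OF t])
  fix A :: "'a set" assume "A \<in> sets (distr (normal_dist s \<Otimes>\<^sub>M normal_dist t) borel (\<lambda>(y, z). y + z))"
  then have [measurable]: "A \<in> sets borel" by simp
  define r where "r = s * t / (s + t)"
  have r: "r > 0" using s t by (simp add: r_def)
  have gg: "gauss s y * gauss t (z - y) = gauss (s + t) z * gauss r (y - (s / (s + t)) *\<^sub>R z)" for y z :: 'a
  proof -
    have c: "(1 / sqrt (2 * pi * s)) * (1 / sqrt (2 * pi * t)) = (1 / sqrt (2 * pi * (s + t))) * (1 / sqrt (2 * pi * r))"
    proof -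
      have "(2 * pi * s) * (2 * pi * t) = (2 * pi * (s + t)) * (2 * pi * r)"
        using s t by (simp add: r_def)
      then have "sqrt (2 * pi * s) * sqrt (2 * pi * t) = sqrt (2 * pi * (s + t)) * sqrt (2 * pi * r)"
        by (metis real_sqrt_mult)
      then show ?thesis by (simp add: divide_simps)
    qed
    have e: "- (y \<bullet> y) / (2 * s) + - ((z - y) \<bullet> (z - y)) / (2 * t) =
        - (z \<bullet> z) / (2 * (s + t)) + - ((y - (s / (s + t)) *\<^sub>R z) \<bullet> (y - (s / (s + t)) *\<^sub>R z)) / (2 * r)"
    proof -
      define p q w where "p = y \<bullet> y" and "q = y \<bullet> z" and "w = z \<bullet> z"
      have st: "s + t \<noteq> 0" "s \<noteq> 0" "t \<noteq> 0" using s t by auto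
      have "(z - y) \<bullet> (z - y) = w - 2 * q + p"
        by (simp add: p_def q_def w_def inner_diff inner_commute)
      moreover have "(y - (s / (s + t)) *\<^sub>R z) \<bullet> (y - (s / (s + t)) *\<^sub>R z) = p - 2 * (s / (s + t)) * q + (s / (s + t))\<^sup>2 * w"
        by (simp add: p_def q_def w_def inner_diff inner_commute power2_eq_square algebra_simps)
      moreover have "- p / (2 * s) + - (w - 2 * q + p) / (2 * t) =
        - w / (2 * (s + t)) + - (p - 2 * (s / (s + t)) * q + (s / (s + t))\<^sup>2 * w) / (2 * r)"
        using st unfolding r_def by (simp add: divide_simps) (simp add: algebra_simps power2_eq_square)
      ultimately show ?thesis by (simp add: p_def w_def)
    qed
    have "gauss s y * gauss t (z - y) = ((1 / sqrt (2 * pi * s)) * (1 / sqrt (2 * pi * t))) ^ DIM('a) *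
        exp (- (y \<bullet> y) / (2 * s) + - ((z - y) \<bullet> (z - y)) / (2 * t))"
      unfolding gauss_eq[OF s] gauss_eq[OF t] exp_add power_mult_distrib by (simp only: ac_simps)
    also have "\<dots> = gauss (s + t) z * gauss r (y - (s / (s + t)) *\<^sub>R z)"
      unfolding c e gauss_eq[OF r] gauss_eq[OF add_pos_pos[OF s t]] exp_add power_mult_distrib by (simp only: ac_simps)
    finally show ?thesis .
  qed
  have tr: "(\<integral>\<^sup>+z. f z \<partial>lborel) = (\<integral>\<^sup>+z. f (z - y) \<partial>lborel)" if [measurable]: "f \<in> borel_measurable borel"
    for f :: "'a \<Rightarrow> ennreal" and y
    using nn_integral_distr[of "\<lambda>z. -y + z" "lborel :: 'a measure" borel f]
    unfolding lborel_distr_plus by simp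
  have "emeasure (distr (normal_dist s \<Otimes>\<^sub>M normal_dist t) borel (\<lambda>(y, z). y + z)) A =
      (\<integral>\<^sup>+p. indicator A (case p of (y, z) \<Rightarrow> y + z) \<partial>(normal_dist s \<Otimes>\<^sub>M normal_dist t))"
    by (subst nn_integral_distr[symmetric, where M'=borel and f="indicator A"]) (simp_all add: split_beta')
  also have "\<dots> = (\<integral>\<^sup>+y. \<integral>\<^sup>+z. indicator A (y + z) \<partial>normal_dist t \<partial>normal_dist s)"
    by (subst T.nn_integral_fst[symmetric]) (simp_all add: split_beta')
  also have "\<dots> = (\<integral>\<^sup>+y. gauss s y * (\<integral>\<^sup>+z. ennreal (gauss t z) * indicator A (y + z) \<partial>lborel) \<partial>lborel)"
    by (simp add: normal_dist_def nn_integral_density)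
  also have "\<dots> = (\<integral>\<^sup>+y. gauss s y * (\<integral>\<^sup>+z. ennreal (gauss t (z - y)) * indicator A z \<partial>lborel) \<partial>lborel)"
    using tr[of "\<lambda>z. ennreal (gauss t z) * indicator A (y + z)" y for y] by simp
  also have "\<dots> = (\<integral>\<^sup>+y. \<integral>\<^sup>+z. ennreal (gauss s y * gauss t (z - y)) * indicator A z \<partial>lborel \<partial>lborel)"
    by (simp add: nn_integral_cmult[symmetric] ennreal_mult ac_simps)
  also have "\<dots> = (\<integral>\<^sup>+z. \<integral>\<^sup>+y. ennreal (gauss s y * gauss t (z - y)) * indicator A z \<partial>lborel \<partial>lborel)"
    by (rule lborel_pair.Fubini') simp
  also have "\<dots> = (\<integral>\<^sup>+z. \<integral>\<^sup>+y. ennreal (gauss (s + t) z) * indicator A z * ennreal (gauss r (y - (s / (s + t)) *\<^sub>R z)) \<partial>lborel \<partial>lborel)"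
    unfolding gg by (simp add: ennreal_mult ac_simps)
  also have "\<dots> = (\<integral>\<^sup>+z. ennreal (gauss (s + t) z) * indicator A z * (\<integral>\<^sup>+y. ennreal (gauss r (y - (s / (s + t)) *\<^sub>R z)) \<partial>lborel) \<partial>lborel)"
    by (simp add: nn_integral_cmult)
  also have "\<dots> = (\<integral>\<^sup>+z. ennreal (gauss (s + t) z) * indicator A z \<partial>lborel)"
    using tr[of "\<lambda>z. ennreal (gauss r z)" y for y] by (simp add: nn_integral_gauss[OF r])
  also have "\<dots> = emeasure (normal_dist (s + t)) A"
    by (simp add: normal_dist_def emeasure_density)
  finally show "emeasure (distr (normal_dist s \<Otimes>\<^sub>M normal_dist t) borel (\<lambda>(y, z). y + z)) A = emeasure (normal_dist (s + t)) A" .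
qed simp

section \<open>The heat operators and their spatial derivatives\<close>

definition heat :: "real \<Rightarrow> ('a::euclidean_space \<Rightarrow> real) \<Rightarrow> 'a \<Rightarrow> real" where
  "heat t h x = (\<integral>z. h (x + z) \<partial>normal_dist t)"

text \<open>The derivative of \<open>heat t h\<close> in direction \<open>v\<close>, with the
  differentiation already moved onto the Gaussian weight, so that it makes sense for functions
  without any smoothness.\<close>

definition heat_deriv :: "real \<Rightarrow> 'a::euclidean_space \<Rightarrow> ('a \<Rightarrow> real) \<Rightarrow> 'a \<Rightarrow> real" where
  "heat_deriv t v h x = (\<integral>z. h (x + z) * (z \<bullet> v / t) \<partial>normal_dist t)"

lemma heat_measurable [measurable]:
  assumes [measurable]: "h \<in> borel_measurable borel" and "t > 0"
  shows "heat t h \<in> borel_measurable borel"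
proof -
  interpret prob_space "normal_dist t :: 'a measure" by (rule prob_space_normal_dist[OF \<open>t > 0\<close>])
  show ?thesis unfolding heat_def by measurable
qed

lemma heat_deriv_measurable [measurable]:
  assumes [measurable]: "h \<in> borel_measurable borel" and "t > 0"
  shows "heat_deriv t v h \<in> borel_measurable borel"
proof -
  interpret prob_space "normal_dist t :: 'a measure" by (rule prob_space_normal_dist[OF \<open>t > 0\<close>])
  show ?thesis unfolding heat_deriv_def by measurable
qed

text \<open>No continuity is assumed, because the main instance \<open>U\<close> is cut off to 0
  outside \<open>D\<close> and may jump at the boundary. All smoothness comes from the
  operators.\<close>

locale bounded_borel =
  fixes h :: "'a::euclidean_space \<Rightarrow> real" and B :: real
  assumes meas [measurable]: "h \<in> borel_measurable borel" and bound: "\<And>x. \<bar>h x\<bar> \<le> B"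
begin

lemma bound_nonneg: "0 \<le> B"
  using bound[of 0] by linarith

lemma integrable_mult_bounded:
  fixes g :: "'a \<Rightarrow> real"
  assumes "integrable (normal_dist t) g"
  shows "integrable (normal_dist t) (\<lambda>z. h (x + z) * g z)"
proof (rule Bochner_Integration.integrable_bound)
  show "integrable (normal_dist t) (\<lambda>z. B * g z)" using assms by simp
  have [measurable]: "g \<in> borel_measurable borel" using assms by (auto dest: borel_measurable_integrable)
  show "(\<lambda>z. h (x + z) * g z) \<in> borel_measurable (normal_dist t)" by measurable
  show "AE z in normal_dist t. norm (h (x + z) * g z) \<le> norm (B * g z)"
    using bound bound_nonneg by (auto intro!: AE_I2 mult_right_mono simp: abs_mult)
qed

lemma integrable_heat: "t > 0 \<Longrightarrow> integrable (normal_dist t) (\<lambda>z. h (x + z))"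
  using integrable_mult_bounded[of t "\<lambda>_. 1" x] integrable_normal_norm_power[where 'a='a, of t 0] by simp

lemma integrable_inner:
  fixes v :: 'a shows "t > 0 \<Longrightarrow> integrable (normal_dist t) (\<lambda>z. z \<bullet> v)"
proof (rule Bochner_Integration.integrable_bound)
  assume "t > 0"
  then show "integrable (normal_dist t) (\<lambda>z::'a. norm v * norm z)"
    using integrable_normal_norm_power[where 'a='a, of t 1] by simp
  show "AE z in normal_dist t. norm (z \<bullet> v) \<le> norm (norm v * norm z)"
    by (auto intro!: AE_I2 simp: Cauchy_Schwarz_ineq2 mult.commute)
qed simp

lemma integrable_heat_deriv: "t > 0 \<Longrightarrow> integrable (normal_dist t) (\<lambda>z. h (x + z) * (z \<bullet> v / t))"
  by (rule integrable_mult_bounded) (use integrable_inner in simp)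

lemma heat_bound: "t > 0 \<Longrightarrow> \<bar>heat t h x\<bar> \<le> B"
proof -
  assume t: "t > 0"
  interpret prob_space "normal_dist t :: 'a measure" by (rule prob_space_normal_dist[OF t])
  have "\<bar>heat t h x\<bar> \<le> (\<integral>z. B \<partial>(normal_dist t :: 'a measure))"
    unfolding heat_def
    by (rule abs_integral_le) (use integrable_heat[OF t] bound in auto)
  then show ?thesis using prob_space by simp
qed

text \<open>One derivative costs \<open>1 / sqrt t\<close>: the first moment is of order
  \<open>sqrt t\<close>, and the weight divides it by \<open>t\<close>.\<close>

lemma heat_deriv_bound:
  assumes t: "t > 0"
  shows "\<bar>heat_deriv t v h x\<bar> \<le> B * norm v * moment TYPE('a) 1 / sqrt t"
proof -
  have "\<bar>heat_deriv t v h x\<bar> \<le> (\<integral>z. (B * norm v / t) * norm (z::'a) ^ 1 \<partial>normal_dist t)"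
    unfolding heat_deriv_def
  proof (rule abs_integral_le)
    show "integrable (normal_dist t) (\<lambda>z::'a. (B * norm v / t) * norm z ^ 1)"
      using integrable_normal_norm_power[OF t, of 1] by (intro integrable_mult_right)
    show "\<bar>h (x + z) * (z \<bullet> v / t)\<bar> \<le> (B * norm v / t) * norm z ^ 1" for z
    proof -
      have "\<bar>h (x + z) * (z \<bullet> v / t)\<bar> \<le> B * (norm z * norm v / t)"
        unfolding abs_mult using t bound bound_nonneg Cauchy_Schwarz_ineq2[of z v]
        by (intro mult_mono) (auto simp: divide_right_mono)
      then show ?thesis by (simp add: ac_simps)
    qed
  qed (rule integrable_heat_deriv[OF t])
  also have "\<dots> = B * norm v * moment TYPE('a) 1 * (sqrt t / t)"
    using normal_moment[where 'a='a, OF t, of 1] by simp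
  also have "sqrt t / t = 1 / sqrt t" using t by (simp add: real_div_sqrt field_simps)
  finally show ?thesis by simp
qed

lemma heat_has_deriv:
  assumes t: "t > 0"
  shows "((\<lambda>s. heat t h (x + s *\<^sub>R v)) has_real_derivative heat_deriv t v h (x + s0 *\<^sub>R v)) (at s0)"
proof -
  define y where "y = x + s0 *\<^sub>R v"
  let ?E = "\<lambda>s z. exp (s * (z \<bullet> v) / t - s\<^sup>2 * (v \<bullet> v) / (2 * t))"
  \<comment> \<open>With \<open>a\<close> and \<open>c\<close> as below and |s| < 1, the weight is
    at most \<open>exp a\<close>, and the factor produced by differentiating it is at most
    \<open>a + c\<close>, hence at most \<open>(1 + c) * exp a\<close>. The two exponentials
    together dominate \<open>exp (2 * a)\<close> for either sign of the inner product, and both are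
    integrable.\<close>
  let ?w = "\<lambda>z. B * (1 + v \<bullet> v / t) * (exp (z \<bullet> ((2 / t) *\<^sub>R v)) + exp (z \<bullet> ((- 2 / t) *\<^sub>R v)))"
  have tilt: "heat t h (y + s *\<^sub>R v) = (\<integral>z. h (y + z) * ?E s z \<partial>normal_dist t)" for s
    using integral_normal_shift[OF t, of "\<lambda>z. h (y + z)" "s *\<^sub>R v"]
    by (simp add: heat_def algebra_simps power2_eq_square)
  have int: "integrable (normal_dist t) (\<lambda>z. h (y + z) * ?E s z)" for s
  proof (rule integrable_mult_bounded)
    have "integrable (normal_dist t) (\<lambda>z. exp (z \<bullet> ((s / t) *\<^sub>R v)) * exp (- (s\<^sup>2 * (v \<bullet> v) / (2 * t))))"
      by (intro integrable_mult_left integrable_normal_exp t)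
    then show "integrable (normal_dist t) (?E s)"
      by (simp add: exp_add[symmetric])
  qed
  have "((\<lambda>s. \<integral>z. h (y + z) * ?E s z \<partial>normal_dist t) has_real_derivative
      (\<integral>z. h (y + z) * (?E 0 z * (z \<bullet> v / t - 0 * (v \<bullet> v) / t)) \<partial>normal_dist t)) (at 0)"
  proof (rule has_real_derivative_integral[where e=1 and w="?w" and F'="\<lambda>s z. h (y + z) * (?E s z * (z \<bullet> v / t - s * (v \<bullet> v) / t))"])
    show "((\<lambda>r. h (y + z) * ?E r z) has_real_derivative h (y + z) * (?E s z * (z \<bullet> v / t - s * (v \<bullet> v) / t))) (at s)" for s z
      using t by (auto intro!: derivative_eq_intros simp: field_simps)
    show "integrable (normal_dist t) ?w"
      by (intro integrable_mult_right Bochner_Integration.integrable_add integrable_normal_exp t)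
    show "\<bar>h (y + z) * (?E s z * (z \<bullet> v / t - s * (v \<bullet> v) / t))\<bar> \<le> ?w z" if s: "\<bar>s - 0\<bar> < 1" for s z
    proof -
      define a where "a = \<bar>z \<bullet> v\<bar> / t"
      define c where "c = v \<bullet> v / t"
      have a: "a \<ge> 0" and c: "c \<ge> 0" using t by (simp_all add: a_def c_def)
      have s1: "\<bar>s\<bar> \<le> 1" using s by simp
      have "s * (z \<bullet> v) / t \<le> \<bar>s\<bar> * \<bar>z \<bullet> v\<bar> / t"
        using t by (intro divide_right_mono) (auto simp: abs_mult[symmetric])
      also have "\<dots> \<le> a"
        unfolding a_def using t s1 by (intro divide_right_mono) (auto simp: mult_left_le_one_le)
      finally have "s * (z \<bullet> v) / t \<le> a" .
      moreover have "0 \<le> s\<^sup>2 * (v \<bullet> v) / (2 * t)" using t by simp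
      ultimately have "?E s z \<le> exp a" by (simp only: exp_le_cancel_iff)
      moreover have "\<bar>z \<bullet> v / t - s * (v \<bullet> v) / t\<bar> \<le> a + c"
      proof -
        have 1: "\<bar>s * (v \<bullet> v) / t\<bar> \<le> c"
          unfolding c_def using t s1 by (auto simp: abs_mult intro!: divide_right_mono mult_left_le_one_le)
        have 2: "\<bar>z \<bullet> v / t\<bar> = a" using t by (simp add: a_def)
        show ?thesis
          using add_mono[OF eq_refl[OF 2] 1] by (rule order_trans[OF abs_triangle_ineq4])
      qed
      moreover have "a + c \<le> (1 + c) * exp a"
      proof -
        have "a + c \<le> (1 + c) * (1 + a)" using a c by (simp add: algebra_simps)
        also have "\<dots> \<le> (1 + c) * exp a" using c by (intro mult_left_mono exp_ge_add_one_self) auto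
        finally show ?thesis .
      qed
      ultimately have "?E s z * \<bar>z \<bullet> v / t - s * (v \<bullet> v) / t\<bar> \<le> exp a * ((1 + c) * exp a)"
        by (intro mult_mono) auto
      also have "\<dots> = (1 + c) * exp (2 * a)" by (simp add: exp_add[symmetric])
      also have "exp (2 * a) \<le> exp (z \<bullet> ((2 / t) *\<^sub>R v)) + exp (z \<bullet> ((- 2 / t) *\<^sub>R v))"
        using t by (cases "z \<bullet> v \<ge> 0") (simp_all add: a_def)
      finally have *: "?E s z * \<bar>z \<bullet> v / t - s * (v \<bullet> v) / t\<bar> \<le>
          (1 + c) * (exp (z \<bullet> ((2 / t) *\<^sub>R v)) + exp (z \<bullet> ((- 2 / t) *\<^sub>R v)))"
        using c by (simp add: mult_left_mono)
      have "\<bar>h (y + z)\<bar> * (?E s z * \<bar>z \<bullet> v / t - s * (v \<bullet> v) / t\<bar>) \<le>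
          B * ((1 + c) * (exp (z \<bullet> ((2 / t) *\<^sub>R v)) + exp (z \<bullet> ((- 2 / t) *\<^sub>R v))))"
        by (rule mult_mono[OF bound *]) (use bound_nonneg in auto)
      then show ?thesis by (simp add: abs_mult c_def mult.assoc)
    qed
  qed (use int in simp_all)
  then have "((\<lambda>s. heat t h (y + s *\<^sub>R v)) has_real_derivative heat_deriv t v h y) (at 0)"
    unfolding tilt heat_deriv_def by simp
  then have "((\<lambda>s. heat t h (y + (s - s0) *\<^sub>R v)) has_real_derivative heat_deriv t v h y) (at s0)"
    using DERIV_shift[of "\<lambda>s. heat t h (y + (s - s0) *\<^sub>R v)" "heat_deriv t v h y" 0 s0] by simp
  moreover have "y + (s - s0) *\<^sub>R v = x + s *\<^sub>R v" for s by (simp add: y_def algebra_simps)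
  ultimately show ?thesis by (simp only: y_def[symmetric])
qed

lemma bounded_borel_heat: "t > 0 \<Longrightarrow> bounded_borel (heat t h) B"
  by unfold_locales (auto simp: heat_bound)

lemma bounded_borel_heat_deriv:
  "t > 0 \<Longrightarrow> bounded_borel (heat_deriv t v h) (B * norm v * moment TYPE('a) 1 / sqrt t)"
  by unfold_locales (use heat_deriv_bound in auto)

text \<open>The derivative bound along the segment from \<open>x\<close> to \<open>y\<close>. For
  merely bounded Borel functions this is the strong Feller property in quantitative form.\<close>

lemma heat_Lipschitz:
  assumes t: "t > 0"
  shows "\<bar>heat t h x - heat t h y\<bar> \<le> B * moment TYPE('a) 1 / sqrt t * norm (x - y)"
proof -
  define v where "v = y - x"
  have "norm (heat t h (x + 0 *\<^sub>R v) - heat t h (x + 1 *\<^sub>R v)) \<le> (B * norm v * moment TYPE('a) 1 / sqrt t) * norm (0 - 1 :: real)"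
  proof (rule field_differentiable_bound[where S=UNIV and f'="\<lambda>s. heat_deriv t v h (x + s *\<^sub>R v)"])
    show "((\<lambda>s. heat t h (x + s *\<^sub>R v)) has_field_derivative heat_deriv t v h (x + s *\<^sub>R v)) (at s within UNIV)" for s
      using heat_has_deriv[OF t] .
    show "norm (heat_deriv t v h (x + s *\<^sub>R v)) \<le> B * norm v * moment TYPE('a) 1 / sqrt t" for s
      using heat_deriv_bound[OF t] by simp
  qed auto
  then show ?thesis by (simp add: v_def norm_minus_commute ac_simps)
qed

lemma heat_continuous: 
  assumes t: "t > 0"
  shows "continuous_on A (heat t h)"
proof -
  let ?K = "B * moment TYPE('a) 1 / sqrt t"
  have K: "?K \<ge> 0" using t bound_nonneg moment_nonneg[where 'a='a] by auto
  have "?K-lipschitz_on A (heat t h)"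
    by (rule lipschitz_onI) (use heat_Lipschitz[OF t] K in \<open>auto simp: dist_norm\<close>)
  then show ?thesis by (rule lipschitz_on_continuous_on)
qed

lemma heat_semigroup:
  assumes s: "s > 0" and t: "t > 0"
  shows "heat s (heat t h) x = heat (s + t) h x"
proof -
  interpret S: prob_space "normal_dist s :: 'a measure" by (rule prob_space_normal_dist[OF s])
  interpret T: prob_space "normal_dist t :: 'a measure" by (rule prob_space_normal_dist[OF t])
  interpret P: pair_prob_space "normal_dist s :: 'a measure" "normal_dist t :: 'a measure" ..
  have "heat (s + t) h x = (\<integral>p. h (x + (case p of (y, z) \<Rightarrow> y + z)) \<partial>(normal_dist s \<Otimes>\<^sub>M normal_dist t))"
    unfolding heat_def normal_dist_conv[OF s t, symmetric] by (subst integral_distr) (simp_all add: split_beta')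
  also have "\<dots> = (\<integral>(y, z). h (x + (y + z)) \<partial>(normal_dist s \<Otimes>\<^sub>M normal_dist t))"
    by (simp add: split_beta')
  also have "\<dots> = (\<integral>y. \<integral>z. h (x + (y + z)) \<partial>normal_dist t \<partial>normal_dist s)"
  proof (rule P.integral_fst[symmetric])
    show "integrable (normal_dist s \<Otimes>\<^sub>M normal_dist t) (\<lambda>(y, z). h (x + (y + z)))"
      by (rule P.integrable_const_bound[where B=B]) (use bound in \<open>auto intro!: AE_I2 simp: split_beta'\<close>)
  qed
  also have "\<dots> = heat s (heat t h) x" by (simp add: heat_def add.assoc)
  finally show ?thesis by simp
qed

text \<open>Both sides are the derivative of \<open>heat (t + s) h\<close> in direction
  \<open>v\<close>: the right one directly, the left one by differentiating the semigroup law under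
  the outer integral. Uniqueness of derivatives replaces a computation with kernels.\<close>

lemma heat_heat_deriv:
  assumes s: "s > 0" and t: "t > 0"
  shows "heat t (heat_deriv s v h) x = heat_deriv (t + s) v h x"
proof -
  interpret T: prob_space "normal_dist t :: 'a measure" by (rule prob_space_normal_dist[OF t])
  interpret H: bounded_borel "heat s h" B by (rule bounded_borel_heat[OF s])
  interpret D: bounded_borel "heat_deriv s v h" "B * norm v * moment TYPE('a) 1 / sqrt s" by (rule bounded_borel_heat_deriv[OF s])
  have "((\<lambda>r. \<integral>z. heat s h (x + z + r *\<^sub>R v) \<partial>normal_dist t) has_real_derivative
      (\<integral>z. heat_deriv s v h (x + z + 0 *\<^sub>R v) \<partial>normal_dist t)) (at 0)"
  proof (rule has_real_derivative_integral[where e=1 and w="\<lambda>_. B * norm v * moment TYPE('a) 1 / sqrt s"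
      and F'="\<lambda>r z. heat_deriv s v h (x + z + r *\<^sub>R v)"])
    show "integrable (normal_dist t) (\<lambda>z. heat s h (x + z + r *\<^sub>R v))" for r
      using H.integrable_heat[OF t, of "x + r *\<^sub>R v"] by (simp add: ac_simps)
    show "((\<lambda>r. heat s h (x + z + r *\<^sub>R v)) has_real_derivative heat_deriv s v h (x + z + r *\<^sub>R v)) (at r)" for r z
      using heat_has_deriv[OF s, of "x + z"] .
    show "\<bar>heat_deriv s v h (x + z + r *\<^sub>R v)\<bar> \<le> B * norm v * moment TYPE('a) 1 / sqrt s" for r z
      by (rule D.bound)
    show "(\<lambda>z. heat_deriv s v h (x + z + 0 *\<^sub>R v)) \<in> borel_measurable (normal_dist t)"
      by measurable
  qed simp_all
  moreover have "(\<integral>z. heat s h (x + z + r *\<^sub>R v) \<partial>normal_dist t) = heat (t + s) h (x + r *\<^sub>R v)" for r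
    using heat_semigroup[OF t s, of "x + r *\<^sub>R v"] by (simp add: heat_def ac_simps)
  ultimately have "((\<lambda>r. heat (t + s) h (x + r *\<^sub>R v)) has_real_derivative heat t (heat_deriv s v h) x) (at 0)"
    by (simp add: heat_def)
  moreover have "((\<lambda>r. heat (t + s) h (x + r *\<^sub>R v)) has_real_derivative heat_deriv (t + s) v h x) (at 0)"
    using heat_has_deriv[of "t + s" x v 0] s t by simp
  ultimately show ?thesis by (rule DERIV_unique)
qed

lemma heat_deriv_heat:
  assumes s: "s > 0" and t: "t > 0"
  shows "heat_deriv t v (heat s h) x = heat_deriv (t + s) v h x"
proof -
  interpret H: bounded_borel "heat s h" B by (rule bounded_borel_heat[OF s])
  have "((\<lambda>r. heat (t + s) h (x + r *\<^sub>R v)) has_real_derivative heat_deriv t v (heat s h) x) (at 0)"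
    using H.heat_has_deriv[OF t, of x v 0] by (simp add: heat_semigroup[OF t s])
  moreover have "((\<lambda>r. heat (t + s) h (x + r *\<^sub>R v)) has_real_derivative heat_deriv (t + s) v h x) (at 0)"
    using heat_has_deriv[of "t + s" x v 0] s t by simp
  ultimately show ?thesis by (rule DERIV_unique)
qed

text \<open>One half of the time turns \<open>h\<close> into a bounded Borel derivative, the other
  half smooths that derivative.\<close>

lemma heat_deriv_continuous:
  assumes t: "t > 0"
  shows "continuous_on A (heat_deriv t v h)"
proof -
  interpret D: bounded_borel "heat_deriv (t/2) v h" "B * norm v * moment TYPE('a) 1 / sqrt (t/2)"
    by (rule bounded_borel_heat_deriv) (use t in simp)
  have "heat_deriv t v h = heat (t/2) (heat_deriv (t/2) v h)"
    using heat_heat_deriv[of "t/2" "t/2" v] t by (auto simp: fun_eq_iff)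
  then show ?thesis using D.heat_continuous[of "t/2" A] t by simp
qed

text \<open>Linearity in the direction. It is needed for the time derivative, where the integration
  variable itself becomes the direction.\<close>

lemma heat_deriv_sum:
  assumes t: "t > 0"
  shows "heat_deriv t v h x = (\<Sum>b\<in>Basis. (v \<bullet> b) * heat_deriv t b h x)"
proof -
  have "heat_deriv t v h x = (\<integral>z. (\<Sum>b\<in>Basis. (v \<bullet> b) * (h (x + z) * (z \<bullet> b / t))) \<partial>normal_dist t)"
    unfolding heat_deriv_def
    by (subst euclidean_inner) (simp add: sum_distrib_left sum_divide_distrib ac_simps)
  also have "\<dots> = (\<Sum>b\<in>Basis. (v \<bullet> b) * heat_deriv t b h x)"
    unfolding heat_deriv_def by (subst Bochner_Integration.integral_sum)
      (intro integrable_mult_right integrable_heat_deriv[OF t], simp)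
  finally show ?thesis .
qed

text \<open>Smoothing the first derivative for time \<open>p\<close> gives a function of
  \<open>p + q\<close> alone, and both sides are derivatives of that function. So the time may be
  distributed over two derivatives at will.\<close>

lemma heat_deriv2_cong:
  assumes "p > 0" "q > 0" "p' > 0" "q' > 0" "p + q = p' + q'"
  shows "heat_deriv p v (heat_deriv q w h) x = heat_deriv p' v (heat_deriv q' w h) x"
proof -
  interpret D: bounded_borel "heat_deriv q w h" "B * norm w * moment TYPE('a) 1 / sqrt q"
    by (rule bounded_borel_heat_deriv) fact
  interpret D': bounded_borel "heat_deriv q' w h" "B * norm w * moment TYPE('a) 1 / sqrt q'"
    by (rule bounded_borel_heat_deriv) fact
  have "heat p (heat_deriv q w h) = heat p' (heat_deriv q' w h)"
    using assms by (auto simp: heat_heat_deriv)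
  then show ?thesis
    using D.heat_has_deriv[of p x v 0] D'.heat_has_deriv[of p' x v 0] assms
    by (auto intro: DERIV_unique)
qed

end

section \<open>The heat equation and local estimates\<close>

context bounded_borel
begin

text \<open>Scaling puts the time into the argument: \<open>heat r (heat s h) x\<close> is the mean
  of \<open>heat s h (x + sqrt r *\<^sub>R z)\<close> over the standard normal law. The chain rule
  differentiates in direction \<open>z\<close>; expanding \<open>z\<close> in the basis and scaling
  back gives half the sum of the pure second derivatives. The inner \<open>heat s\<close> makes the
  integrand differentiable.\<close>

lemma heat_has_time_deriv:
  assumes s: "s > 0" and t: "t > 0"
  shows "((\<lambda>r. heat r (heat s h) x) has_real_derivative
      (\<Sum>b\<in>Basis. heat_deriv t b (heat_deriv s b h) x) / 2) (at t)"
proof -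
  interpret H: bounded_borel "heat s h" B by (rule bounded_borel_heat[OF s])
  define K where "K = B * moment TYPE('a) 1 / sqrt s"
  let ?D = "\<lambda>r z. heat_deriv s z h (x + sqrt r *\<^sub>R z) / (2 * sqrt r)"
  have sum: "heat_deriv s z h y = (\<Sum>b\<in>Basis. (z \<bullet> b) * heat_deriv s b h y)" for y z
    by (rule heat_deriv_sum[OF s])
  have [measurable]: "heat_deriv s b h \<in> borel_measurable borel" for b
    using heat_deriv_measurable[OF meas s] .
  have K: "K \<ge> 0" using bound_nonneg moment_nonneg[where 'a='a] s by (simp add: K_def)
  have "((\<lambda>r. \<integral>z. heat s h (x + sqrt r *\<^sub>R z) \<partial>normal_dist 1) has_real_derivative
      (\<integral>z. ?D t z \<partial>normal_dist 1)) (at t)"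
  \<comment> \<open>The radius \<open>t / 2\<close> keeps \<open>sqrt r\<close> away from 0, so that
    the factor \<open>1 / (2 * sqrt r)\<close> stays bounded.\<close>
  proof (rule has_real_derivative_integral[where e="t/2" and w="\<lambda>z. K / (2 * sqrt (t / 2)) * norm z ^ 1" and F'="?D"])
    fix r :: real assume "\<bar>r - t\<bar> < t / 2"
    then have r: "r > t / 2" by (simp add: abs_if split: if_splits)
    then have r0: "r > 0" using t by simp
    interpret N: prob_space "normal_dist 1 :: 'a measure" by (rule prob_space_normal_dist) simp
    show "integrable (normal_dist 1) (\<lambda>z. heat s h (x + sqrt r *\<^sub>R z))"
      by (rule N.integrable_const_bound[where B=B]) (use H.bound H.meas in auto)
    fix z :: 'a
    have "((\<lambda>r. heat s h (x + r *\<^sub>R z)) has_real_derivative heat_deriv s z h (x + sqrt r *\<^sub>R z)) (at (sqrt r))"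
      by (rule heat_has_deriv[OF s])
    from DERIV_chain2[OF this DERIV_real_sqrt[OF r0]]
    show "((\<lambda>r. heat s h (x + sqrt r *\<^sub>R z)) has_real_derivative ?D r z) (at r)"
      by (rule DERIV_cong) (simp add: divide_simps)
    have "\<bar>heat_deriv s z h (x + sqrt r *\<^sub>R z)\<bar> \<le> K * norm z"
      using heat_deriv_bound[OF s, of z] by (simp add: K_def ac_simps)
    moreover have "sqrt (t / 2) \<le> sqrt r" using r by simp
    ultimately have "\<bar>heat_deriv s z h (x + sqrt r *\<^sub>R z)\<bar> / (2 * sqrt r) \<le> K * norm z / (2 * sqrt (t / 2))"
      using t K by (intro frac_le) auto
    then show "\<bar>?D r z\<bar> \<le> K / (2 * sqrt (t / 2)) * norm z ^ 1"
      using r0 by (simp add: abs_divide)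
  next
    show "integrable (normal_dist 1) (\<lambda>z::'a. K / (2 * sqrt (t / 2)) * norm z ^ 1)"
      by (intro integrable_mult_right integrable_normal_norm_power) simp
    have "?D t = (\<lambda>z. (\<Sum>b\<in>Basis. (z \<bullet> b) * heat_deriv s b h (x + sqrt t *\<^sub>R z)) / (2 * sqrt t))"
      by (rule ext) (subst sum, rule refl)
    then show "?D t \<in> borel_measurable (normal_dist 1)" by simp
  qed (use t in simp)
  moreover have "(\<integral>z. ?D t z \<partial>normal_dist 1) = (\<Sum>b\<in>Basis. heat_deriv t b (heat_deriv s b h) x) / 2"
  proof -
    have "(\<integral>z. ?D t z \<partial>normal_dist 1) =
        (\<integral>z. (\<Sum>b\<in>Basis. heat_deriv s b h (x + sqrt t *\<^sub>R z) * ((sqrt t *\<^sub>R z) \<bullet> b / t) / 2) \<partial>normal_dist 1)"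
    proof (rule Bochner_Integration.integral_cong[OF refl])
      fix z :: 'a
      have "sqrt t / t = 1 / sqrt t" using t by (simp add: real_div_sqrt field_simps)
      then have "a * (sqrt t * c / t) / 2 = c * a / (2 * sqrt t)" for a c
        by (metis (no_types, opaque_lifting) mult.commute mult.left_commute mult_1 times_divide_eq_left times_divide_eq_right divide_divide_eq_left)
      then show "?D t z = (\<Sum>b\<in>Basis. heat_deriv s b h (x + sqrt t *\<^sub>R z) * ((sqrt t *\<^sub>R z) \<bullet> b / t) / 2)"
        by (subst sum) (simp add: sum_divide_distrib)
    qed
    also have "\<dots> = (\<integral>z. (\<Sum>b\<in>Basis. heat_deriv s b h (x + z) * (z \<bullet> b / t) / 2) \<partial>normal_dist t)"
      by (subst integral_normal_scale[OF t]) simp_all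
    also have "\<dots> = (\<Sum>b\<in>Basis. (\<integral>z. heat_deriv s b h (x + z) * (z \<bullet> b / t) / 2 \<partial>normal_dist t))"
    proof (rule Bochner_Integration.integral_sum)
      fix b :: 'a
      interpret D: bounded_borel "heat_deriv s b h" "B * norm b * moment TYPE('a) 1 / sqrt s"
        by (rule bounded_borel_heat_deriv[OF s])
      show "integrable (normal_dist t) (\<lambda>z. heat_deriv s b h (x + z) * (z \<bullet> b / t) / 2)"
        using D.integrable_heat_deriv[OF t] by (rule integrable_divide_zero)
    qed
    also have "\<dots> = (\<Sum>b\<in>Basis. heat_deriv t b (heat_deriv s b h) x) / 2"
      unfolding heat_deriv_def[of t] by (simp add: sum_divide_distrib)
    finally show ?thesis .
  qed
  ultimately have "((\<lambda>r. \<integral>z. heat s h (x + sqrt r *\<^sub>R z) \<partial>normal_dist 1) has_real_derivative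
      (\<Sum>b\<in>Basis. heat_deriv t b (heat_deriv s b h) x) / 2) (at t)" by (simp only:)
  then show ?thesis
  proof (rule has_field_derivative_transform_within_open[where S="{0<..}"])
    show "(\<integral>z. heat s h (x + sqrt r *\<^sub>R z) \<partial>normal_dist 1) = heat r (heat s h) x" if "r \<in> {0<..}" for r
      unfolding heat_def[of r] using that by (subst integral_normal_scale) auto
  qed (use t in auto)
qed

text \<open>Outside the ball of radius \<open>\<delta>\<close> the factor
  \<open>norm z ^ 4 / \<delta> ^ 4\<close> is at least 1. Its Gaussian mean is of order
  \<open>t\<^sup>2\<close>, so values of \<open>h\<close> far from \<open>x\<close> contribute no
  more than that, however large \<open>B\<close> is compared with \<open>\<eta>\<close>.\<close>

lemma local_bounds:
  assumes \<delta>: "\<delta> > 0" and loc: "\<And>y. y \<in> ball x \<delta> \<Longrightarrow> \<bar>h y\<bar> \<le> \<eta>" and t: "t > 0"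
  shows "\<bar>heat t h x\<bar> \<le> \<eta> + B * moment TYPE('a) 4 / \<delta> ^ 4 * t\<^sup>2"
    and "norm b = 1 \<Longrightarrow> \<bar>heat_deriv t b h x\<bar> \<le> (\<eta> * moment TYPE('a) 1 + B * moment TYPE('a) 5 / \<delta> ^ 4 * t\<^sup>2) / sqrt t"
proof -
  interpret N: prob_space "normal_dist t :: 'a measure" by (rule prob_space_normal_dist[OF t])
  have \<eta>: "\<eta> \<ge> 0" using loc[of x] \<delta> by simp
  have s4: "sqrt t ^ 4 = t\<^sup>2" using t by (simp add: power4_eq_xxxx power2_eq_square)
  have pt: "\<bar>h (x + z)\<bar> \<le> \<eta> + B / \<delta> ^ 4 * norm z ^ 4" for z
  proof (cases "norm z < \<delta>")
    case True
    then have "\<bar>h (x + z)\<bar> \<le> \<eta>" by (intro loc) (simp add: dist_norm)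
    then show ?thesis using bound_nonneg \<delta> by (smt (verit) divide_nonneg_nonneg mult_nonneg_nonneg zero_le_power norm_ge_zero)
  next
    case False
    then have "\<delta> ^ 4 \<le> norm z ^ 4" using \<delta> by (intro power_mono) auto
    then have "B * \<delta> ^ 4 \<le> B * norm z ^ 4" using bound_nonneg by (rule mult_left_mono)
    then have "B \<le> B / \<delta> ^ 4 * norm z ^ 4" using \<delta> by (simp add: field_simps)
    then show ?thesis using bound[of "x + z"] \<eta> by linarith
  qed
  have "\<bar>heat t h x\<bar> \<le> (\<integral>z. \<eta> + B / \<delta> ^ 4 * norm (z::'a) ^ 4 \<partial>normal_dist t)"
    unfolding heat_def
    by (rule abs_integral_le) (use integrable_heat[OF t] pt in \<open>auto intro!: integrable_mult_right integrable_normal_norm_power t\<close>)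
  also have "\<dots> = \<eta> + B / \<delta> ^ 4 * (\<integral>z. norm (z::'a) ^ 4 \<partial>normal_dist t)"
    using N.prob_space by (subst Bochner_Integration.integral_add)
     (auto intro!: integrable_mult_right integrable_normal_norm_power t)
  also have "\<dots> = \<eta> + B * moment TYPE('a) 4 / \<delta> ^ 4 * t\<^sup>2"
    using t by (subst normal_moment) (auto simp: s4)
  finally show "\<bar>heat t h x\<bar> \<le> \<eta> + B * moment TYPE('a) 4 / \<delta> ^ 4 * t\<^sup>2" .
  assume b: "norm b = 1"
  have "\<bar>heat_deriv t b h x\<bar> \<le> (\<integral>z. \<eta> / t * norm (z::'a) ^ 1 + B / \<delta> ^ 4 / t * norm z ^ 5 \<partial>normal_dist t)"
    unfolding heat_deriv_def
  proof (rule abs_integral_le)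
    show "\<bar>h (x + z) * (z \<bullet> b / t)\<bar> \<le> \<eta> / t * norm z ^ 1 + B / \<delta> ^ 4 / t * norm z ^ 5" for z :: 'a
    proof -
      have "\<bar>z \<bullet> b\<bar> \<le> norm z" using Cauchy_Schwarz_ineq2[of z b] b by simp
      then have "\<bar>z \<bullet> b / t\<bar> \<le> norm z / t" using t by (simp add: divide_right_mono)
      then have "\<bar>h (x + z) * (z \<bullet> b / t)\<bar> \<le> (\<eta> + B / \<delta> ^ 4 * norm z ^ 4) * (norm z / t)"
        unfolding abs_mult using pt[of z] by (intro mult_mono) auto
      also have "\<dots> = \<eta> / t * norm z ^ 1 + B / \<delta> ^ 4 / t * norm z ^ 5"
        by (simp add: algebra_simps eval_nat_numeral add_divide_distrib)
      finally show ?thesis .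
    qed
    show "integrable (normal_dist t) (\<lambda>z::'a. \<eta> / t * norm z ^ 1 + B / \<delta> ^ 4 / t * norm z ^ 5)"
      by (intro Bochner_Integration.integrable_add integrable_mult_right integrable_normal_norm_power t)
  qed (rule integrable_heat_deriv[OF t])
  also have "\<dots> = \<eta> / t * (sqrt t ^ 1 * moment TYPE('a) 1) + B / \<delta> ^ 4 / t * (sqrt t ^ 5 * moment TYPE('a) 5)"
    by (subst Bochner_Integration.integral_add)
      (intro integrable_mult_right integrable_normal_norm_power t, intro integrable_mult_right integrable_normal_norm_power t,
       simp only: integral_mult_right_zero normal_moment[OF t])
  also have "\<dots> = (\<eta> * moment TYPE('a) 1 + B * moment TYPE('a) 5 / \<delta> ^ 4 * t\<^sup>2) * (sqrt t / t)"
  proof -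
    have "sqrt t ^ 5 = sqrt t * t\<^sup>2" using s4 by (simp add: eval_nat_numeral)
    then show ?thesis using t \<delta> by (simp add: field_simps)
  qed
  also have "sqrt t / t = 1 / sqrt t" using t by (simp add: real_div_sqrt field_simps)
  finally show "\<bar>heat_deriv t b h x\<bar> \<le> (\<eta> * moment TYPE('a) 1 + B * moment TYPE('a) 5 / \<delta> ^ 4 * t\<^sup>2) / sqrt t"
    by simp
qed

end

text \<open>Each derivative divides by \<open>sqrt s\<close>, so a local size
  \<open>C * s\<^sup>2\<close> still leaves order \<open>s\<close> after two of them. The constant
  depends neither on \<open>w\<close> nor on the point or the time, as uniform convergence will
  require. The radius is \<open>2 * \<delta>\<close> because the local estimate is applied twice in
  succession, each time with radius \<open>\<delta>\<close>.\<close>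

lemma heat_derivs_small:
  fixes B C \<delta> :: real
  assumes B: "B \<ge> 0" and C: "C \<ge> 0" and \<delta>: "\<delta> > 0"
  obtains K where "K \<ge> 0"
    "\<And>w s (x::'a::euclidean_space) b b'. bounded_borel w B \<Longrightarrow> 0 < s \<Longrightarrow> s \<le> 1 \<Longrightarrow>
      (\<And>y. y \<in> ball x (2 * \<delta>) \<Longrightarrow> \<bar>w y\<bar> \<le> C * s\<^sup>2) \<Longrightarrow> b \<in> Basis \<Longrightarrow> b' \<in> Basis \<Longrightarrow>
      \<bar>heat s w x\<bar> \<le> K * s \<and> \<bar>heat_deriv s b w x\<bar> \<le> K * s \<and>
      \<bar>heat_deriv (s/2) b' (heat_deriv (s/2) b w) x\<bar> \<le> K * s"
proof -
  let ?M = "moment TYPE('a)"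
  have M: "?M k \<ge> 0" for k by (rule moment_nonneg)
  define K0 where "K0 = C + B * ?M 4 / \<delta> ^ 4"
  define K1 where "K1 = C * ?M 1 + B * ?M 5 / \<delta> ^ 4"
  define K2 where "K2 = 2 * K1 * ?M 1 + 2 * (B * ?M 1) * ?M 5 / \<delta> ^ 4"
  have K: "K0 \<ge> 0" "K1 \<ge> 0" "K2 \<ge> 0"
    using B C \<delta> M by (auto simp: K0_def K1_def K2_def)
  show thesis
  proof (rule that[of "K0 + K1 + K2"])
    show "K0 + K1 + K2 \<ge> 0" using K by simp
    fix w :: "'a \<Rightarrow> real" and s :: real and x b b' :: 'a
    assume w: "bounded_borel w B" and s: "0 < s" "s \<le> 1" and b: "b \<in> Basis" "b' \<in> Basis"
    assume loc: "\<And>y. y \<in> ball x (2 * \<delta>) \<Longrightarrow> \<bar>w y\<bar> \<le> C * s\<^sup>2"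
    interpret w: bounded_borel w B by (rule w)
    have nb: "norm b = 1" "norm b' = 1" using b by auto
    have s2: "s\<^sup>2 \<le> s" using s by (simp add: power2_eq_square mult_left_le)
    have loc': "\<bar>w z\<bar> \<le> C * s\<^sup>2" if "y \<in> ball x \<delta>" "z \<in> ball y \<delta>" for y z
    proof (rule loc)
      show "z \<in> ball x (2 * \<delta>)" using that dist_triangle[of x z y] by simp
    qed
    have xx: "x \<in> ball x \<delta>" using \<delta> by simp
    have 1: "\<bar>heat_deriv t b w y\<bar> \<le> K1 * s\<^sup>2 / sqrt t" if t: "0 < t" "t \<le> s" and y: "y \<in> ball x \<delta>" for t y
    proof -
      have "\<bar>heat_deriv t b w y\<bar> \<le> (C * s\<^sup>2 * ?M 1 + B * ?M 5 / \<delta> ^ 4 * t\<^sup>2) / sqrt t"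
        by (rule w.local_bounds(2)[OF \<delta> loc'[OF y] t(1) nb(1)])
      also have "\<dots> \<le> (C * s\<^sup>2 * ?M 1 + B * ?M 5 / \<delta> ^ 4 * s\<^sup>2) / sqrt t"
        using t B M \<delta> by (intro divide_right_mono add_left_mono mult_left_mono power_mono) auto
      also have "\<dots> = K1 * s\<^sup>2 / sqrt t" by (simp add: K1_def algebra_simps)
      finally show ?thesis .
    qed
    have sq: "s\<^sup>2 / sqrt s \<le> s"
    proof -
      have "s \<le> sqrt s" using s by (intro real_le_rsqrt) (rule s2)
      then have "s * s \<le> s * sqrt s" using s by (intro mult_left_mono) auto
      then show ?thesis using s by (simp add: divide_le_eq power2_eq_square)
    qed
    have a0: "\<bar>heat s w x\<bar> \<le> K0 * s"
    proof -
      have "\<bar>heat s w x\<bar> \<le> C * s\<^sup>2 + B * ?M 4 / \<delta> ^ 4 * s\<^sup>2"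
        by (rule w.local_bounds(1)[OF \<delta> loc'[OF xx] s(1)])
      also have "\<dots> = K0 * s\<^sup>2" by (simp add: K0_def algebra_simps)
      also have "\<dots> \<le> K0 * s" using K s2 by (intro mult_left_mono) auto
      finally show ?thesis .
    qed
    have a1: "\<bar>heat_deriv s b w x\<bar> \<le> K1 * s"
    proof -
      have "\<bar>heat_deriv s b w x\<bar> \<le> K1 * (s\<^sup>2 / sqrt s)" using 1[OF s(1) order_refl xx] by simp
      also have "\<dots> \<le> K1 * s" using K sq by (intro mult_left_mono) auto
      finally show ?thesis .
    qed
    have h: "s / 2 > 0" "s / 2 \<le> s" using s by auto
    \<comment> \<open>The first derivative at time \<open>s / 2\<close> is itself bounded and Borel,
      so the local estimate applies to it once more. Fact \<open>1\<close> is its local size; its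
      poor global bound enters only with the factor \<open>(s/2)\<^sup>2\<close>.\<close>
    interpret D: bounded_borel "heat_deriv (s/2) b w" "B * norm b * ?M 1 / sqrt (s/2)"
      by (rule w.bounded_borel_heat_deriv[OF h(1)])
    have a2: "\<bar>heat_deriv (s/2) b' (heat_deriv (s/2) b w) x\<bar> \<le> K2 * s"
    proof -
      have "\<bar>heat_deriv (s/2) b' (heat_deriv (s/2) b w) x\<bar> \<le>
          ((K1 * s\<^sup>2 / sqrt (s/2)) * ?M 1 + (B * norm b * ?M 1 / sqrt (s/2)) * ?M 5 / \<delta> ^ 4 * (s/2)\<^sup>2) / sqrt (s/2)"
        by (rule D.local_bounds(2)[OF \<delta> 1[OF h] h(1) nb(2)])
      also have "\<dots> = (K1 * s\<^sup>2 * ?M 1 + (B * ?M 1) * ?M 5 / \<delta> ^ 4 * (s/2)\<^sup>2) / (sqrt (s/2) * sqrt (s/2))"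
      proof -
        define q where "q = sqrt (s/2)"
        have "q > 0" using s by (simp add: q_def)
        then show ?thesis using \<delta> nb unfolding q_def[symmetric] by (simp add: divide_simps)
      qed
      also have "\<dots> = (K1 * s\<^sup>2 * ?M 1 + (B * ?M 1) * ?M 5 / \<delta> ^ 4 * (s/2)\<^sup>2) / (s/2)"
        using h(1) by simp
      also have "\<dots> = (2 * K1 * ?M 1 + (B * ?M 1) * ?M 5 / \<delta> ^ 4 / 2) * s"
        using s by (simp add: field_simps power2_eq_square)
      also have "\<dots> \<le> K2 * s"
      proof (rule mult_right_mono)
        have "0 \<le> (B * ?M 1) * ?M 5 / \<delta> ^ 4" using B M \<delta> by auto
        then show "2 * K1 * ?M 1 + (B * ?M 1) * ?M 5 / \<delta> ^ 4 / 2 \<le> K2" unfolding K2_def by simp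
      qed (use s in simp)
      finally show ?thesis .
    qed
    have "K0 * s \<le> (K0 + K1 + K2) * s" "K1 * s \<le> (K0 + K1 + K2) * s" "K2 * s \<le> (K0 + K1 + K2) * s"
      using K s by (auto intro!: mult_right_mono)
    then show "\<bar>heat s w x\<bar> \<le> (K0 + K1 + K2) * s \<and> \<bar>heat_deriv s b w x\<bar> \<le> (K0 + K1 + K2) * s \<and>
      \<bar>heat_deriv (s/2) b' (heat_deriv (s/2) b w) x\<bar> \<le> (K0 + K1 + K2) * s"
      using a0 a1 a2 by linarith
  qed
qed

section \<open>Limits of derivatives and the identification of the eigenfunction\<close>

lemma geometric_uniform_limit:
  fixes f :: "nat \<Rightarrow> 'a \<Rightarrow> real"
  assumes "\<And>n x. x \<in> U \<Longrightarrow> \<bar>f (Suc n) x - f n x\<bar> \<le> K * (1/2) ^ n"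
  shows "\<exists>l. uniform_limit U f l sequentially"
proof -
  have "uniform_limit U (\<lambda>n x. \<Sum>i<n. f (Suc i) x - f i x) (\<lambda>x. \<Sum>i. f (Suc i) x - f i x) sequentially"
    by (rule Weierstrass_m_test[where M="\<lambda>n. K * (1/2) ^ n"]) (use assms in \<open>auto intro!: summable_mult summable_geometric\<close>)
  then have "uniform_limit U (\<lambda>n x. f 0 x + (\<Sum>i<n. f (Suc i) x - f i x)) (\<lambda>x. f 0 x + (\<Sum>i. f (Suc i) x - f i x)) sequentially"
    by (intro uniform_limit_intros)
  moreover have "f 0 x + (\<Sum>i<n. f (Suc i) x - f i x) = f n x" for n x
    by (subst sum_lessThan_telescope) simp
  ultimately have "uniform_limit U f (\<lambda>x. f 0 x + (\<Sum>i. f (Suc i) x - f i x)) sequentially" by simp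
  then show ?thesis by blast
qed

text \<open>On a short segment through \<open>x\<close> inside \<open>U\<close> this is the
  one-dimensional theorem on differentiating a convergent sequence with uniformly convergent
  derivatives.\<close>

lemma directional_deriv_limit:
  fixes f f' :: "nat \<Rightarrow> 'a::real_normed_vector \<Rightarrow> real"
  assumes U: "open U" and x: "x \<in> U"
    and der: "\<And>n y. y \<in> U \<Longrightarrow> ((\<lambda>s. f n (y + s *\<^sub>R b)) has_real_derivative f' n y) (at 0)"
    and lim: "\<And>y. y \<in> U \<Longrightarrow> (\<lambda>n. f n y) \<longlonglongrightarrow> l y"
    and unif: "uniform_limit U f' l' sequentially"
  shows "((\<lambda>s. l (x + s *\<^sub>R b)) has_real_derivative l' x) (at 0)"
proof -
  have "open ((\<lambda>s::real. x + s *\<^sub>R b) -` U)"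
    by (intro open_vimage U continuous_intros)
  moreover have "(0::real) \<in> (\<lambda>s::real. x + s *\<^sub>R b) -` U" using x by simp
  ultimately obtain e where e: "e > 0" "\<And>s::real. s \<in> ball 0 e \<Longrightarrow> x + s *\<^sub>R b \<in> U"
    unfolding open_contains_ball by blast
  let ?S = "ball (0::real) e"
  have der': "((\<lambda>s. f n (x + s *\<^sub>R b)) has_derivative (\<lambda>h. f' n (x + s *\<^sub>R b) * h)) (at s within ?S)" if "s \<in> ?S" for n s
  proof -
    have "((\<lambda>r. f n (x + s *\<^sub>R b + r *\<^sub>R b)) has_real_derivative f' n (x + s *\<^sub>R b)) (at 0)"
      by (rule der) (use e that in auto)
    then have "((\<lambda>r. f n (x + s *\<^sub>R b + (r - s) *\<^sub>R b)) has_real_derivative f' n (x + s *\<^sub>R b)) (at s)"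
      using DERIV_shift[of "\<lambda>r. f n (x + s *\<^sub>R b + (r - s) *\<^sub>R b)" "f' n (x + s *\<^sub>R b)" 0 s] by simp
    moreover have "x + s *\<^sub>R b + (r - s) *\<^sub>R b = x + r *\<^sub>R b" for r by (simp add: algebra_simps)
    ultimately have "((\<lambda>r. f n (x + r *\<^sub>R b)) has_real_derivative f' n (x + s *\<^sub>R b)) (at s)" by simp
    then show ?thesis by (simp add: has_field_derivative_def has_derivative_at_withinI)
  qed
  have "\<exists>g. \<forall>s\<in>?S. (\<lambda>n. f n (x + s *\<^sub>R b)) \<longlonglongrightarrow> g s \<and> (g has_derivative (\<lambda>h. l' (x + s *\<^sub>R b) * h)) (at s within ?S)"
  proof (rule has_derivative_sequence)
    show "convex ?S" by simp
    show "0 \<in> ?S" using e by simp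
    show "(\<lambda>n. f n (x + 0 *\<^sub>R b)) \<longlonglongrightarrow> l x" using lim[OF x] by simp
    show "\<forall>\<^sub>F n in sequentially. \<forall>s\<in>?S. \<forall>h. norm (f' n (x + s *\<^sub>R b) * h - l' (x + s *\<^sub>R b) * h) \<le> \<epsilon> * norm h"
      if "\<epsilon> > 0" for \<epsilon>
    proof -
      have "\<forall>\<^sub>F n in sequentially. \<forall>y\<in>U. dist (f' n y) (l' y) < \<epsilon>"
        using unif that by (auto simp: uniform_limit_iff)
      then show ?thesis
      proof eventually_elim
        case (elim n)
        show ?case
        proof (intro ballI allI)
          fix s h :: real assume "s \<in> ?S"
          then have "dist (f' n (x + s *\<^sub>R b)) (l' (x + s *\<^sub>R b)) < \<epsilon>" using elim e by blast
          then have "\<bar>f' n (x + s *\<^sub>R b) - l' (x + s *\<^sub>R b)\<bar> * \<bar>h\<bar> \<le> \<epsilon> * \<bar>h\<bar>"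
            by (intro mult_right_mono) (auto simp: dist_real_def)
          then show "norm (f' n (x + s *\<^sub>R b) * h - l' (x + s *\<^sub>R b) * h) \<le> \<epsilon> * norm h"
            by (simp add: left_diff_distrib[symmetric] abs_mult)
        qed
      qed
    qed
  qed (rule der')
  then obtain g where g: "\<And>s. s \<in> ?S \<Longrightarrow> (\<lambda>n. f n (x + s *\<^sub>R b)) \<longlonglongrightarrow> g s"
      "\<And>s. s \<in> ?S \<Longrightarrow> (g has_derivative (\<lambda>h. l' (x + s *\<^sub>R b) * h)) (at s within ?S)" by blast
  have eq: "g s = l (x + s *\<^sub>R b)" if "s \<in> ?S" for s
    using LIMSEQ_unique[OF g(1)[OF that] lim[OF e(2)[OF that]]] .
  have "(g has_real_derivative l' x) (at 0)"
    using g(2)[of 0] e at_within_open[of 0 ?S] by (simp add: has_field_derivative_def)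
  then show ?thesis
    by (rule has_field_derivative_transform_within_open[where S="?S"]) (use e eq in auto)
qed

lemma directional_deriv_cong:
  fixes f g :: "'a::real_normed_vector \<Rightarrow> real"
  assumes U: "open U" and x: "x \<in> U" and eq: "\<And>y. y \<in> U \<Longrightarrow> f y = g y"
  shows "((\<lambda>s. f (x + s *\<^sub>R b)) has_real_derivative D) (at 0) \<longleftrightarrow> ((\<lambda>s. g (x + s *\<^sub>R b)) has_real_derivative D) (at 0)"
proof -
  have "open ((\<lambda>s::real. x + s *\<^sub>R b) -` U)"
    by (intro open_vimage U continuous_intros)
  moreover have "(0::real) \<in> (\<lambda>s::real. x + s *\<^sub>R b) -` U" using x by simp
  ultimately have "\<forall>\<^sub>F s in nhds (0::real). f (x + s *\<^sub>R b) = g (x + s *\<^sub>R b)"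
    unfolding eventually_nhds using eq by blast
  then show ?thesis by (intro DERIV_cong_ev) auto
qed

text \<open>\<open>partial_deriv b u\<close> is known to equal \<open>d1 b\<close> only inside
  \<open>U\<close>; openness allows the replacement before differentiating a second time.\<close>

lemma C2_on_intro:
  assumes U: "open U" and u: "continuous_on U u"
    and d1: "\<And>x b. x \<in> U \<Longrightarrow> b \<in> Basis \<Longrightarrow> ((\<lambda>s. u (x + s *\<^sub>R b)) has_real_derivative d1 b x) (at 0)"
    and c1: "\<And>b. b \<in> Basis \<Longrightarrow> continuous_on U (d1 b)"
    and d2: "\<And>x b b'. x \<in> U \<Longrightarrow> b \<in> Basis \<Longrightarrow> b' \<in> Basis \<Longrightarrow>
      ((\<lambda>s. d1 b (x + s *\<^sub>R b')) has_real_derivative d2 b b' x) (at 0)"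
    and c2: "\<And>b b'. b \<in> Basis \<Longrightarrow> b' \<in> Basis \<Longrightarrow> continuous_on U (d2 b b')"
  shows "C2_on U u" and "\<And>x. x \<in> U \<Longrightarrow> laplacian u x = (\<Sum>b\<in>Basis. d2 b b x)"
proof -
  have p1: "partial_deriv b u x = d1 b x" if "x \<in> U" "b \<in> Basis" for x b
    unfolding partial_deriv_def by (rule DERIV_imp_deriv[OF d1[OF that]])
  have d2': "((\<lambda>s. partial_deriv b u (x + s *\<^sub>R b')) has_real_derivative d2 b b' x) (at 0)"
    if "x \<in> U" "b \<in> Basis" "b' \<in> Basis" for x b b'
    using directional_deriv_cong[OF U that(1), of "partial_deriv b u" "d1 b" b'] p1 that d2 by blast
  have p2: "partial_deriv b' (partial_deriv b u) x = d2 b b' x" if "x \<in> U" "b \<in> Basis" "b' \<in> Basis" for x b b'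
    unfolding partial_deriv_def[of b'] by (rule DERIV_imp_deriv[OF d2'[OF that]])
  have "continuous_on U (partial_deriv b u)" if "b \<in> Basis" for b
    using c1[OF that] p1 that by (subst continuous_on_cong[of U U _ "d1 b"]) auto
  moreover have "continuous_on U (partial_deriv b' (partial_deriv b u))" if "b \<in> Basis" "b' \<in> Basis" for b b'
    using c2[OF that] p2 that by (subst continuous_on_cong[of U U _ "d2 b b'"]) auto
  ultimately show "C2_on U u"
    unfolding C2_on_def C1_on_def using u d1 d2'
    unfolding real_differentiable_def by blast
  show "laplacian u x = (\<Sum>b\<in>Basis. d2 b b x)" if "x \<in> U" for x
    unfolding laplacian_def using p2 that by (intro sum.cong) auto
qed

lemma heat_deriv_diff:
  assumes "bounded_borel f B" "bounded_borel g B'" and t: "t > 0"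
  shows "heat_deriv t v (\<lambda>y. f y - k * g y) x = heat_deriv t v f x - k * heat_deriv t v g x"
proof -
  interpret f: bounded_borel f B by fact
  interpret g: bounded_borel g B' by fact
  have "heat_deriv t v (\<lambda>y. f y - k * g y) x =
      (\<integral>z. f (x + z) * (z \<bullet> v / t) - k * (g (x + z) * (z \<bullet> v / t)) \<partial>normal_dist t)"
    unfolding heat_deriv_def by (rule Bochner_Integration.integral_cong[OF refl]) (simp only: left_diff_distrib mult.assoc)
  also have "\<dots> = heat_deriv t v f x - k * heat_deriv t v g x"
    unfolding heat_deriv_def
    by (subst Bochner_Integration.integral_diff)
      (intro f.integrable_heat_deriv t integrable_mult_right g.integrable_heat_deriv | simp)+
  finally show ?thesis .
qed

lemma heat_diff:
  assumes "bounded_borel f B" "bounded_borel g B'" and t: "t > 0"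
  shows "heat t (\<lambda>y. f y - k * g y) x = heat t f x - k * heat t g x"
proof -
  interpret f: bounded_borel f B by fact
  interpret g: bounded_borel g B' by fact
  show ?thesis
    unfolding heat_def
    by (subst Bochner_Integration.integral_diff)
      (intro f.integrable_heat t integrable_mult_right g.integrable_heat | simp)+
qed

lemma bounded_borel_diff:
  assumes "bounded_borel f B" "bounded_borel g B'" and k: "\<bar>k\<bar> \<le> 1"
  shows "bounded_borel (\<lambda>y. f y - k * g y) (B + B')"
proof
  interpret f: bounded_borel f B by fact
  interpret g: bounded_borel g B' by fact
  show "(\<lambda>y. f y - k * g y) \<in> borel_measurable borel" by measurable
  fix x
  have "\<bar>k * g x\<bar> \<le> 1 * B'" unfolding abs_mult using k g.bound by (intro mult_mono) auto
  then show "\<bar>f x - k * g x\<bar> \<le> B + B'" using f.bound[of x] by linarith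
qed

text \<open>With \<open>G t = e\<^sup>-\<^sup>c\<^sup>t P\<^sub>t h\<close>, the semigroup law gives \<open>G s - G (s + r) = e\<^sup>-\<^sup>c\<^sup>s P\<^sub>s (h - G r)\<close>, and
  \<open>h - G r\<close> is of order \<open>r\<^sup>2\<close> near the point. Hence \<open>G\<close> converges together with its derivatives up to
  the second order as \<open>t\<close> tends to \<open>0\<close>, and the limit satisfies \<open>\<Delta> h / 2 - c h = lim \<partial>\<^sub>t G = 0\<close>.\<close>

theorem eigenfunction_of_heat_approx:
  fixes h :: "'a::euclidean_space \<Rightarrow> real"
  assumes h: "bounded_borel h B" and C: "C \<ge> 0" and c: "c \<ge> 0" and \<delta>: "\<delta> > 0"
    and approx: "\<And>t y. 0 < t \<Longrightarrow> t \<le> 1 \<Longrightarrow> y \<in> ball a (3 * \<delta>) \<Longrightarrow> \<bar>h y - exp (- c * t) * heat t h y\<bar> \<le> C * t\<^sup>2"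
  shows "C2_on (ball a \<delta>) h" and "\<And>x. x \<in> ball a \<delta> \<Longrightarrow> laplacian h x = 2 * c * h x"
proof -
  interpret bounded_borel h B by (rule h)
  let ?U = "ball a \<delta>"
  define G where "G = (\<lambda>t x. exp (- c * t) * heat t h x)"
  define G1 where "G1 = (\<lambda>b t x. exp (- c * t) * heat_deriv t b h x)"
  \<comment> \<open>Each of the two derivatives receives half of the time; by
    \<open>heat_deriv2_cong\<close> the even split is only a normal form.\<close>
  define G2 where "G2 = (\<lambda>b b' t x. exp (- c * t) * heat_deriv (t/2) b' (heat_deriv (t/2) b h) x)"
  have B2: "B + B \<ge> 0" using bound_nonneg by simp
  obtain K where K: "K \<ge> 0" and Ks:
    "\<And>w s (x::'a) b b'. bounded_borel w (B + B) \<Longrightarrow> 0 < s \<Longrightarrow> s \<le> 1 \<Longrightarrow>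
      (\<And>y. y \<in> ball x (2 * \<delta>) \<Longrightarrow> \<bar>w y\<bar> \<le> C * s\<^sup>2) \<Longrightarrow> b \<in> Basis \<Longrightarrow> b' \<in> Basis \<Longrightarrow>
      \<bar>heat s w x\<bar> \<le> K * s \<and> \<bar>heat_deriv s b w x\<bar> \<le> K * s \<and>
      \<bar>heat_deriv (s/2) b' (heat_deriv (s/2) b w) x\<bar> \<le> K * s"
    using heat_derivs_small[OF B2 C \<delta>] by metis
  have diffs: "\<bar>G s x - G (s + r) x\<bar> \<le> K * s \<and> \<bar>G1 b s x - G1 b (s + r) x\<bar> \<le> K * s \<and>
      \<bar>G2 b b' s x - G2 b b' (s + r) x\<bar> \<le> K * s"
    if r: "0 < r" and rs: "r \<le> s" and s1: "s \<le> 1" and x: "x \<in> ?U" and b: "b \<in> Basis" and b': "b' \<in> Basis" for r s x b b'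
  proof -
    have s: "s > 0" and h2: "s/2 > 0" using r rs by auto
    define w where "w = (\<lambda>y. h y - exp (- c * r) * heat r h y)"
    have e: "\<bar>exp (- c * r)\<bar> \<le> 1" "\<bar>exp (- c * s)\<bar> \<le> 1" using c r s by auto
    have w: "bounded_borel w (B + B)"
      unfolding w_def by (intro bounded_borel_diff h bounded_borel_heat r e)
    have loc: "\<bar>w y\<bar> \<le> C * s\<^sup>2" if "y \<in> ball x (2 * \<delta>)" for y
    proof -
      have "y \<in> ball a (3 * \<delta>)" using that x dist_triangle[of a y x] by simp
      then have "\<bar>w y\<bar> \<le> C * r\<^sup>2" unfolding w_def using approx[of r y] r rs s1 by simp
      also have "\<dots> \<le> C * s\<^sup>2" using C r rs by (intro mult_left_mono power_mono) auto
      finally show ?thesis .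
    qed
    have ee: "exp (- c * (s + r)) = exp (- c * s) * exp (- c * r)"
      by (simp add: exp_add[symmetric] algebra_simps)
    have mono: "\<bar>exp (- c * s) * z\<bar> \<le> K * s" if "\<bar>z\<bar> \<le> K * s" for z
    proof -
      have "\<bar>exp (- c * s) * z\<bar> \<le> 1 * \<bar>z\<bar>"
        unfolding abs_mult using e by (intro mult_right_mono) auto
      then show ?thesis using that by simp
    qed
    have 0: "heat s w x = heat s h x - exp (- c * r) * heat (s + r) h x"
      unfolding w_def heat_diff[OF h bounded_borel_heat[OF r] s] heat_semigroup[OF s r] ..
    have 1: "heat_deriv t b w y = heat_deriv t b h y - exp (- c * r) * heat_deriv (t + r) b h y" if "t > 0" for t y
      unfolding w_def heat_deriv_diff[OF h bounded_borel_heat[OF r] that] heat_deriv_heat[OF r that] ..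
    have sr: "s/2 + r > 0" "(s + r)/2 > 0" using s r by auto
    have w1: "heat_deriv (s/2) b w = (\<lambda>y. heat_deriv (s/2) b h y - exp (- c * r) * heat_deriv (s/2 + r) b h y)"
      by (rule ext) (rule 1[OF h2])
    \<comment> \<open>Expanding \<open>w\<close> produces the uneven split into \<open>s/2\<close>
      and \<open>s/2 + r\<close>; it is rebalanced to match \<open>G2\<close> at time
      \<open>s + r\<close>.\<close>
    have 2: "heat_deriv (s/2) b' (heat_deriv (s/2) b w) x =
        heat_deriv (s/2) b' (heat_deriv (s/2) b h) x - exp (- c * r) * heat_deriv ((s + r)/2) b' (heat_deriv ((s + r)/2) b h) x"
      unfolding w1 heat_deriv_diff[OF bounded_borel_heat_deriv[OF h2] bounded_borel_heat_deriv[OF sr(1)] h2]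
      using heat_deriv2_cong[of "s/2" "s/2 + r" "(s + r)/2" "(s + r)/2" b' b x] h2 sr by (simp add: field_simps)
    have "G s x - G (s + r) x = exp (- c * s) * heat s w x"
      unfolding G_def 0 ee by (simp add: algebra_simps)
    moreover have "G1 b s x - G1 b (s + r) x = exp (- c * s) * heat_deriv s b w x"
      unfolding G1_def 1[OF s] ee by (simp add: algebra_simps)
    moreover have "G2 b b' s x - G2 b b' (s + r) x = exp (- c * s) * heat_deriv (s/2) b' (heat_deriv (s/2) b w) x"
      unfolding G2_def 2 ee by (simp add: algebra_simps)
    ultimately show ?thesis
      using mono Ks[OF w s s1 loc b b'] by simp
  qed
  \<comment> \<open>Along these times consecutive members are related by
    \<open>s = r = p (Suc n)\<close> and \<open>s + r = p n\<close>, the extreme case of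
    \<open>diffs\<close>, which makes the increments of \<open>G\<close>, \<open>G1\<close> and
    \<open>G2\<close> geometrically small.\<close>
  define p where "p n = (1/2::real) ^ n" for n :: nat
  have p: "p n > 0" "p n \<le> 1" "p (Suc n) + p (Suc n) = p n" "p (Suc n) \<le> p n" for n
    by (auto simp: p_def power_le_one)
  have p0: "p \<longlonglongrightarrow> 0" unfolding p_def by (rule LIMSEQ_realpow_zero) auto
  obtain b0 :: 'a where b0: "b0 \<in> Basis" using nonempty_Basis by blast
  have step: "\<bar>G (p (Suc n)) x - G (p n) x\<bar> \<le> K * (1/2) ^ n" "\<bar>G1 b (p (Suc n)) x - G1 b (p n) x\<bar> \<le> K * (1/2) ^ n"
      "\<bar>G2 b b' (p (Suc n)) x - G2 b b' (p n) x\<bar> \<le> K * (1/2) ^ n"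
    if "x \<in> ?U" "b \<in> Basis" "b' \<in> Basis" for n x b b'
  proof -
    have "K * p (Suc n) \<le> K * p n" by (rule mult_left_mono[OF p(4) K])
    then show "\<bar>G (p (Suc n)) x - G (p n) x\<bar> \<le> K * (1/2) ^ n" "\<bar>G1 b (p (Suc n)) x - G1 b (p n) x\<bar> \<le> K * (1/2) ^ n"
      "\<bar>G2 b b' (p (Suc n)) x - G2 b b' (p n) x\<bar> \<le> K * (1/2) ^ n"
      using diffs[OF p(1) order_refl p(2) that, of "Suc n"] unfolding p(3)
      by (simp_all add: p_def[symmetric])
  qed
  have "\<exists>l. uniform_limit ?U (\<lambda>n. G (p n)) l sequentially"
    by (rule geometric_uniform_limit) (rule step(1)[OF _ b0 b0])
  then obtain l0 where l0: "uniform_limit ?U (\<lambda>n. G (p n)) l0 sequentially" by blast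
  have "\<forall>b\<in>Basis. \<exists>l. uniform_limit ?U (\<lambda>n. G1 b (p n)) l sequentially"
    by (intro ballI geometric_uniform_limit) (rule step(2)[OF _ _ b0])
  then obtain l1 where l1: "\<And>b. b \<in> Basis \<Longrightarrow> uniform_limit ?U (\<lambda>n. G1 b (p n)) (l1 b) sequentially"
    by metis
  have "\<forall>b\<in>Basis. \<forall>b'\<in>Basis. \<exists>l. uniform_limit ?U (\<lambda>n. G2 b b' (p n)) l sequentially"
    by (intro ballI geometric_uniform_limit) (rule step(3))
  then obtain l2 where l2: "\<And>b b'. b \<in> Basis \<Longrightarrow> b' \<in> Basis \<Longrightarrow> uniform_limit ?U (\<lambda>n. G2 b b' (p n)) (l2 b b') sequentially"
    by metis
  have hlim: "(\<lambda>n. G (p n) x) \<longlonglongrightarrow> h x" if "x \<in> ?U" for x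
  proof (rule LIM_zero_cancel, rule Lim_null_comparison[where g="\<lambda>n. C * (p n)\<^sup>2"])
    show "\<forall>\<^sub>F n in sequentially. norm (G (p n) x - h x) \<le> C * (p n)\<^sup>2"
      using approx[of "p n" x for n] p that \<delta> by (auto simp: G_def abs_minus_commute intro!: always_eventually)
    have "(\<lambda>n. C * (p n)\<^sup>2) \<longlonglongrightarrow> C * 0\<^sup>2" by (intro tendsto_intros p0)
    then show "(\<lambda>n. C * (p n)\<^sup>2) \<longlonglongrightarrow> 0" by simp
  qed
  have l0h: "l0 x = h x" if "x \<in> ?U" for x
    using tendsto_uniform_limitI[OF l0 that] hlim[OF that] by (rule LIMSEQ_unique)
  have h2: "p n / 2 > 0" for n using p by simp
  have bb1: "bounded_borel (heat_deriv (p n/2) b h) (B * norm b * moment TYPE('a) 1 / sqrt (p n/2))" for n b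
    by (rule bounded_borel_heat_deriv[OF h2])
  have cont: "continuous_on ?U h"
  proof (subst continuous_on_cong[OF refl, of ?U h l0])
    show "continuous_on ?U l0"
      by (rule uniform_limit_theorem[OF _ l0])
        (use p in \<open>auto simp: G_def intro!: continuous_intros heat_continuous always_eventually\<close>)
  qed (use l0h in simp)
  have c1: "continuous_on ?U (l1 b)" if "b \<in> Basis" for b
    by (rule uniform_limit_theorem[OF _ l1[OF that]])
      (use p in \<open>auto simp: G1_def intro!: continuous_intros heat_deriv_continuous always_eventually\<close>)
  have c2: "continuous_on ?U (l2 b b')" if "b \<in> Basis" "b' \<in> Basis" for b b'
    by (rule uniform_limit_theorem[OF _ l2[OF that]])
      (use h2 in \<open>auto simp: G2_def intro!: continuous_intros bounded_borel.heat_deriv_continuous[OF bb1] always_eventually\<close>)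
  have d1: "((\<lambda>s. h (x + s *\<^sub>R b)) has_real_derivative l1 b x) (at 0)" if "x \<in> ?U" "b \<in> Basis" for x b
  proof (rule directional_deriv_limit[OF open_ball that(1) _ hlim l1[OF that(2)]])
    show "((\<lambda>s. G (p n) (y + s *\<^sub>R b)) has_real_derivative G1 b (p n) y) (at 0)" for n y
      unfolding G_def G1_def using heat_has_deriv[OF p(1), of n y b 0] by (intro DERIV_cmult) simp
  qed
  have d2: "((\<lambda>s. l1 b (x + s *\<^sub>R b')) has_real_derivative l2 b b' x) (at 0)" if "x \<in> ?U" "b \<in> Basis" "b' \<in> Basis" for x b b'
  proof (rule directional_deriv_limit[OF open_ball that(1) _ tendsto_uniform_limitI[OF l1[OF that(2)]] l2[OF that(2,3)]])
    show "((\<lambda>s. G1 b (p n) (y + s *\<^sub>R b')) has_real_derivative G2 b b' (p n) y) (at 0)" for n y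
    proof -
      have "heat_deriv (p n) b h z = heat (p n/2) (heat_deriv (p n/2) b h) z" for z
        using heat_heat_deriv[OF h2[of n] h2[of n], of b z] by simp
      then show ?thesis
        unfolding G2_def G1_def using bounded_borel.heat_has_deriv[OF bb1[of n b] h2[of n], of y b' 0]
        by (intro DERIV_cmult) simp
    qed
  qed
  show "C2_on ?U h"
    by (rule C2_on_intro(1)[OF open_ball cont, where ?d1.0=l1 and ?d2.0=l2]) (fact d1 c1 d2 c2)+
  have lap: "laplacian h x = (\<Sum>b\<in>Basis. l2 b b x)" if x: "x \<in> ?U" for x
    by (rule C2_on_intro(2)[OF open_ball cont, where ?d1.0=l1 and ?d2.0=l2]) (fact d1 c1 d2 c2 x)+
  show "laplacian h x = 2 * c * h x" if x: "x \<in> ?U" for x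
  proof -
    \<comment> \<open>The time derivative of \<open>G\<close> at \<open>x\<close>, as the heat
      equation and the product rule show. The claim is that it tends to 0.\<close>
    define F' where "F' t = (\<Sum>b\<in>Basis. G2 b b t x) / 2 - c * G t x" for t
    have der: "((\<lambda>t. G t x) has_real_derivative F' t) (at t)" if t: "t > 0" for t
    proof -
      have t2: "t/2 > 0" using t by simp
      have "((\<lambda>r. heat r (heat (t/2) h) x) has_real_derivative
          (\<Sum>b\<in>Basis. heat_deriv (t/2) b (heat_deriv (t/2) b h) x) / 2) (at (t/2))"
        by (rule heat_has_time_deriv[OF t2 t2])
      then have "((\<lambda>r. heat (r + - (t/2)) (heat (t/2) h) x) has_real_derivative
          (\<Sum>b\<in>Basis. heat_deriv (t/2) b (heat_deriv (t/2) b h) x) / 2) (at t)"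
        using DERIV_shift[of "\<lambda>r. heat (r + - (t/2)) (heat (t/2) h) x" _ "t/2" "t/2"] by simp
      then have "((\<lambda>r. heat r h x) has_real_derivative
          (\<Sum>b\<in>Basis. heat_deriv (t/2) b (heat_deriv (t/2) b h) x) / 2) (at t)"
      proof (rule has_field_derivative_transform_within_open[where S="{t/2<..}"])
        show "heat (r + - (t/2)) (heat (t/2) h) x = heat r h x" if "r \<in> {t/2<..}" for r
          using that t by (subst heat_semigroup) auto
      qed (use t in auto)
      moreover have "((\<lambda>r. exp (- c * r)) has_real_derivative - c * exp (- c * t)) (at t)"
        by (auto intro!: derivative_eq_intros)
      ultimately have "((\<lambda>r. exp (- c * r) * heat r h x) has_real_derivative
          (- c * exp (- c * t)) * heat t h x + (\<Sum>b\<in>Basis. heat_deriv (t/2) b (heat_deriv (t/2) b h) x) / 2 * exp (- c * t)) (at t)"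
        by (rule DERIV_mult[rotated])
      then show ?thesis
        unfolding F'_def G_def G2_def by (rule DERIV_cong) (simp add: sum_distrib_left sum_distrib_right sum_divide_distrib mult.commute)
    qed
    \<comment> \<open>\<open>5 * C\<close> arises from
      \<open>C * (2 * e)\<^sup>2 + C * e\<^sup>2\<close> after division by the step
      \<open>e\<close>; the other two terms are the cost of moving from an intermediate time to
      \<open>e\<close> in the two parts of \<open>F'\<close>.\<close>
    define K' where "K' = 5 * C + DIM('a) * K / 2 + c * K"
    have small: "\<bar>F' (p (Suc n))\<bar> \<le> K' * p (Suc n)" for n
    proof -
      let ?e = "p (Suc n)"
      \<comment> \<open>At the times \<open>e\<close> and \<open>2 * e\<close> the value of
        \<open>G\<close> is within order \<open>e\<^sup>2\<close> of \<open>h x\<close>, so by the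
        mean value theorem \<open>F'\<close> is of order \<open>e\<close> at some time in between.
        \<open>diffs\<close> then transfers this to the time \<open>e\<close> itself.\<close>
      have "\<exists>\<xi>. ?e < \<xi> \<and> \<xi> < p n \<and> G (p n) x - G ?e x = (p n - ?e) * F' \<xi>"
        by (rule MVT2) (use p(1,3)[of n] p(1)[of "Suc n"] der in auto)
      then obtain \<xi> where \<xi>: "?e < \<xi>" "\<xi> < p n" "G (p n) x - G ?e x = ?e * F' \<xi>"
        using p(3)[of n] by (metis add_diff_cancel_left')
      have xx: "x \<in> ball a (3 * \<delta>)" using x \<delta> by simp
      have "\<bar>G (p n) x - G ?e x\<bar> \<le> C * (p n)\<^sup>2 + C * ?e\<^sup>2"
        using approx[OF p(1,2) xx, of n] approx[OF p(1,2) xx, of "Suc n"] unfolding G_def by linarith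
      also have "\<dots> = 5 * C * ?e * ?e"
        using p(3)[of n] by (simp add: power2_eq_square[symmetric]) (simp add: p_def power_divide power2_eq_square)
      finally have "?e * \<bar>F' \<xi>\<bar> \<le> ?e * (5 * C * ?e)" using \<xi>(3) p(1)[of "Suc n"] by (simp add: abs_mult ac_simps)
      then have 1: "\<bar>F' \<xi>\<bar> \<le> 5 * C * ?e" using p(1)[of "Suc n"] by simp
      define r where "r = \<xi> - ?e"
      have r: "0 < r" "r \<le> ?e" "?e + r = \<xi>" using \<xi> p(3)[of n] by (auto simp: r_def)
      note D = diffs[OF r(1,2) p(2) x, unfolded r(3)]
      have "\<bar>F' ?e - F' \<xi>\<bar> = \<bar>(\<Sum>b\<in>Basis. G2 b b ?e x - G2 b b \<xi> x) / 2 - c * (G ?e x - G \<xi> x)\<bar>"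
        unfolding F'_def by (simp add: sum_subtractf algebra_simps diff_divide_distrib)
      also have "\<dots> \<le> \<bar>\<Sum>b\<in>Basis. G2 b b ?e x - G2 b b \<xi> x\<bar> / 2 + c * \<bar>G ?e x - G \<xi> x\<bar>"
        using c abs_triangle_ineq4[of "(\<Sum>b\<in>Basis. G2 b b ?e x - G2 b b \<xi> x) / 2" "c * (G ?e x - G \<xi> x)"]
        by (simp add: abs_mult)
      also have "\<dots> \<le> (\<Sum>b\<in>(Basis::'a set). K * ?e) / 2 + c * (K * ?e)"
        using c D b0 by (intro add_mono divide_right_mono mult_left_mono order_trans[OF sum_abs] sum_mono) auto
      also have "\<dots> = (DIM('a) * K / 2 + c * K) * ?e" by (simp add: algebra_simps)
      finally show ?thesis using 1 unfolding K'_def by (simp add: algebra_simps)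
    qed
    have "(\<lambda>n. F' (p (Suc n))) \<longlonglongrightarrow> 0"
    proof (rule Lim_null_comparison[where g="\<lambda>n. K' * p (Suc n)"])
      show "\<forall>\<^sub>F n in sequentially. norm (F' (p (Suc n))) \<le> K' * p (Suc n)" using small by simp
      have "(\<lambda>n. K' * p (Suc n)) \<longlonglongrightarrow> K' * 0" by (intro tendsto_intros LIMSEQ_Suc p0)
      then show "(\<lambda>n. K' * p (Suc n)) \<longlonglongrightarrow> 0" by simp
    qed
    moreover have "(\<lambda>n. F' (p (Suc n))) \<longlonglongrightarrow> (\<Sum>b\<in>Basis. l2 b b x) / 2 - c * h x"
      unfolding F'_def
      by (intro tendsto_intros LIMSEQ_Suc[OF hlim[OF x]] LIMSEQ_Suc[OF tendsto_uniform_limitI[OF l2 x]]) auto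
    ultimately have "(\<Sum>b\<in>Basis. l2 b b x) / 2 - c * h x = 0" by (metis LIMSEQ_unique)
    then show ?thesis using lap[OF x] by simp
  qed
qed

section \<open>Increments of Brownian motion\<close>

definition rat_times :: "real set" where
  "rat_times = \<rat> \<inter> {0..}"

text \<open>Countably many coordinates, so that conditions imposed at all rational times are
  measurable.\<close>

definition path_space :: "(real \<Rightarrow> 'a::euclidean_space) measure" where
  "path_space = (\<Pi>\<^sub>M s\<in>rat_times. borel)"

text \<open>Increments instead of positions: their law is free of the starting point and of
  \<open>t\<close>. Positions are recovered by adding \<open>W t\<close>.\<close>

definition future :: "(real \<Rightarrow> 'w \<Rightarrow> 'a::euclidean_space) \<Rightarrow> real \<Rightarrow> 'w \<Rightarrow> real \<Rightarrow> 'a" where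
  "future W t \<omega> = (\<lambda>s\<in>rat_times. W (t + s) \<omega> - W t \<omega>)"

text \<open>Puts finitely many rational times on one uniform grid. The increments along such a grid
  are independent and identically distributed, and they determine every finite-dimensional
  distribution.\<close>

lemma common_denominator:
  assumes "finite J" "J \<subseteq> rat_times"
  shows "\<exists>N k. N > 0 \<and> (\<forall>j\<in>J. \<exists>i\<le>k. j = real i / real N)"
  using assms
proof (induction J rule: finite_induct)
  case empty
  then show ?case by (auto intro!: exI[of _ 1])
next
  case (insert j J)
  then obtain N k where N: "N > 0" "\<forall>j\<in>J. \<exists>i\<le>k. j = real i / real N" by auto
  have "j \<in> \<rat>" "j \<ge> 0" using insert by (auto simp: rat_times_def)
  then obtain m n :: nat where mn: "n \<noteq> 0" "j = real m / real n"
    using Rats_abs_nat_div_natE by (metis abs_of_nonneg)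
  have "\<exists>i\<le>k * n + m * N. j' = real i / real (N * n)" if "j' \<in> insert j J" for j'
  proof (cases "j' = j")
    case True
    have "real m / real n = real (m * N) / real (N * n)" using N(1) by simp
    then have "j' = real (m * N) / real (N * n)" unfolding True mn(2) .
    then show ?thesis by (intro exI[of _ "m * N"] conjI) simp_all
  next
    case False
    then have "j' \<in> J" using that by simp
    then obtain i where i: "i \<le> k" "j' = real i / real N" using N(2) by metis
    have "real i / real N = real (i * n) / real (N * n)" using mn(1) by simp
    then have "j' = real (i * n) / real (N * n)" unfolding i(2) .
    moreover have "i * n \<le> k * n + m * N" using i(1) by (simp add: trans_le_add1)
    ultimately show ?thesis by (intro exI[of _ "i * n"] conjI)
  qed
  moreover have "N * n > 0" using N(1) mn(1) by simp
  ultimately show ?case by blast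
qed

lemma future_in_cylinder_iff:
  assumes J: "J \<subseteq> rat_times" and E: "\<And>j. j \<in> J \<Longrightarrow> j = real (E j) / real N"
  shows "future W t \<omega> \<in> prod_emb rat_times (\<lambda>_. borel) J (Pi\<^sub>E J A) \<longleftrightarrow>
    (\<forall>j\<in>J. (\<Sum>l<E j. W (t + real (Suc l) / real N) \<omega> - W (t + real l / real N) \<omega>) \<in> A j)"
proof -
  have eq: "future W t \<omega> j = (\<Sum>l<E j. W (t + real (Suc l) / real N) \<omega> - W (t + real l / real N) \<omega>)"
    if "j \<in> J" for j
  proof -
    have "W (t + j) \<omega> - W t \<omega> = W (t + real (E j) / real N) \<omega> - W (t + real 0 / real N) \<omega>"
      by (subst (1) E[OF that]) simp
    also have "\<dots> = (\<Sum>l<E j. W (t + real (Suc l) / real N) \<omega> - W (t + real l / real N) \<omega>)"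
      by (rule sum_lessThan_telescope[symmetric])
    finally show ?thesis using J that by (simp add: future_def subsetD)
  qed
  have "future W t \<omega> \<in> prod_emb rat_times (\<lambda>_. borel) J (Pi\<^sub>E J A) \<longleftrightarrow> (\<forall>j\<in>J. future W t \<omega> j \<in> A j)"
  proof -
    have "future W t \<omega> \<in> extensional rat_times" by (simp add: future_def)
    then show ?thesis unfolding prod_emb_iff PiE_iff by simp
  qed
  also have "\<dots> \<longleftrightarrow> (\<forall>j\<in>J. (\<Sum>l<E j. W (t + real (Suc l) / real N) \<omega> - W (t + real l / real N) \<omega>) \<in> A j)"
    by (intro ball_cong refl) (simp only: eq)
  finally show ?thesis .
qed

text \<open>The index map \<open>g\<close> is the identity or \<open>Suc\<close>: in the proof of
  independence the index 0 is reserved for the increment from 0 to \<open>t\<close>.\<close>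

lemma cylinder_measurable:
  fixes E :: "real \<Rightarrow> nat"
  assumes J: "finite J" and E: "\<And>j. j \<in> J \<Longrightarrow> E j \<le> k" and A: "\<And>j. j \<in> J \<Longrightarrow> A j \<in> sets borel"
    and K: "\<And>l. l < k \<Longrightarrow> g l \<in> K"
  shows "{\<xi> \<in> space (\<Pi>\<^sub>M i\<in>K. borel). \<forall>j\<in>J. (\<Sum>l<E j. \<xi> (g l)) \<in> A j} \<in> sets (\<Pi>\<^sub>M i\<in>K. (borel :: 'a::euclidean_space measure))"
proof -
  have "(\<lambda>\<xi>. \<Sum>l<E j. \<xi> (g l)) \<in> (\<Pi>\<^sub>M i\<in>K. (borel :: 'a measure)) \<rightarrow>\<^sub>M borel" if "j \<in> J" for j
  proof (intro borel_measurable_sum measurable_component_singleton)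
    fix l assume "l \<in> {..<E j}"
    then have "l < k" using E[OF that] by simp
    then show "g l \<in> K" by (rule K)
  qed
  then have "{\<xi> \<in> space (\<Pi>\<^sub>M i\<in>K. borel). (\<Sum>l<E j. \<xi> (g l)) \<in> A j} \<in> sets (\<Pi>\<^sub>M i\<in>K. (borel :: 'a measure))" if "j \<in> J" for j
    using A[OF that] that by (auto intro!: measurable_sets_Collect)
  then show ?thesis by (rule sets.sets_Collect_finite_All[OF _ J])
qed

locale brownian = prob_space M
  for M :: "'w measure" and W :: "real \<Rightarrow> 'w \<Rightarrow> 'a::euclidean_space" and x :: 'a +
  assumes measurable_W: "0 \<le> t \<Longrightarrow> W t \<in> borel_measurable M"
    and W_0: "AE \<omega> in M. W 0 \<omega> = x"
    and continuous_W: "\<omega> \<in> space M \<Longrightarrow> continuous_on {0..} (\<lambda>t. W t \<omega>)"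
    and distr_increment: "0 \<le> s \<Longrightarrow> s < t \<Longrightarrow> distr M borel (\<lambda>\<omega>. W t \<omega> - W s \<omega>) = normal_dist (t - s)"
    and indep_increments: "0 \<le> (\<tau>::nat \<Rightarrow> real) 0 \<Longrightarrow> incseq \<tau> \<Longrightarrow>
      indep_vars (\<lambda>_. borel) (\<lambda>i \<omega>. W (\<tau> (Suc i)) \<omega> - W (\<tau> i) \<omega>) {..<k}"

lemma brownian_motion_imp_brownian:
  assumes "brownian_motion M W x"
  shows "brownian M W x"
proof -
  interpret prob_space M using assms by (simp add: brownian_motion_def)
  show ?thesis
  proof
    show "distr M borel (\<lambda>\<omega>. W t \<omega> - W s \<omega>) = normal_dist (t - s)" if "0 \<le> s" "s < t" for s t
    proof -
      have "distributed M lborel (\<lambda>\<omega>. W t \<omega> - W s \<omega>) (\<lambda>y. ennreal (gauss (t - s) y))"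
        using assms that unfolding brownian_motion_def gauss_def by blast
      then have "distr M lborel (\<lambda>\<omega>. W t \<omega> - W s \<omega>) = normal_dist (t - s)"
        unfolding normal_dist_def by (rule distributed_distr_eq_density)
      then show ?thesis by (simp cong: distr_cong)
    qed
  qed (use assms in \<open>auto simp: brownian_motion_def\<close>)
qed

context brownian
begin

lemma measurable_increment:
  "0 \<le> s \<Longrightarrow> 0 \<le> t \<Longrightarrow> (\<lambda>\<omega>. W t \<omega> - W s \<omega>) \<in> borel_measurable M"
  using measurable_W by (intro borel_measurable_diff) auto

lemma measurable_future: "0 \<le> t \<Longrightarrow> future W t \<in> M \<rightarrow>\<^sub>M path_space"
  unfolding future_def path_space_def
  by (intro measurable_restrict measurable_increment) (auto simp: rat_times_def)

lemma distr_grid_increments: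
  assumes t: "0 \<le> t" and N: "N > 0"
  defines "X \<equiv> (\<lambda>i \<omega>. W (t + real (Suc i) / real N) \<omega> - W (t + real i / real N) \<omega>)"
  shows "distr M (\<Pi>\<^sub>M i\<in>{..<Suc k}. borel) (\<lambda>\<omega>. \<lambda>i\<in>{..<Suc k}. X i \<omega>) = (\<Pi>\<^sub>M i\<in>{..<Suc k}. normal_dist (1 / real N))"
proof -
  have ind: "indep_vars (\<lambda>_. borel) X {..<Suc k}"
    unfolding X_def using t
    by (intro indep_increments[of "\<lambda>i. t + real i / real N"]) (auto simp: incseq_def divide_right_mono)
  have d: "distr M borel (X i) = normal_dist (1 / real N)" for i
  proof -
    have "t + real (Suc i) / real N - (t + real i / real N) = 1 / real N"
      by (simp add: diff_divide_distrib[symmetric])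
    moreover have "distr M borel (X i) = normal_dist (t + real (Suc i) / real N - (t + real i / real N))"
      unfolding X_def using t N by (intro distr_increment) (auto simp: divide_strict_right_mono)
    ultimately show ?thesis by simp
  qed
  have rv: "random_variable borel (X i)" for i
    unfolding X_def using t by (intro measurable_increment) auto
  \<comment> \<open>The index set \<open>{..<Suc k}\<close> is never empty, as the characterization
    of independence by product measures demands.\<close>
  show ?thesis
    using ind rv by (subst (asm) indep_vars_iff_distr_eq_PiM) (auto simp: d)
qed

text \<open>The right-hand side mentions neither \<open>M\<close> nor \<open>W\<close>,
  \<open>x\<close> or \<open>t\<close>; this is why all futures share one law.\<close>

lemma emeasure_future_cylinder:
  assumes t: "0 \<le> t" and N: "N > 0" and J: "finite J" "J \<subseteq> rat_times"
    and E: "\<And>j. j \<in> J \<Longrightarrow> j = real (E j) / real N" "\<And>j. j \<in> J \<Longrightarrow> E j \<le> k"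
    and A: "\<And>j. j \<in> J \<Longrightarrow> A j \<in> sets borel"
  shows "emeasure M (future W t -` prod_emb rat_times (\<lambda>_. borel) J (Pi\<^sub>E J A) \<inter> space M) =
    emeasure (\<Pi>\<^sub>M i\<in>{..<Suc k}. normal_dist (1 / real N))
      {\<xi> \<in> space (\<Pi>\<^sub>M i\<in>{..<Suc k}. borel). \<forall>j\<in>J. (\<Sum>l<E j. \<xi> l) \<in> A j}"
proof -
  let ?X = "\<lambda>i \<omega>. W (t + real (Suc i) / real N) \<omega> - W (t + real i / real N) \<omega>"
  let ?C = "{\<xi> \<in> space (\<Pi>\<^sub>M i\<in>{..<Suc k}. borel). \<forall>j\<in>J. (\<Sum>l<E j. \<xi> l) \<in> A j}"
  have C: "?C \<in> sets (\<Pi>\<^sub>M i\<in>{..<Suc k}. borel)"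
    by (rule cylinder_measurable[OF J(1) E(2) A]) auto
  have "emeasure (\<Pi>\<^sub>M i\<in>{..<Suc k}. normal_dist (1 / real N)) ?C =
      emeasure (distr M (\<Pi>\<^sub>M i\<in>{..<Suc k}. borel) (\<lambda>\<omega>. \<lambda>i\<in>{..<Suc k}. ?X i \<omega>)) ?C"
    by (simp only: distr_grid_increments[OF t N])
  also have "\<dots> = emeasure M ((\<lambda>\<omega>. \<lambda>i\<in>{..<Suc k}. ?X i \<omega>) -` ?C \<inter> space M)"
    using t by (intro emeasure_distr C measurable_restrict measurable_increment) auto
  also have "(\<lambda>\<omega>. \<lambda>i\<in>{..<Suc k}. ?X i \<omega>) -` ?C \<inter> space M =
      future W t -` prod_emb rat_times (\<lambda>_. borel) J (Pi\<^sub>E J A) \<inter> space M"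
  proof -
    have "(\<Sum>l<E j. (\<lambda>i\<in>{..<Suc k}. ?X i \<omega>) l) = (\<Sum>l<E j. ?X l \<omega>)" if "j \<in> J" for j \<omega>
      using E(2)[OF that] by (intro sum.cong) auto
    moreover have iff: "future W t \<omega> \<in> prod_emb rat_times (\<lambda>_. borel) J (Pi\<^sub>E J A) \<longleftrightarrow>
        (\<forall>j\<in>J. (\<Sum>l<E j. W (t + real (Suc l) / real N) \<omega> - W (t + real l / real N) \<omega>) \<in> A j)" for \<omega>
      by (rule future_in_cylinder_iff[OF J(2) E(1)])
    ultimately show ?thesis
      unfolding set_eq_iff Int_iff vimage_eq iff mem_Collect_eq
      by (simp add: space_PiM del: restrict_apply of_nat_Suc cong: conj_cong ball_cong)
  qed
  finally show ?thesis ..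
qed

text \<open>Only the single value \<open>W t\<close> is decoupled from the future, which is all that is used of the
  Markov property.\<close>

lemma indep_future_cylinder:
  assumes t: "0 \<le> t" and N: "N > 0" and J: "finite J" "J \<subseteq> rat_times"
    and E: "\<And>j. j \<in> J \<Longrightarrow> j = real (E j) / real N" "\<And>j. j \<in> J \<Longrightarrow> E j \<le> k"
    and A: "\<And>j. j \<in> J \<Longrightarrow> A j \<in> sets borel" and S: "S \<in> sets borel"
  defines "Z \<equiv> prod_emb rat_times (\<lambda>_. borel) J (Pi\<^sub>E J A)"
  shows "prob ({\<omega> \<in> space M. W t \<omega> - W 0 \<omega> \<in> S} \<inter> (future W t -` Z \<inter> space M)) =
    prob {\<omega> \<in> space M. W t \<omega> - W 0 \<omega> \<in> S} * prob (future W t -` Z \<inter> space M)"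
proof -
  \<comment> \<open>Time 0 is put in front of the grid that starts at \<open>t\<close>: the
    increment with index 0 is \<open>W t - W 0\<close>, those with positive index form the
    future.\<close>
  define \<tau> where "\<tau> i = (case i of 0 \<Rightarrow> 0 | Suc i \<Rightarrow> t + real i / real N)" for i
  let ?Y = "\<lambda>i \<omega>. W (\<tau> (Suc i)) \<omega> - W (\<tau> i) \<omega>"
  have inc: "incseq \<tau>"
    using t by (intro incseq_SucI) (auto simp: \<tau>_def divide_right_mono split: nat.split)
  have "indep_vars (\<lambda>_. borel) ?Y {..<Suc k}"
    by (rule indep_increments[OF _ inc]) (simp add: \<tau>_def)
  then have ind: "indep_var (PiM {0} (\<lambda>_. borel)) (\<lambda>\<omega>. restrict (\<lambda>i. ?Y i \<omega>) {0})
      (PiM {1..<Suc k} (\<lambda>_. borel)) (\<lambda>\<omega>. restrict (\<lambda>i. ?Y i \<omega>) {1..<Suc k})"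
    by (rule indep_var_restrict) auto
  let ?D = "{\<xi> \<in> space (PiM {0::nat} (\<lambda>_. borel :: 'a measure)). \<xi> 0 \<in> S}"
  let ?C = "{\<xi> \<in> space (PiM {1..<Suc k} (\<lambda>_. borel :: 'a measure)). \<forall>j\<in>J. (\<Sum>l<E j. \<xi> (Suc l)) \<in> A j}"
  have C0: "?D \<in> sets (PiM {0::nat} (\<lambda>_. borel :: 'a measure))"
    using S by (intro measurable_sets_Collect[OF measurable_component_singleton]) auto
  have C: "?C \<in> sets (PiM {1..<Suc k} (\<lambda>_. borel :: 'a measure))"
    by (rule cylinder_measurable[OF J(1) E(2) A]) auto
  have 0: "(\<lambda>\<omega>. restrict (\<lambda>i. ?Y i \<omega>) {0}) -` ?D \<inter> space M = {\<omega> \<in> space M. W t \<omega> - W 0 \<omega> \<in> S}"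
    by (auto simp: space_PiM \<tau>_def)
  have 1: "(\<lambda>\<omega>. restrict (\<lambda>i. ?Y i \<omega>) {1..<Suc k}) -` ?C \<inter> space M = future W t -` Z \<inter> space M"
  proof -
    have "(\<Sum>l<E j. restrict (\<lambda>i. ?Y i \<omega>) {1..<Suc k} (Suc l)) =
        (\<Sum>l<E j. W (t + real (Suc l) / real N) \<omega> - W (t + real l / real N) \<omega>)" if "j \<in> J" for j \<omega>
      using E(2)[OF that] by (intro sum.cong) (auto simp: \<tau>_def)
    moreover have iff: "future W t \<omega> \<in> prod_emb rat_times (\<lambda>_. borel) J (Pi\<^sub>E J A) \<longleftrightarrow>
        (\<forall>j\<in>J. (\<Sum>l<E j. W (t + real (Suc l) / real N) \<omega> - W (t + real l / real N) \<omega>) \<in> A j)" for \<omega>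
      by (rule future_in_cylinder_iff[OF J(2) E(1)])
    ultimately show ?thesis
      unfolding Z_def set_eq_iff Int_iff vimage_eq iff mem_Collect_eq
      by (simp add: space_PiM del: restrict_apply of_nat_Suc cong: conj_cong ball_cong)
  qed
  have "prob ((\<lambda>\<omega>. (restrict (\<lambda>i. ?Y i \<omega>) {0}, restrict (\<lambda>i. ?Y i \<omega>) {1..<Suc k})) -` (?D \<times> ?C) \<inter> space M) =
      prob {\<omega> \<in> space M. W t \<omega> - W 0 \<omega> \<in> S} * prob (future W t -` Z \<inter> space M)"
    using indep_varD[OF ind C0 C] unfolding 0 1 .
  moreover have "(\<lambda>\<omega>. (restrict (\<lambda>i. ?Y i \<omega>) {0}, restrict (\<lambda>i. ?Y i \<omega>) {1..<Suc k})) -` (?D \<times> ?C) \<inter> space M =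
      {\<omega> \<in> space M. W t \<omega> - W 0 \<omega> \<in> S} \<inter> (future W t -` Z \<inter> space M)"
    unfolding 0[symmetric] 1[symmetric] by blast
  ultimately show ?thesis by simp
qed

end

section \<open>The law of the future and its independence of the present value\<close>

lemma cylinder_in_path_space:
  assumes "finite J" "J \<subseteq> rat_times" "\<And>j. j \<in> J \<Longrightarrow> A j \<in> sets borel"
  shows "prod_emb rat_times (\<lambda>_. borel) J (Pi\<^sub>E J A) \<in> sets path_space"
  unfolding path_space_def by (rule sets_PiM_I) (use assms in auto)

lemma distr_future_unique:
  fixes W :: "real \<Rightarrow> 'w \<Rightarrow> 'a::euclidean_space" and W' :: "real \<Rightarrow> 'v \<Rightarrow> 'a"
  assumes "brownian M W x" "brownian M' W' x'" and t: "0 \<le> t" "0 \<le> t'"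
  shows "distr M path_space (future W t) = distr M' path_space (future W' t')"
proof -
  interpret A: brownian M W x by fact
  interpret B: brownian M' W' x' by fact
  note [measurable] = A.measurable_future[OF t(1)] B.measurable_future[OF t(2)]
  show ?thesis
  proof (rule measure_eqI_PiM_infinite[where I=rat_times and M="\<lambda>_. borel"])
    fix S J assume J: "finite J" "J \<subseteq> rat_times" and S: "\<And>i. i \<in> J \<Longrightarrow> S i \<in> sets (borel :: 'a measure)"
    obtain N k where N: "N > 0" "\<forall>j\<in>J. \<exists>i\<le>k. j = real i / real N" using common_denominator[OF J] by blast
    then obtain E where E: "\<And>j. j \<in> J \<Longrightarrow> j = real (E j) / real N" "\<And>j. j \<in> J \<Longrightarrow> E j \<le> k" by metis
    have Z: "prod_emb rat_times (\<lambda>_. borel) J (Pi\<^sub>E J S) \<in> sets path_space"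
      by (rule cylinder_in_path_space[OF J S])
    show "emeasure (distr M path_space (future W t)) (prod_emb rat_times (\<lambda>_. borel) J (Pi\<^sub>E J S)) =
        emeasure (distr M' path_space (future W' t')) (prod_emb rat_times (\<lambda>_. borel) J (Pi\<^sub>E J S))"
      using A.emeasure_future_cylinder[OF t(1) N(1) J E S] B.emeasure_future_cylinder[OF t(2) N(1) J E S] Z
      by (simp add: emeasure_distr)
  next
    show "finite_measure (distr M path_space (future W t))"
      by (intro prob_space.finite_measure A.prob_space_distr) measurable
  qed (auto simp: path_space_def)
qed

context brownian
begin

text \<open>For fixed \<open>S\<close> both sides are finite measures in \<open>Z\<close>. They
  agree on cylinders, by \<open>indep_future_cylinder\<close>, and cylinders determine a finite
  measure on the product space.\<close>

lemma indep_future: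
  assumes t: "0 \<le> t" and S: "S \<in> sets borel" and Z: "Z \<in> sets path_space"
  shows "emeasure M ({\<omega> \<in> space M. W t \<omega> - W 0 \<omega> \<in> S} \<inter> (future W t -` Z \<inter> space M)) =
    emeasure M {\<omega> \<in> space M. W t \<omega> - W 0 \<omega> \<in> S} * emeasure M (future W t -` Z \<inter> space M)"
proof -
  note [measurable] = measurable_future[OF t]
  let ?S = "{\<omega> \<in> space M. W t \<omega> - W 0 \<omega> \<in> S}"
  have [measurable]: "?S \<in> sets M"
    using S t by (intro measurable_sets_Collect[OF measurable_increment]) auto
  let ?m1 = "distr (density M (indicator ?S)) path_space (future W t)"
  let ?m2 = "scale_measure (emeasure M ?S) (distr M path_space (future W t))"
  have m1: "emeasure ?m1 Z = emeasure M (?S \<inter> (future W t -` Z \<inter> space M))" if [measurable]: "Z \<in> sets path_space" for Z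
  proof -
    have "emeasure ?m1 Z = emeasure (density M (indicator ?S)) (future W t -` Z \<inter> space M)"
      by (subst emeasure_distr) auto
    also have "\<dots> = (\<integral>\<^sup>+\<omega>. indicator ?S \<omega> * indicator (future W t -` Z \<inter> space M) \<omega> \<partial>M)"
      by (rule emeasure_density) measurable
    also have "\<dots> = (\<integral>\<^sup>+\<omega>. indicator (?S \<inter> (future W t -` Z \<inter> space M)) \<omega> \<partial>M)"
      by (simp add: indicator_inter_arith)
    also have "\<dots> = emeasure M (?S \<inter> (future W t -` Z \<inter> space M))"
      by (rule nn_integral_indicator) measurable
    finally show ?thesis .
  qed
  have m2: "emeasure ?m2 Z = emeasure M ?S * emeasure M (future W t -` Z \<inter> space M)" if "Z \<in> sets path_space" for Z
    using that by (simp add: emeasure_distr)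
  have "?m1 = ?m2"
  proof (rule measure_eqI_PiM_infinite[where I=rat_times and M="\<lambda>_. borel"])
    fix A J assume J: "finite J" "J \<subseteq> rat_times" and A: "\<And>i. i \<in> J \<Longrightarrow> A i \<in> sets (borel :: 'a measure)"
    obtain N k where N: "N > 0" "\<forall>j\<in>J. \<exists>i\<le>k. j = real i / real N" using common_denominator[OF J] by blast
    then obtain E where E: "\<And>j. j \<in> J \<Longrightarrow> j = real (E j) / real N" "\<And>j. j \<in> J \<Longrightarrow> E j \<le> k" by metis
    have Z: "prod_emb rat_times (\<lambda>_. borel) J (Pi\<^sub>E J A) \<in> sets path_space"
      by (rule cylinder_in_path_space[OF J A])
    show "emeasure ?m1 (prod_emb rat_times (\<lambda>_. borel) J (Pi\<^sub>E J A)) = emeasure ?m2 (prod_emb rat_times (\<lambda>_. borel) J (Pi\<^sub>E J A))"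
      unfolding m1[OF Z] m2[OF Z]
      using indep_future_cylinder[OF t N(1) J E A S] by (simp only: emeasure_eq_measure ennreal_mult measure_nonneg)
  next
    show "finite_measure ?m1"
    proof
      have "space ?m1 \<in> sets path_space" by simp
      then show "emeasure ?m1 (space ?m1) \<noteq> \<infinity>"
        by (subst m1) (auto simp: emeasure_eq_measure)
    qed
  qed (auto simp: path_space_def)
  then show ?thesis using m1[OF Z] m2[OF Z] by simp
qed

lemma distr_pair:
  assumes t: "0 < t"
  shows "distr M (borel \<Otimes>\<^sub>M path_space) (\<lambda>\<omega>. (W t \<omega> - W 0 \<omega>, future W t \<omega>)) =
    normal_dist t \<Otimes>\<^sub>M distr M path_space (future W t)"
proof (rule pair_measure_eqI[symmetric])
  have t0: "0 \<le> t" using t by simp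
  note [measurable] = measurable_future[OF t0] measurable_increment[OF order_refl t0]
  show "sigma_finite_measure (normal_dist t :: 'a measure)"
    using prob_space_normal_dist[OF t] by (intro finite_measure.sigma_finite_measure prob_space.finite_measure)
  show "sigma_finite_measure (distr M path_space (future W t))"
    by (intro finite_measure.sigma_finite_measure prob_space.finite_measure prob_space_distr) measurable
  show "sets (normal_dist t \<Otimes>\<^sub>M distr M path_space (future W t)) =
      sets (distr M (borel \<Otimes>\<^sub>M path_space) (\<lambda>\<omega>. (W t \<omega> - W 0 \<omega>, future W t \<omega>)))"
    unfolding sets_distr by (intro sets_pair_measure_cong) simp_all
  fix A :: "'a set" and B :: "(real \<Rightarrow> 'a) set"
  assume "A \<in> sets (normal_dist t)" and B: "B \<in> sets (distr M path_space (future W t))"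
  then have A[measurable]: "A \<in> sets borel" and B[measurable]: "B \<in> sets path_space" by auto
  have "emeasure (normal_dist t) A = emeasure (distr M borel (\<lambda>\<omega>. W t \<omega> - W 0 \<omega>)) A"
    using distr_increment[of 0 t] t by simp
  also have "\<dots> = emeasure M {\<omega> \<in> space M. W t \<omega> - W 0 \<omega> \<in> A}"
    by (subst emeasure_distr) (auto intro!: arg_cong[where f="emeasure M"])
  finally have "emeasure (normal_dist t) A * emeasure (distr M path_space (future W t)) B =
      emeasure M ({\<omega> \<in> space M. W t \<omega> - W 0 \<omega> \<in> A} \<inter> (future W t -` B \<inter> space M))"
    using indep_future[OF t0 A B] by (simp add: emeasure_distr)
  also have "{\<omega> \<in> space M. W t \<omega> - W 0 \<omega> \<in> A} \<inter> (future W t -` B \<inter> space M) =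
      (\<lambda>\<omega>. (W t \<omega> - W 0 \<omega>, future W t \<omega>)) -` (A \<times> B) \<inter> space M" by auto
  also have "emeasure M \<dots> = emeasure (distr M (borel \<Otimes>\<^sub>M path_space) (\<lambda>\<omega>. (W t \<omega> - W 0 \<omega>, future W t \<omega>))) (A \<times> B)"
    by (subst emeasure_distr) auto
  finally show "emeasure (normal_dist t) A * emeasure (distr M path_space (future W t)) B =
      emeasure (distr M (borel \<Otimes>\<^sub>M path_space) (\<lambda>\<omega>. (W t \<omega> - W 0 \<omega>, future W t \<omega>))) (A \<times> B)" .
qed

end

section \<open>A maximal inequality of Ottaviani type\<close>

context brownian
begin

text \<open>Markov's inequality for the fourth power; the second moment would give only the order
  \<open>t - s\<close>.\<close>

lemma increment_tail:
  assumes st: "0 \<le> s" "s \<le> t" and a: "0 < a"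
  shows "prob {\<omega> \<in> space M. a \<le> norm (W t \<omega> - W s \<omega>)} \<le> moment TYPE('a) 4 * (t - s)\<^sup>2 / a ^ 4"
proof (cases "s = t")
  case True
  then show ?thesis using a by simp
next
  case False
  then have st': "s < t" using st by simp
  have [measurable]: "(\<lambda>\<omega>. W t \<omega> - W s \<omega>) \<in> borel_measurable M"
    using st by (intro measurable_increment) auto
  interpret N: prob_space "normal_dist (t - s) :: 'a measure" by (rule prob_space_normal_dist) (use st' in simp)
  have "{\<omega> \<in> space M. a \<le> norm (W t \<omega> - W s \<omega>)} = (\<lambda>\<omega>. W t \<omega> - W s \<omega>) -` {z. a \<le> norm z} \<inter> space M" by auto
  then have "prob {\<omega> \<in> space M. a \<le> norm (W t \<omega> - W s \<omega>)} = measure (distr M borel (\<lambda>\<omega>. W t \<omega> - W s \<omega>)) {z. a \<le> norm z}"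
    by (subst measure_distr) auto
  also have "\<dots> = measure (normal_dist (t - s)) {z \<in> space (normal_dist (t - s)). a ^ 4 \<le> norm (z::'a) ^ 4}"
    using a unfolding distr_increment[OF st(1) st'] by (simp add: power_mono_iff)
  also have "\<dots> \<le> (\<integral>z. norm (z::'a) ^ 4 \<partial>normal_dist (t - s)) / a ^ 4"
    using st' a by (intro integral_Markov_inequality_measure[where A="{}"] integrable_normal_norm_power) auto
  also have "(\<integral>z. norm (z::'a) ^ 4 \<partial>normal_dist (t - s)) = sqrt (t - s) ^ 4 * moment TYPE('a) 4"
    using st' by (intro normal_moment) simp
  also have "sqrt (t - s) ^ 4 = (t - s)\<^sup>2" using st' by (simp add: power4_eq_xxxx power2_eq_square)
  finally show ?thesis by (simp add: mult.commute)
qed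

text \<open>Decompose by the first grid index \<open>i\<close> at which the distance from the start
  reaches \<open>2 * a\<close> (event \<open>E i\<close>). The remaining increment is independent of
  that event and below \<open>a\<close> with probability at least 1/2 (event \<open>F i\<close>),
  and then the final distance is still at least \<open>a\<close>. So the maximum costs only a factor
  2 over the final value. If the tail bound exceeds 1/2, the claimed bound exceeds 1.\<close>

lemma ottaviani_grid:
  assumes t: "0 \<le> t" and N: "N > 0" and a: "0 < a"
  shows "prob {\<omega> \<in> space M. \<exists>i\<le>N. 2 * a \<le> norm (W (real i * (t / real N)) \<omega> - W 0 \<omega>)}
    \<le> 2 * moment TYPE('a) 4 * t\<^sup>2 / a ^ 4"
proof (cases "moment TYPE('a) 4 * t\<^sup>2 / a ^ 4 \<le> 1 / 2")
  case False
  then have "1 \<le> 2 * moment TYPE('a) 4 * t\<^sup>2 / a ^ 4" by (simp add: ac_simps)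
  then show ?thesis by (rule order_trans[OF prob_le_1])
next
  case True
  define \<tau> where "\<tau> i = real i * (t / real N)" for i
  have \<tau>: "0 \<le> \<tau> i" "\<tau> 0 = 0" "\<tau> N = t" "i \<le> j \<Longrightarrow> \<tau> i \<le> \<tau> j" for i j
    using t N by (auto simp: \<tau>_def intro!: mult_right_mono divide_right_mono)
  let ?X = "\<lambda>i \<omega>. W (\<tau> (Suc i)) \<omega> - W (\<tau> i) \<omega>"
  define S where "S i \<omega> = W (\<tau> i) \<omega> - W 0 \<omega>" for i \<omega>
  have [measurable]: "S i \<in> borel_measurable M" for i
    unfolding S_def by (intro measurable_increment \<tau>) auto
  have S_sum: "S i \<omega> = (\<Sum>l<i. ?X l \<omega>)" for i \<omega>
    unfolding S_def using sum_lessThan_telescope[of "\<lambda>i. W (\<tau> i) \<omega>" i] \<tau>(2) by simp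
  have S_diff: "S N \<omega> - S i \<omega> = (\<Sum>l\<in>{i..<N}. ?X l \<omega>)" if "i \<le> N" for i \<omega>
    unfolding S_def using sum_Suc_diff'[OF that, of "\<lambda>i. W (\<tau> i) \<omega>"] by simp
  define E where "E i = {\<omega> \<in> space M. 2 * a \<le> norm (S i \<omega>) \<and> (\<forall>l<i. norm (S l \<omega>) < 2 * a)}" for i
  define F where "F i = {\<omega> \<in> space M. norm (S N \<omega> - S i \<omega>) < a}" for i
  have [measurable]: "E i \<in> sets M" "F i \<in> sets M" for i
    unfolding E_def F_def by measurable
  have indep: "prob (E i \<inter> F i) = prob (E i) * prob (F i)" if i: "i \<le> N" for i
  proof -
    have "indep_vars (\<lambda>_. borel) ?X {..<N}"
      by (rule indep_increments) (use \<tau> in \<open>auto simp: incseq_def\<close>)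
    then have ind: "indep_var (PiM {..<i} (\<lambda>_. borel)) (\<lambda>\<omega>. restrict (\<lambda>i. ?X i \<omega>) {..<i})
        (PiM {i..<N} (\<lambda>_. borel)) (\<lambda>\<omega>. restrict (\<lambda>i. ?X i \<omega>) {i..<N})"
      by (rule indep_var_restrict) (use i in auto)
    let ?XA = "{\<xi> \<in> space (PiM {..<i} (\<lambda>_. borel :: 'a measure)). 2 * a \<le> norm (\<Sum>l<i. \<xi> l) \<and> (\<forall>m<i. norm (\<Sum>l<m. \<xi> l) < 2 * a)}"
    let ?XB = "{\<xi> \<in> space (PiM {i..<N} (\<lambda>_. borel :: 'a measure)). norm (\<Sum>l\<in>{i..<N}. \<xi> l) < a}"
    have m: "(\<lambda>\<xi>. \<Sum>l<m. \<xi> l) \<in> borel_measurable (PiM {..<i} (\<lambda>_. borel :: 'a measure))" if "m \<le> i" for m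
      using that by (intro borel_measurable_sum measurable_component_singleton) auto
    have XA: "?XA \<in> sets (PiM {..<i} (\<lambda>_. borel :: 'a measure))"
    proof (intro sets.sets_Collect_conj)
      note [measurable] = m[OF order_refl]
      show "{\<xi> \<in> space (PiM {..<i} (\<lambda>_. borel :: 'a measure)). 2 * a \<le> norm (\<Sum>l<i. \<xi> l)} \<in> sets (PiM {..<i} (\<lambda>_. borel))"
        by measurable
      have *: "{\<xi> \<in> space (PiM {..<i} (\<lambda>_. borel :: 'a measure)). norm (\<Sum>l<m. \<xi> l) < 2 * a} \<in> sets (PiM {..<i} (\<lambda>_. borel))" if "m \<in> {..<i}" for m
      proof -
        have [measurable]: "(\<lambda>\<xi>. \<Sum>l<m. \<xi> l) \<in> borel_measurable (PiM {..<i} (\<lambda>_. borel :: 'a measure))"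
          by (rule m) (use that in simp)
        show ?thesis by measurable
      qed
      have "{\<xi> \<in> space (PiM {..<i} (\<lambda>_. borel :: 'a measure)). \<forall>m\<in>{..<i}. norm (\<Sum>l<m. \<xi> l) < 2 * a} \<in> sets (PiM {..<i} (\<lambda>_. borel))"
        by (rule sets.sets_Collect_finite_All[OF *]) auto
      then show "{\<xi> \<in> space (PiM {..<i} (\<lambda>_. borel :: 'a measure)). \<forall>m<i. norm (\<Sum>l<m. \<xi> l) < 2 * a} \<in> sets (PiM {..<i} (\<lambda>_. borel))"
        by (simp only: Ball_def lessThan_iff)
    qed
    have [measurable]: "(\<lambda>\<xi>. \<Sum>l\<in>{i..<N}. \<xi> l) \<in> borel_measurable (PiM {i..<N} (\<lambda>_. borel :: 'a measure))"
      by (intro borel_measurable_sum measurable_component_singleton) auto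
    have XB: "?XB \<in> sets (PiM {i..<N} (\<lambda>_. borel :: 'a measure))" by measurable
    have A: "(\<lambda>\<omega>. restrict (\<lambda>i. ?X i \<omega>) {..<i}) -` ?XA \<inter> space M = E i"
    proof -
      have "(\<Sum>l<m. restrict (\<lambda>i. ?X i \<omega>) {..<i} l) = S m \<omega>" if "m \<le> i" for m \<omega>
        unfolding S_sum using that by (intro sum.cong) auto
      then show ?thesis by (auto simp: E_def space_PiM simp del: restrict_apply)
    qed
    have B: "(\<lambda>\<omega>. restrict (\<lambda>i. ?X i \<omega>) {i..<N}) -` ?XB \<inter> space M = F i"
    proof -
      have "(\<Sum>l\<in>{i..<N}. restrict (\<lambda>i. ?X i \<omega>) {i..<N} l) = S N \<omega> - S i \<omega>" for \<omega>
        unfolding S_diff[OF i] by (intro sum.cong) auto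
      then show ?thesis by (auto simp: F_def space_PiM simp del: restrict_apply)
    qed
    have "prob ((\<lambda>\<omega>. (restrict (\<lambda>i. ?X i \<omega>) {..<i}, restrict (\<lambda>i. ?X i \<omega>) {i..<N})) -` (?XA \<times> ?XB) \<inter> space M) = prob (E i) * prob (F i)"
      using indep_varD[OF ind XA XB] unfolding A B .
    moreover have "(\<lambda>\<omega>. (restrict (\<lambda>i. ?X i \<omega>) {..<i}, restrict (\<lambda>i. ?X i \<omega>) {i..<N})) -` (?XA \<times> ?XB) \<inter> space M = E i \<inter> F i"
      unfolding A[symmetric] B[symmetric] by blast
    ultimately show ?thesis by simp
  qed
  have F_half: "1 / 2 \<le> prob (F i)" if i: "i \<le> N" for i
  proof -
    have "space M - F i = {\<omega> \<in> space M. a \<le> norm (W (\<tau> N) \<omega> - W (\<tau> i) \<omega>)}"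
      by (auto simp: F_def S_def)
    then have "prob (space M - F i) \<le> moment TYPE('a) 4 * (\<tau> N - \<tau> i)\<^sup>2 / a ^ 4"
      using increment_tail[OF \<tau>(1) \<tau>(4)[OF i] a] by simp
    also have "\<dots> \<le> moment TYPE('a) 4 * t\<^sup>2 / a ^ 4"
      using a \<tau>(1)[of i] \<tau>(4)[OF i] moment_nonneg[where 'a='a]
      by (intro divide_right_mono mult_left_mono power_mono) (auto simp: \<tau>(3))
    also have "\<dots> \<le> 1 / 2" by (rule True)
    finally show ?thesis by (simp add: prob_compl)
  qed
  have disj: "disjoint_family_on E {..N}"
    unfolding disjoint_family_on_def
  proof (intro ballI impI)
    fix i j :: nat assume "i \<noteq> j"
    then consider "i < j" | "j < i" by linarith
    then show "E i \<inter> E j = {}" by cases (auto simp: E_def)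
  qed
  have disj': "disjoint_family_on (\<lambda>i. E i \<inter> F i) {..N}"
    using disj by (auto simp: disjoint_family_on_def)
  have union: "{\<omega> \<in> space M. \<exists>i\<le>N. 2 * a \<le> norm (S i \<omega>)} = (\<Union>i\<in>{..N}. E i)"
  proof (intro equalityI subsetI)
    fix \<omega> assume "\<omega> \<in> {\<omega> \<in> space M. \<exists>i\<le>N. 2 * a \<le> norm (S i \<omega>)}"
    then obtain i0 where \<omega>: "\<omega> \<in> space M" and i0: "i0 \<le> N" "2 * a \<le> norm (S i0 \<omega>)" by auto
    define i where "i = (LEAST i. 2 * a \<le> norm (S i \<omega>))"
    have "2 * a \<le> norm (S i \<omega>)" unfolding i_def by (rule LeastI) (rule i0(2))
    moreover have "i \<le> N" unfolding i_def using Least_le[of "\<lambda>i. 2 * a \<le> norm (S i \<omega>)", OF i0(2)] i0(1) by linarith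
    moreover have "norm (S l \<omega>) < 2 * a" if "l < i" for l
      using not_less_Least[of l "\<lambda>i. 2 * a \<le> norm (S i \<omega>)"] that unfolding i_def by linarith
    ultimately show "\<omega> \<in> (\<Union>i\<in>{..N}. E i)" using \<omega> by (auto simp: E_def)
  qed (auto simp: E_def)
  have "prob {\<omega> \<in> space M. \<exists>i\<le>N. 2 * a \<le> norm (S i \<omega>)} = (\<Sum>i\<in>{..N}. prob (E i))"
    unfolding union by (rule finite_measure_finite_Union[OF _ _ disj]) auto
  also have "\<dots> \<le> (\<Sum>i\<in>{..N}. 2 * prob (E i \<inter> F i))"
  proof (rule sum_mono)
    fix i assume "i \<in> {..N}"
    then have i: "i \<le> N" by simp
    have "prob (E i) * (1 / 2) \<le> prob (E i) * prob (F i)" by (rule mult_left_mono[OF F_half[OF i]]) simp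
    then show "prob (E i) \<le> 2 * prob (E i \<inter> F i)" unfolding indep[OF i] by simp
  qed
  also have "\<dots> = 2 * prob (\<Union>i\<in>{..N}. E i \<inter> F i)"
    unfolding sum_distrib_left[symmetric] by (subst finite_measure_finite_Union[OF _ _ disj']) auto
  also have "\<dots> \<le> 2 * prob {\<omega> \<in> space M. a \<le> norm (W (\<tau> N) \<omega> - W (\<tau> 0) \<omega>)}"
  proof -
    have "(\<Union>i\<in>{..N}. E i \<inter> F i) \<subseteq> {\<omega> \<in> space M. a \<le> norm (S N \<omega>)}"
    proof
      fix \<omega> assume "\<omega> \<in> (\<Union>i\<in>{..N}. E i \<inter> F i)"
      then obtain i where "\<omega> \<in> space M" "2 * a \<le> norm (S i \<omega>)" "norm (S N \<omega> - S i \<omega>) < a"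
        by (auto simp: E_def F_def)
      then show "\<omega> \<in> {\<omega> \<in> space M. a \<le> norm (S N \<omega>)}"
        using norm_triangle_ineq3[of "S i \<omega>" "S N \<omega>"] by (simp add: norm_minus_commute)
    qed
    moreover have "{\<omega> \<in> space M. a \<le> norm (S N \<omega>)} \<in> sets M" by measurable
    ultimately show ?thesis by (auto simp: S_def \<tau>(2) intro!: finite_measure_mono)
  qed
  also have "\<dots> \<le> 2 * (moment TYPE('a) 4 * (\<tau> N - \<tau> 0)\<^sup>2 / a ^ 4)"
    by (intro mult_left_mono increment_tail \<tau> a) auto
  finally show ?thesis unfolding S_def \<tau>(2,3) unfolding \<tau>_def by simp
qed

text \<open>The exceptional set is the increasing union of the events on dyadic grids, hence
  measurable, and the grid bound survives the limit because it does not depend on the mesh. Off this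
  set, path continuity extends the estimate from dyadic fractions of \<open>t\<close> to all
  times.\<close>

lemma maximal_inequality:
  assumes t: "0 \<le> t" and \<delta>: "0 < \<delta>"
  obtains A where "A \<in> sets M" "prob A \<le> 512 * moment TYPE('a) 4 / \<delta> ^ 4 * t\<^sup>2"
    "\<And>\<omega> s. \<omega> \<in> space M - A \<Longrightarrow> 0 \<le> s \<Longrightarrow> s \<le> t \<Longrightarrow> norm (W s \<omega> - W 0 \<omega>) < \<delta>"
proof -
  \<comment> \<open>The passage to the limit gives only \<open>\<le> 2 * a = \<delta> / 2\<close>,
    which leaves room for the strict inequality. The constant is
    \<open>512 = 2 * 4 ^ 4\<close>.\<close>
  define a where "a = \<delta> / 4"
  have a: "a > 0" using \<delta> by (simp add: a_def)
  define A where "A m = {\<omega> \<in> space M. \<exists>i\<le>2 ^ m. 2 * a \<le> norm (W (real i * (t / real (2 ^ m))) \<omega> - W 0 \<omega>)}" for m :: nat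
  have Am[measurable]: "A m \<in> sets M" for m
  proof -
    have [measurable]: "(\<lambda>\<omega>. W (real i * (t / real (2 ^ m))) \<omega> - W 0 \<omega>) \<in> borel_measurable M" for i
      using t by (intro measurable_increment) auto
    show ?thesis unfolding A_def by measurable
  qed
  have "incseq A"
  proof (rule incseq_SucI, rule subsetI)
    fix m \<omega> assume "\<omega> \<in> A m"
    then obtain i where i: "\<omega> \<in> space M" "i \<le> 2 ^ m" "2 * a \<le> norm (W (real i * (t / real (2 ^ m))) \<omega> - W 0 \<omega>)"
      by (auto simp: A_def)
    have "real i * (t / real (2 ^ m)) = real (2 * i) * (t / real (2 ^ Suc m))" by simp
    then have "2 * a \<le> norm (W (real (2 * i) * (t / real (2 ^ Suc m))) \<omega> - W 0 \<omega>)" using i(3) by (simp only:)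
    moreover have "2 * i \<le> 2 ^ Suc m" using i(2) by simp
    ultimately show "\<omega> \<in> A (Suc m)" unfolding A_def using i(1) by blast
  qed
  then have "(\<lambda>m. prob (A m)) \<longlonglongrightarrow> prob (\<Union>m. A m)"
    by (intro finite_Lim_measure_incseq) auto
  moreover have "prob (A m) \<le> 2 * moment TYPE('a) 4 * t\<^sup>2 / a ^ 4" for m
    unfolding A_def by (rule ottaviani_grid[OF t _ a]) simp
  ultimately have "prob (\<Union>m. A m) \<le> 2 * moment TYPE('a) 4 * t\<^sup>2 / a ^ 4"
    by (intro LIMSEQ_le_const2) auto
  then have p: "prob (\<Union>m. A m) \<le> 512 * moment TYPE('a) 4 / \<delta> ^ 4 * t\<^sup>2"
    by (simp add: a_def power_divide)
  show thesis
  proof (rule that[OF _ p])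
    fix \<omega> s assume \<omega>: "\<omega> \<in> space M - (\<Union>m. A m)" and s: "0 \<le> s" "s \<le> t"
    have lt: "norm (W (real i * (t / real (2 ^ m))) \<omega> - W 0 \<omega>) \<le> 2 * a" if "i \<le> 2 ^ m" for i m
    proof -
      have "\<omega> \<notin> A m" using \<omega> by blast
      then have "\<not> 2 * a \<le> norm (W (real i * (t / real (2 ^ m))) \<omega> - W 0 \<omega>)"
        unfolding A_def using \<omega> that by blast
      then show ?thesis by linarith
    qed
    show "norm (W s \<omega> - W 0 \<omega>) < \<delta>"
    proof (cases "t = 0")
      case True
      then show ?thesis using s \<delta> by simp
    next
      case False
      then have t0: "t > 0" using t by simp
      define i where "i m = nat \<lfloor>s / t * 2 ^ m\<rfloor>" for m :: nat
      define r where "r m = real (i m) * (t / real (2 ^ m))" for m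
      have fl: "real (i m) \<le> s / t * 2 ^ m" "s / t * 2 ^ m < real (i m) + 1" for m
        unfolding i_def using s t0 by auto
      have im: "i m \<le> 2 ^ m" for m
      proof -
        have "s / t * 2 ^ m \<le> 1 * 2 ^ m" using s t0 by (intro mult_right_mono) auto
        then have "real (i m) \<le> real (2 ^ m)" using fl(1)[of m] by (metis mult_1 of_nat_numeral of_nat_power order_trans)
        then show ?thesis by (simp only: of_nat_le_iff)
      qed
      have r0: "0 \<le> r m" for m using t0 by (simp add: r_def)
      have r_le: "r m \<le> s" for m
      proof -
        have "real (i m) / 2 ^ m \<le> s / t" using fl(1)[of m] by (simp add: pos_divide_le_eq)
        then have "real (i m) / 2 ^ m * t \<le> s" using t0 by (simp add: pos_le_divide_eq)
        then show ?thesis by (simp add: r_def)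
      qed
      have r_ge: "s - t / 2 ^ m \<le> r m" for m
      proof -
        have "s / t \<le> (real (i m) + 1) / 2 ^ m" using fl(2)[of m] by (simp add: pos_le_divide_eq less_imp_le)
        then have "s \<le> (real (i m) + 1) / 2 ^ m * t" using t0 by (simp add: pos_divide_le_eq)
        then show ?thesis by (simp add: r_def add_divide_distrib distrib_right)
      qed
      have "(\<lambda>m. s - t / 2 ^ m) \<longlonglongrightarrow> s - 0"
        using LIMSEQ_divide_realpow_zero[of 2 t] by (intro tendsto_intros) auto
      then have rl: "r \<longlonglongrightarrow> s"
        by (intro tendsto_sandwich[of "\<lambda>m. s - t / 2 ^ m" r _ "\<lambda>_. s"]) (auto intro!: always_eventually simp: r_le r_ge)
      have "(\<lambda>m. W (r m) \<omega>) \<longlonglongrightarrow> W s \<omega>"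
        using continuous_on_tendsto_compose[OF continuous_W rl, of \<omega>] \<omega> s r0 by auto
      then have "(\<lambda>m. norm (W (r m) \<omega> - W 0 \<omega>)) \<longlonglongrightarrow> norm (W s \<omega> - W 0 \<omega>)"
        by (intro tendsto_intros)
      then have "norm (W s \<omega> - W 0 \<omega>) \<le> 2 * a"
        by (rule LIMSEQ_le_const2) (intro exI[of _ 0] allI impI, unfold r_def, rule lt[OF im])
      then show ?thesis using \<delta> by (simp add: a_def)
    qed
  qed auto
qed

end

section \<open>Families of Brownian motions and the Markov property at a fixed time\<close>

locale brownian_fam =
  fixes P :: "'a::euclidean_space \<Rightarrow> 'w measure" and W :: "real \<Rightarrow> 'w \<Rightarrow> 'a"
  assumes family: "brownian_family P W"
begin

lemma brownian: "brownian (P x) W x"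
  using family by (auto simp: brownian_family_def intro: brownian_motion_imp_brownian)

text \<open>Starting point 0 and time 0 are arbitrary choices; \<open>distr_future\<close> shows
  that every other choice gives the same law.\<close>

definition path_law :: "(real \<Rightarrow> 'a) measure" where
  "path_law = distr (P 0) path_space (future W 0)"

lemma distr_future: "0 \<le> t \<Longrightarrow> distr (P x) path_space (future W t) = path_law"
  unfolding path_law_def by (rule distr_future_unique[OF brownian brownian]) auto

lemma sets_path_law [measurable_cong, simp]: "sets path_law = sets path_space"
  by (simp add: path_law_def)

lemma prob_space_path_law: "prob_space path_law"
  unfolding path_law_def
  by (intro prob_space.prob_space_distr brownian.measurable_future[OF brownian] order_refl)
    (rule brownian.axioms[OF brownian])

lemma integral_start:
  fixes F :: "'a \<times> (real \<Rightarrow> 'a) \<Rightarrow> real"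
  assumes [measurable]: "F \<in> borel_measurable (borel \<Otimes>\<^sub>M path_space)"
  shows "(\<integral>\<omega>. F (W 0 \<omega>, future W 0 \<omega>) \<partial>P x) = (\<integral>w. F (x, w) \<partial>path_law)"
proof -
  interpret brownian "P x" W x by (rule brownian)
  note [measurable] = measurable_future[OF order_refl] measurable_W[OF order_refl]
  have "(\<integral>\<omega>. F (W 0 \<omega>, future W 0 \<omega>) \<partial>P x) = (\<integral>\<omega>. F (x, future W 0 \<omega>) \<partial>P x)"
    by (rule integral_cong_AE) (use W_0 in auto)
  also have "\<dots> = (\<integral>w. F (x, w) \<partial>path_law)"
    unfolding distr_future[OF order_refl, of x, symmetric] by (subst integral_distr) auto
  finally show ?thesis .
qed

text \<open>By \<open>distr_pair\<close> the increment up to \<open>t\<close> and the future have a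
  product law. Integrating the future out first leaves a function of the present position, averaged
  over \<open>normal_dist t\<close>. Boundedness of \<open>F\<close> serves Fubini.\<close>

lemma integral_markov:
  fixes F :: "'a \<times> (real \<Rightarrow> 'a) \<Rightarrow> real"
  assumes [measurable]: "F \<in> borel_measurable (borel \<Otimes>\<^sub>M path_space)" and B: "\<And>p. \<bar>F p\<bar> \<le> B" and t: "0 < t"
  shows "(\<integral>\<omega>. F (W t \<omega>, future W t \<omega>) \<partial>P x) = heat t (\<lambda>z. \<integral>w. F (z, w) \<partial>path_law) x"
proof -
  interpret brownian "P x" W x by (rule brownian)
  have t0: "0 \<le> t" using t by simp
  note [measurable] = measurable_future[OF t0] measurable_W[OF order_refl] measurable_W[OF t0]
  interpret N: prob_space "normal_dist t :: 'a measure" by (rule prob_space_normal_dist[OF t])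
  interpret L: prob_space path_law by (rule prob_space_path_law)
  interpret NL: pair_prob_space "normal_dist t :: 'a measure" path_law ..
  have "(\<integral>\<omega>. F (W t \<omega>, future W t \<omega>) \<partial>P x) = (\<integral>\<omega>. F (x + (W t \<omega> - W 0 \<omega>), future W t \<omega>) \<partial>P x)"
    by (rule integral_cong_AE) (use W_0 in auto)
  also have "\<dots> = (\<integral>p. F (x + fst p, snd p) \<partial>distr (P x) (borel \<Otimes>\<^sub>M path_space) (\<lambda>\<omega>. (W t \<omega> - W 0 \<omega>, future W t \<omega>)))"
    by (subst integral_distr) auto
  also have "\<dots> = (\<integral>(v, w). F (x + v, w) \<partial>(normal_dist t \<Otimes>\<^sub>M path_law))"
    unfolding distr_pair[OF t] distr_future[OF t0] by (simp add: split_beta')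
  also have "\<dots> = (\<integral>v. \<integral>w. F (x + v, w) \<partial>path_law \<partial>normal_dist t)"
  proof (rule NL.integral_fst[symmetric])
    show "integrable (normal_dist t \<Otimes>\<^sub>M path_law) (\<lambda>(v, w). F (x + v, w))"
      by (rule NL.integrable_const_bound[where B=B]) (use B in \<open>auto intro!: AE_I2 simp: split_beta'\<close>)
  qed
  finally show ?thesis by (simp add: heat_def)
qed

text \<open>The source of measurability in the starting point: one fixed law is integrated out of a
  jointly measurable function.\<close>

lemma bounded_borel_path_integral:
  fixes F :: "'a \<times> (real \<Rightarrow> 'a) \<Rightarrow> real"
  assumes [measurable]: "F \<in> borel_measurable (borel \<Otimes>\<^sub>M path_space)" and B: "\<And>p. \<bar>F p\<bar> \<le> B"
  shows "bounded_borel (\<lambda>z. \<integral>w. F (z, w) \<partial>path_law) B"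
proof
  interpret L: prob_space path_law by (rule prob_space_path_law)
  show "(\<lambda>z. \<integral>w. F (z, w) \<partial>path_law) \<in> borel_measurable borel" by measurable
  fix z
  have "\<bar>\<integral>w. F (z, w) \<partial>path_law\<bar> \<le> (\<integral>w. B \<partial>path_law)"
    by (rule abs_integral_le, rule L.integrable_const_bound[where B=B]) (use B in auto)
  then show "\<bar>\<integral>w. F (z, w) \<partial>path_law\<bar> \<le> B" using L.prob_space by simp
qed

end

section \<open>Exit times\<close>

text \<open>Closed sets that exhaust an open \<open>D\<close>. Lying in one of them at all rational
  times passes to all times by continuity, while lying in \<open>D\<close> at all rational times
  does not.\<close>

definition inner_part :: "'a::metric_space set \<Rightarrow> nat \<Rightarrow> 'a set" where
  "inner_part D j = {z. ball z (1 / real (Suc j)) \<subseteq> D}"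

lemma closed_inner_part: "closed (inner_part D j)"
proof -
  have eq: "inner_part D j = - (\<Union>y\<in>-D. ball y (1 / real (Suc j)))"
    unfolding inner_part_def by (auto simp: subset_iff dist_commute)
  show ?thesis unfolding eq by (intro closed_Compl open_UN ballI open_ball)
qed

lemma inner_part_borel [measurable]: "inner_part D j \<in> sets borel"
  by (rule borel_closed[OF closed_inner_part])

lemma LIMSEQ_from_below:
  assumes "\<And>m. s - 1 / real (Suc m) \<le> r m" "\<And>m. r m \<le> s"
  shows "r \<longlonglongrightarrow> s"
proof (rule tendsto_sandwich[of "\<lambda>m. s - 1 / real (Suc m)" _ _ "\<lambda>_. s"])
  show "\<forall>\<^sub>F m in sequentially. s - 1 / real (Suc m) \<le> r m" "\<forall>\<^sub>F m in sequentially. r m \<le> s"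
    using assms by (intro always_eventually allI; blast)+
  have "(\<lambda>m. s - 1 / real (Suc m)) \<longlonglongrightarrow> s - 0" by (intro tendsto_intros LIMSEQ_Suc[OF lim_1_over_n])
  then show "(\<lambda>m. s - 1 / real (Suc m)) \<longlonglongrightarrow> s" by simp
qed (rule tendsto_const)

text \<open>A compact piece of path inside \<open>D\<close> keeps a positive distance from the
  complement, which gives one \<open>j\<close> for all times; the converse is closedness of
  \<open>inner_part D j\<close>. The left end is rational so that the constant sequence reaches it,
  even if the interval is a single point.\<close>

lemma stays_iff:
  fixes p :: "real \<Rightarrow> 'a::metric_space"
  assumes D: "open D" and p: "continuous_on {0..} p" and a: "0 \<le> a" "a \<in> \<rat>"
  shows "(\<forall>s\<in>{a..b}. p s \<in> D) \<longleftrightarrow> (\<exists>j. \<forall>q\<in>rat_times \<inter> {a..b}. p q \<in> inner_part D j)"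
proof
  assume L: "\<forall>s\<in>{a..b}. p s \<in> D"
  have "compact (p ` {a..b})"
    by (rule compact_continuous_image[OF continuous_on_subset[OF p]]) (use a in auto)
  moreover have "p ` {a..b} \<subseteq> D" using L by auto
  ultimately obtain e where e: "e > 0" "(\<Union>x\<in>p ` {a..b}. ball x e) \<subseteq> D"
    using compact_subset_open_imp_ball_epsilon_subset[OF _ D] by blast
  obtain j where j: "1 / real (Suc j) < e" using nat_approx_posE[OF e(1)] .
  have "p q \<in> inner_part D j" if "q \<in> rat_times \<inter> {a..b}" for q
  proof -
    have "ball (p q) (1 / real (Suc j)) \<subseteq> ball (p q) e" using j by (intro subset_ball) simp
    also have "ball (p q) e \<subseteq> (\<Union>x\<in>p ` {a..b}. ball x e)" using that by (intro UN_upper) auto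
    also have "\<dots> \<subseteq> D" by (rule e(2))
    finally show ?thesis by (simp add: inner_part_def)
  qed
  then show "\<exists>j. \<forall>q\<in>rat_times \<inter> {a..b}. p q \<in> inner_part D j" by blast
next
  assume "\<exists>j. \<forall>q\<in>rat_times \<inter> {a..b}. p q \<in> inner_part D j"
  then obtain j where j: "\<And>q. q \<in> rat_times \<inter> {a..b} \<Longrightarrow> p q \<in> inner_part D j" by blast
  show "\<forall>s\<in>{a..b}. p s \<in> D"
  proof
    fix s assume s: "s \<in> {a..b}"
    have "\<exists>r. (\<forall>n. r n \<in> rat_times \<inter> {a..b}) \<and> r \<longlonglongrightarrow> s"
    proof (cases "s = a")
      case True
      then show ?thesis using a s by (intro exI[of _ "\<lambda>_. a"]) (auto simp: rat_times_def)
    next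
      case False
      then have as: "a < s" using s by simp
      have "\<exists>q\<in>\<rat>. max a (s - 1 / real (Suc n)) < q \<and> q < s" for n
        using Rats_dense_in_real[of "max a (s - 1 / real (Suc n))" s] as by auto
      then obtain r where r: "\<And>n. r n \<in> \<rat>" "\<And>n. max a (s - 1 / real (Suc n)) < r n" "\<And>n. r n < s" by metis
      have lo: "s - 1 / real (Suc n) \<le> r n" for n using r(2)[of n] by simp
      have "r \<longlonglongrightarrow> s" by (rule LIMSEQ_from_below) (rule lo, rule less_imp_le[OF r(3)])
      moreover have "r n \<in> rat_times \<inter> {a..b}" for n
        using r(1)[of n] r(2)[of n] r(3)[of n] s a by (auto simp: rat_times_def)
      ultimately show ?thesis by blast
    qed
    then obtain r where r: "\<And>n. r n \<in> rat_times \<inter> {a..b}" "r \<longlonglongrightarrow> s" by blast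
    have "(\<lambda>n. p (r n)) \<longlonglongrightarrow> p s"
      by (rule continuous_on_tendsto_compose[OF p r(2)]) (use r(1) s a in \<open>auto simp: rat_times_def\<close>)
    then have "p s \<in> inner_part D j"
      by (rule closed_sequentially[OF closed_inner_part, rotated]) (use j r(1) in blast)
    then show "p s \<in> D" unfolding inner_part_def using centre_in_ball[of "p s" "1 / real (Suc j)"] by auto
  qed
qed

lemma le_exit_time_iff:
  assumes "0 \<le> r"
  shows "ennreal r \<le> exit_time W D \<omega> \<longleftrightarrow> (\<forall>s. 0 < s \<longrightarrow> s < r \<longrightarrow> W s \<omega> \<in> D)"
proof
  assume r: "ennreal r \<le> exit_time W D \<omega>"
  show "\<forall>s. 0 < s \<longrightarrow> s < r \<longrightarrow> W s \<omega> \<in> D"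
  proof (intro allI impI, rule ccontr)
    fix s assume s: "0 < s" "s < r" "W s \<omega> \<notin> D"
    then have "exit_time W D \<omega> \<le> ennreal s" unfolding exit_time_def by (intro Inf_lower) auto
    then show False using r s by (meson ennreal_less_iff leD less_imp_le order_trans)
  qed
next
  assume *: "\<forall>s. 0 < s \<longrightarrow> s < r \<longrightarrow> W s \<omega> \<in> D"
  show "ennreal r \<le> exit_time W D \<omega>"
    unfolding exit_time_def
  proof (rule Inf_greatest)
    fix y assume "y \<in> {ennreal t |t. 0 < t \<and> W t \<omega> \<notin> D}"
    then obtain t where t: "y = ennreal t" "0 < t" "W t \<omega> \<notin> D" by blast
    then have "r \<le> t" using * by (meson not_le)
    then show "ennreal r \<le> y" using t by (simp add: ennreal_leI)
  qed
qed

text \<open>For a start inside \<open>D\<close> the time 0 may be included, and since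
  \<open>D\<close> is open the path stays inside slightly beyond \<open>r\<close>, which makes the
  inequality strict.\<close>

lemma less_exit_time_iff:
  fixes W :: "real \<Rightarrow> 'w \<Rightarrow> 'a::metric_space"
  assumes D: "open D" and p: "continuous_on {0..} (\<lambda>t. W t \<omega>)" and D0: "W 0 \<omega> \<in> D" and r: "0 \<le> r"
  shows "ennreal r < exit_time W D \<omega> \<longleftrightarrow> (\<forall>s\<in>{0..r}. W s \<omega> \<in> D)"
proof
  assume lt: "ennreal r < exit_time W D \<omega>"
  show "\<forall>s\<in>{0..r}. W s \<omega> \<in> D"
  proof (rule ccontr)
    assume "\<not> (\<forall>s\<in>{0..r}. W s \<omega> \<in> D)"
    then obtain s where s: "0 \<le> s" "s \<le> r" "W s \<omega> \<notin> D" by auto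
    then have "0 < s" using D0 by (cases "s = 0") auto
    then have "exit_time W D \<omega> \<le> ennreal s" unfolding exit_time_def using s by (intro Inf_lower) auto
    also have "\<dots> \<le> ennreal r" using s by (simp add: ennreal_leI)
    finally show False using lt by simp
  qed
next
  assume in_D: "\<forall>s\<in>{0..r}. W s \<omega> \<in> D"
  have "\<exists>e>0. \<forall>s\<in>{0..}. dist s r < e \<longrightarrow> W s \<omega> \<in> D"
  proof -
    obtain d where d: "d > 0" "ball (W r \<omega>) d \<subseteq> D" using D in_D r unfolding open_contains_ball by force
    obtain e where "e > 0" "\<And>s. s \<in> {0..} \<Longrightarrow> dist s r < e \<Longrightarrow> dist (W s \<omega>) (W r \<omega>) < d"
      using p[unfolded continuous_on_iff] d(1) r by (metis atLeast_iff)
    then show ?thesis using d(2) by (intro exI[of _ e]) (auto simp: dist_commute subset_iff)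
  qed
  then obtain e where e: "e > 0" "\<And>s. 0 \<le> s \<Longrightarrow> dist s r < e \<Longrightarrow> W s \<omega> \<in> D" by auto
  have "ennreal (r + e) \<le> exit_time W D \<omega>"
  proof (subst le_exit_time_iff)
    show "\<forall>s. 0 < s \<longrightarrow> s < r + e \<longrightarrow> W s \<omega> \<in> D"
    proof (intro allI impI)
      fix s assume s: "0 < s" "s < r + e"
      show "W s \<omega> \<in> D"
      proof (cases "s \<le> r")
        case True
        then show ?thesis using in_D s by auto
      next
        case False
        then show ?thesis using e(2)[of s] s by (simp add: dist_real_def)
      qed
    qed
  qed (use r e in simp)
  moreover have "ennreal r < ennreal (r + e)" using r e by (simp add: ennreal_less_iff)
  ultimately show "ennreal r < exit_time W D \<omega>" by simp
qed

lemma exit_time_finite: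
  fixes W :: "real \<Rightarrow> 'w \<Rightarrow> 'a::metric_space"
  assumes D: "open D" and p: "continuous_on {0..} (\<lambda>t. W t \<omega>)" and D0: "W 0 \<omega> \<in> D"
    and fin: "exit_time W D \<omega> < \<infinity>"
  defines "T \<equiv> enn2real (exit_time W D \<omega>)"
  shows "0 < T" and "\<And>s. 0 \<le> s \<Longrightarrow> s < T \<Longrightarrow> W s \<omega> \<in> D" and "W T \<omega> \<notin> D"
    and "W T \<omega> \<in> frontier D" and "exit_time W D \<omega> = ennreal T"
proof -
  show eq: "exit_time W D \<omega> = ennreal T" using fin by (simp add: T_def)
  note iff = less_exit_time_iff[of D W \<omega>, OF D p D0]
  have "ennreal 0 < exit_time W D \<omega>" using iff[of 0] D0 by simp
  then show T: "0 < T" unfolding eq by simp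
  show in_D: "W s \<omega> \<in> D" if "0 \<le> s" "s < T" for s
    using iff[OF that(1)] that unfolding eq by (simp add: ennreal_less_iff)
  show notin: "W T \<omega> \<notin> D"
  proof
    assume "W T \<omega> \<in> D"
    then have "\<forall>s\<in>{0..T}. W s \<omega> \<in> D" using in_D by (metis atLeastAtMost_iff order_le_less)
    then show False using iff[of T] T unfolding eq by simp
  qed
  have "(\<lambda>n. T - T / real (Suc (Suc n))) \<longlonglongrightarrow> T - 0"
    by (intro tendsto_intros LIMSEQ_Suc[OF LIMSEQ_Suc[OF lim_const_over_n]])
  then have "(\<lambda>n. W (T - T / real (Suc (Suc n))) \<omega>) \<longlonglongrightarrow> W T \<omega>"
    by (intro continuous_on_tendsto_compose[OF p]) (use T in \<open>auto simp: field_simps\<close>)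
  moreover have "W (T - T / real (Suc (Suc n))) \<omega> \<in> D" for n
    by (rule in_D) (use T in \<open>auto simp: field_simps\<close>)
  ultimately have "W T \<omega> \<in> closure D" unfolding closure_sequential
    by (intro exI[of _ "\<lambda>n. W (T - T / real (Suc (Suc n))) \<omega>"]) simp
  then show "W T \<omega> \<in> frontier D" using notin D by (simp add: frontier_def interior_open)
qed

context brownian
begin

text \<open>Round the time down to multiples of \<open>1 / real (Suc m)\<close>: each rounded
  version takes countably many values, and path continuity gives the limit.\<close>

lemma measurable_random_time:
  assumes T[measurable]: "T \<in> borel_measurable M" and T0: "\<And>\<omega>. 0 \<le> T \<omega>"
  shows "(\<lambda>\<omega>. W (T \<omega>) \<omega>) \<in> borel_measurable M"
proof (rule borel_measurable_LIMSEQ_metric)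
  let ?r = "\<lambda>m \<omega>. real (nat \<lfloor>T \<omega> * real (Suc m)\<rfloor>) / real (Suc m)"
  show "(\<lambda>\<omega>. W (?r m \<omega>) \<omega>) \<in> borel_measurable M" for m
  proof (rule measurable_compose_countable[where f="\<lambda>k. W (real k / real (Suc m))" and g="\<lambda>\<omega>. nat \<lfloor>T \<omega> * real (Suc m)\<rfloor>"])
    show "W (real k / real (Suc m)) \<in> borel_measurable M" for k by (rule measurable_W) simp
    show "(\<lambda>\<omega>. nat \<lfloor>T \<omega> * real (Suc m)\<rfloor>) \<in> M \<rightarrow>\<^sub>M count_space UNIV" by measurable
  qed
  fix \<omega> assume \<omega>: "\<omega> \<in> space M"
  have fl: "?r m \<omega> \<le> T \<omega>" "T \<omega> - 1 / real (Suc m) \<le> ?r m \<omega>" for m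
  proof -
    define q n where "q = real (Suc m)" and "n = real (nat \<lfloor>T \<omega> * q\<rfloor>)"
    have q: "q > 0" by (simp add: q_def)
    have "0 \<le> T \<omega> * q" using T0 q by simp
    then have "n = of_int \<lfloor>T \<omega> * q\<rfloor>" by (simp add: n_def)
    then have "n \<le> T \<omega> * q" "T \<omega> * q \<le> n + 1"
      using floor_correct[of "T \<omega> * q"] by simp_all
    then have "n / q \<le> T \<omega>" "T \<omega> \<le> (n + 1) / q"
      using q by (simp_all only: pos_divide_le_eq pos_le_divide_eq)
    then show "?r m \<omega> \<le> T \<omega>" "T \<omega> - 1 / real (Suc m) \<le> ?r m \<omega>"
      unfolding q_def[symmetric] n_def[symmetric] by (simp_all add: add_divide_distrib)
  qed
  have "(\<lambda>m. ?r m \<omega>) \<longlonglongrightarrow> T \<omega>" by (rule LIMSEQ_from_below) (rule fl)+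
  then show "(\<lambda>m. W (?r m \<omega>) \<omega>) \<longlonglongrightarrow> W (T \<omega>) \<omega>"
    by (rule continuous_on_tendsto_compose[OF continuous_W[OF \<omega>]]) (use T0 in auto)
qed

text \<open>The start may lie outside \<open>D\<close>, so the open interval from 0 to
  \<open>r\<close> is exhausted by the intervals from \<open>?a m\<close> to
  \<open>r - ?a m\<close>. Their left ends are rational, and \<open>stays_iff\<close> turns each
  condition into a countable one.\<close>

lemma measurable_exit_time:
  assumes D: "open D"
  shows "exit_time W D \<in> borel_measurable M"
proof (rule borel_measurableI_ge)
  have sets: "{\<omega> \<in> space M. ennreal r \<le> exit_time W D \<omega>} \<in> sets M" if r: "0 \<le> r" for r
  proof -
    let ?a = "\<lambda>m. 1 / real (Suc m)"
    have "{\<omega> \<in> space M. ennreal r \<le> exit_time W D \<omega>} =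
        {\<omega> \<in> space M. \<forall>m. \<exists>j. \<forall>q\<in>rat_times \<inter> {?a m..r - ?a m}. W q \<omega> \<in> inner_part D j}"
    proof (intro Collect_cong conj_cong refl)
      fix \<omega> assume \<omega>: "\<omega> \<in> space M"
      have "(\<forall>s. 0 < s \<longrightarrow> s < r \<longrightarrow> W s \<omega> \<in> D) \<longleftrightarrow> (\<forall>m. \<forall>s\<in>{?a m..r - ?a m}. W s \<omega> \<in> D)"
      proof (intro iffI allI impI ballI)
        fix m s assume *: "\<forall>s. 0 < s \<longrightarrow> s < r \<longrightarrow> W s \<omega> \<in> D" and s: "s \<in> {?a m..r - ?a m}"
        have "0 < ?a m" by simp
        then show "W s \<omega> \<in> D" using * s by (metis atLeastAtMost_iff diff_gt_0_iff_gt le_diff_eq less_le_trans not_le add.commute less_add_same_cancel1)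
      next
        fix s assume *: "\<forall>m. \<forall>s\<in>{?a m..r - ?a m}. W s \<omega> \<in> D" and s: "0 < s" "s < r"
        then have "0 < min s (r - s)" by simp
        then obtain m where "?a m < min s (r - s)" using nat_approx_posE by blast
        then have "s \<in> {?a m..r - ?a m}" by simp
        then show "W s \<omega> \<in> D" using * by blast
      qed
      also have "\<dots> \<longleftrightarrow> (\<forall>m. \<exists>j. \<forall>q\<in>rat_times \<inter> {?a m..r - ?a m}. W q \<omega> \<in> inner_part D j)"
        by (intro all_cong1 stays_iff[OF D continuous_W[OF \<omega>]]) auto
      finally show "ennreal r \<le> exit_time W D \<omega> \<longleftrightarrow> (\<forall>m. \<exists>j. \<forall>q\<in>rat_times \<inter> {?a m..r - ?a m}. W q \<omega> \<in> inner_part D j)"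
        unfolding le_exit_time_iff[OF r] .
    qed
    also have "\<dots> \<in> sets M"
    proof (intro sets.sets_Collect_countable_All sets.sets_Collect_countable_Ex sets.sets_Collect_countable_All')
      fix m j q assume "q \<in> rat_times \<inter> {?a m..r - ?a m}"
      then have "W q \<in> borel_measurable M" by (intro measurable_W) (simp add: rat_times_def)
      then show "{\<omega> \<in> space M. W q \<omega> \<in> inner_part D j} \<in> sets M"
        by (rule measurable_sets_Collect) measurable
    qed (auto simp: rat_times_def countable_rat)
    finally show ?thesis .
  qed
  fix y :: ennreal
  show "{\<omega> \<in> space M. y \<le> exit_time W D \<omega>} \<in> sets M"
  proof (cases y rule: ennreal_cases)
    case (real r)
    then show ?thesis using sets by simp
  next
    case top
    have "{\<omega> \<in> space M. y \<le> exit_time W D \<omega>} = {\<omega> \<in> space M. \<forall>n::nat. ennreal (real n) \<le> exit_time W D \<omega>}"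
    proof (intro Collect_cong conj_cong refl iffI allI)
      fix \<omega> assume *: "\<forall>n::nat. ennreal (real n) \<le> exit_time W D \<omega>"
      show "y \<le> exit_time W D \<omega>"
      proof (rule ccontr)
        assume "\<not> y \<le> exit_time W D \<omega>"
        then have "exit_time W D \<omega> < \<infinity>" using top by (simp add: not_le)
        then obtain n :: nat where "exit_time W D \<omega> < of_nat n" using ennreal_Ex_less_of_nat by auto
        then show False using * by (simp add: ennreal_of_nat_eq_real_of_nat not_le[symmetric])
      qed
    qed (use top in \<open>simp add: top_unique\<close>)
    also have "\<dots> \<in> sets M" by (intro sets.sets_Collect_countable_All sets) simp
    finally show ?thesis .
  qed
qed

lemma measurable_exit_point: "open D \<Longrightarrow> exit_point W D \<in> borel_measurable M"
  unfolding exit_point_def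
  using measurable_exit_time by (intro measurable_random_time) auto

end

section \<open>The exit functional on path space\<close>

text \<open>The pair consists of a starting point and the increments. By \<open>stays_iff\<close>
  the condition says, for a continuous path, that it stays in \<open>D\<close> during the times from
  0 to \<open>r\<close>, but in a form that is measurable on the product space.\<close>

definition lasting :: "'a::euclidean_space set \<Rightarrow> real \<Rightarrow> 'a \<times> (real \<Rightarrow> 'a) \<Rightarrow> bool" where
  "lasting D r p \<longleftrightarrow> (\<exists>j. \<forall>q\<in>rat_times \<inter> {0..r}. fst p + snd p q \<in> inner_part D j)"

text \<open>A discretization of \<open>e\<^sup>-\<^sup>c\<^sup>\<tau> g(W \<tau>)\<close> that reads the path at rational times only; at most one
  summand is nonzero.\<close>

definition exit_approx :: "real \<Rightarrow> ('a::euclidean_space \<Rightarrow> real) \<Rightarrow> 'a set \<Rightarrow> nat \<Rightarrow> 'a \<times> (real \<Rightarrow> 'a) \<Rightarrow> real" where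
  "exit_approx c g D m p = (\<Sum>k. if lasting D (real k / real (Suc m)) p \<and> \<not> lasting D (real (Suc k) / real (Suc m)) p
     then exp (- c * (real k / real (Suc m))) * g (fst p + snd p (real k / real (Suc m))) else 0)"

text \<open>Paths in the product space need not be continuous, hence the clipping to \<open>[-B, B]\<close>.\<close>

definition exit_functional :: "real \<Rightarrow> ('a::euclidean_space \<Rightarrow> real) \<Rightarrow> real \<Rightarrow> 'a set \<Rightarrow> 'a \<times> (real \<Rightarrow> 'a) \<Rightarrow> real" where
  "exit_functional c g B D p = max (- B) (min B (lim (\<lambda>m. exit_approx c g D m p)))"

lemma measurable_coordinate:
  assumes q: "q \<in> rat_times"
  shows "(\<lambda>p. fst p + snd p q) \<in> borel_measurable (borel \<Otimes>\<^sub>M path_space)"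
proof -
  have [measurable]: "(\<lambda>w. w q) \<in> borel_measurable path_space"
    unfolding path_space_def by (rule measurable_component_singleton[OF q])
  show ?thesis by measurable
qed

lemma lasting_measurable [measurable]:
  "Measurable.pred (borel \<Otimes>\<^sub>M path_space) (lasting (D :: 'a::euclidean_space set) r)"
proof -
  have "{p \<in> space (borel \<Otimes>\<^sub>M path_space). \<exists>j. \<forall>q\<in>rat_times \<inter> {0..r}. fst p + snd p q \<in> inner_part D j}
      \<in> sets (borel \<Otimes>\<^sub>M (path_space :: (real \<Rightarrow> 'a) measure))"
  proof (intro sets.sets_Collect_countable_Ex sets.sets_Collect_countable_All')
    fix j q assume "q \<in> rat_times \<inter> {0..r}"
    then show "{p \<in> space (borel \<Otimes>\<^sub>M path_space). fst p + snd p q \<in> inner_part D j} \<in> sets (borel \<Otimes>\<^sub>M path_space)"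
      by (intro measurable_sets_Collect[OF measurable_coordinate]) auto
  qed (auto simp: rat_times_def countable_rat)
  then show ?thesis unfolding lasting_def pred_def .
qed

lemma ratio_in_rat_times: "real k / real n \<in> rat_times"
  by (simp add: rat_times_def)

lemma exit_functional_measurable [measurable]:
  assumes [measurable]: "g \<in> borel_measurable borel"
  shows "exit_functional c g B D \<in> borel_measurable (borel \<Otimes>\<^sub>M path_space)"
proof -
  note [measurable] = measurable_coordinate[OF ratio_in_rat_times]
  have [measurable]: "exit_approx c g D m \<in> borel_measurable (borel \<Otimes>\<^sub>M path_space)" for m
    unfolding exit_approx_def by measurable
  show ?thesis unfolding exit_functional_def by measurable
qed

lemma exit_functional_bound: "0 \<le> B \<Longrightarrow> \<bar>exit_functional c g B D p\<bar> \<le> B"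
  by (auto simp: exit_functional_def)

lemma lasting_iff:
  fixes W :: "real \<Rightarrow> 'w \<Rightarrow> 'a::euclidean_space"
  assumes D: "open D" and W: "continuous_on {0..} (\<lambda>s. W s \<omega>)" and t: "0 \<le> t"
  shows "lasting D r (W t \<omega>, future W t \<omega>) \<longleftrightarrow> (\<forall>s\<in>{0..r}. W (t + s) \<omega> \<in> D)"
proof -
  have "continuous_on {0..} (\<lambda>s. W (t + s) \<omega>)"
    by (rule continuous_on_compose2[OF W]) (use t in \<open>auto intro!: continuous_intros\<close>)
  then have "(\<forall>s\<in>{0..r}. W (t + s) \<omega> \<in> D) \<longleftrightarrow> (\<exists>j. \<forall>q\<in>rat_times \<inter> {0..r}. W (t + q) \<omega> \<in> inner_part D j)"
    by (rule stays_iff[OF D]) auto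
  also have "\<dots> \<longleftrightarrow> lasting D r (W t \<omega>, future W t \<omega>)"
    unfolding lasting_def by (intro ex_cong1 ball_cong refl) (auto simp: future_def)
  finally show ?thesis ..
qed

lemma exit_functional_exit:
  fixes W :: "real \<Rightarrow> 'w \<Rightarrow> 'a::euclidean_space"
  assumes D: "open D" and W: "continuous_on {0..} (\<lambda>s. W s \<omega>)" and t: "0 \<le> t"
    and g: "continuous_on UNIV g" "\<And>z. \<bar>g z\<bar> \<le> B" and c: "0 \<le> c"
    and T: "0 < T" "\<And>s. 0 \<le> s \<Longrightarrow> s < T \<Longrightarrow> W (t + s) \<omega> \<in> D" "W (t + T) \<omega> \<notin> D"
  shows "exit_functional c g B D (W t \<omega>, future W t \<omega>) = exp (- c * T) * g (W (t + T) \<omega>)"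
proof -
  let ?p = "(W t \<omega>, future W t \<omega>)"
  have last: "lasting D r ?p \<longleftrightarrow> r < T" if "0 \<le> r" for r
    unfolding lasting_iff[of D W \<omega>, OF D W t]
  proof
    assume *: "\<forall>s\<in>{0..r}. W (t + s) \<omega> \<in> D"
    show "r < T"
    proof (rule ccontr)
      assume "\<not> r < T"
      then have "T \<in> {0..r}" using T(1) by simp
      then show False using * T(3) by blast
    qed
  next
    assume "r < T"
    then show "\<forall>s\<in>{0..r}. W (t + s) \<omega> \<in> D" using T(2) by simp
  qed
  \<comment> \<open>The last grid index strictly before \<open>T\<close>. It is the ceiling minus 1
    and not the floor, because at a grid time equal to \<open>T\<close> the path is no longer in
    \<open>D\<close>.\<close>
  define k where "k m = nat (\<lceil>T * real (Suc m)\<rceil> - 1)" for m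
  define r where "r m = real (k m) / real (Suc m)" for m
  have k: "real (k m) < T * real (Suc m)" "T * real (Suc m) \<le> real (Suc (k m))" for m
  proof -
    have pos: "0 < T * real (Suc m)" using T(1) by simp
    then have "1 \<le> \<lceil>T * real (Suc m)\<rceil>" by (simp add: one_le_ceiling)
    then have "real (k m) = of_int \<lceil>T * real (Suc m)\<rceil> - 1" by (simp add: k_def)
    then show "real (k m) < T * real (Suc m)" "T * real (Suc m) \<le> real (Suc (k m))"
      using ceiling_correct[of "T * real (Suc m)"] by auto
  qed
  have r: "r m < T" "T - 1 / real (Suc m) \<le> r m" "0 \<le> r m" for m
  proof -
    have q: "real (Suc m) > 0" by simp
    show "r m < T" using k(1)[of m] q unfolding r_def by (simp only: pos_divide_less_eq)
    have "T \<le> real (Suc (k m)) / real (Suc m)" using k(2)[of m] q by (simp only: pos_le_divide_eq)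
    also have "\<dots> = r m + 1 / real (Suc m)" unfolding r_def by (simp add: add_divide_distrib)
    finally show "T - 1 / real (Suc m) \<le> r m" by linarith
    show "0 \<le> r m" unfolding r_def by simp
  qed
  have approx: "exit_approx c g D m ?p = exp (- c * r m) * g (W (t + r m) \<omega>)" for m
  proof -
    have iff: "lasting D (real i / real (Suc m)) ?p \<and> \<not> lasting D (real (Suc i) / real (Suc m)) ?p \<longleftrightarrow> i = k m" for i
    proof -
      have q: "real (Suc m) > 0" by simp
      have "lasting D (real j / real (Suc m)) ?p \<longleftrightarrow> real j < T * real (Suc m)" for j
        using last[of "real j / real (Suc m)"] q by (simp only: pos_divide_less_eq divide_nonneg_pos of_nat_0_le_iff)
      then have "lasting D (real i / real (Suc m)) ?p \<and> \<not> lasting D (real (Suc i) / real (Suc m)) ?p \<longleftrightarrow>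
          real i < T * real (Suc m) \<and> T * real (Suc m) \<le> real (Suc i)" by (simp only: not_less)
      also have "\<dots> \<longleftrightarrow> i = k m"
      proof
        assume *: "real i < T * real (Suc m) \<and> T * real (Suc m) \<le> real (Suc i)"
        then have "real i < real (Suc (k m))" "real (k m) < real (Suc i)" using k[of m] by linarith+
        then show "i = k m" by (simp only: of_nat_less_iff)
      qed (use k[of m] in simp)
      finally show ?thesis .
    qed
    have "exit_approx c g D m ?p = (\<Sum>i. if i = k m then exp (- c * r m) * g (W t \<omega> + future W t \<omega> (r m)) else 0)"
      unfolding exit_approx_def iff r_def by (intro suminf_cong) simp
    also have "\<dots> = exp (- c * r m) * g (W t \<omega> + future W t \<omega> (r m))"
      using sums_single[of "k m" "\<lambda>_. exp (- c * r m) * g (W t \<omega> + future W t \<omega> (r m))"] by (simp add: sums_iff)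
    also have "W t \<omega> + future W t \<omega> (r m) = W (t + r m) \<omega>"
    proof -
      have "r m \<in> rat_times" unfolding r_def by (rule ratio_in_rat_times)
      then show ?thesis by (simp add: future_def)
    qed
    finally show ?thesis .
  qed
  have rl: "r \<longlonglongrightarrow> T" by (rule LIMSEQ_from_below) (rule r(2), rule less_imp_le[OF r(1)])
  have trl: "(\<lambda>m. t + r m) \<longlonglongrightarrow> t + T" by (intro tendsto_intros rl)
  have "(\<lambda>m. W (t + r m) \<omega>) \<longlonglongrightarrow> W (t + T) \<omega>"
    by (rule continuous_on_tendsto_compose[OF W trl]) (use t T(1) r(3) in auto)
  then have "(\<lambda>m. g (W (t + r m) \<omega>)) \<longlonglongrightarrow> g (W (t + T) \<omega>)"
    by (rule continuous_on_tendsto_compose[OF g(1)]) auto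
  then have "(\<lambda>m. exit_approx c g D m ?p) \<longlonglongrightarrow> exp (- c * T) * g (W (t + T) \<omega>)"
    unfolding approx by (intro tendsto_intros rl)
  then have "lim (\<lambda>m. exit_approx c g D m ?p) = exp (- c * T) * g (W (t + T) \<omega>)" by (rule limI)
  moreover have "\<bar>exp (- c * T) * g (W (t + T) \<omega>)\<bar> \<le> 1 * B"
    unfolding abs_mult using c T(1) g(2) by (intro mult_mono) auto
  ultimately show ?thesis unfolding exit_functional_def by (auto simp: abs_le_iff max_def min_def)
qed

lemma exit_functional_stay:
  fixes W :: "real \<Rightarrow> 'w \<Rightarrow> 'a::euclidean_space"
  assumes D: "open D" and W: "continuous_on {0..} (\<lambda>s. W s \<omega>)" and t: "0 \<le> t" and B: "0 \<le> B"
    and stay: "\<And>s. 0 \<le> s \<Longrightarrow> W (t + s) \<omega> \<in> D"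
  shows "exit_functional c g B D (W t \<omega>, future W t \<omega>) = 0"
proof -
  have "lasting D r (W t \<omega>, future W t \<omega>)" for r
    unfolding lasting_iff[of D W \<omega>, OF D W t] using stay by simp
  then have "exit_approx c g D m (W t \<omega>, future W t \<omega>) = 0" for m
    unfolding exit_approx_def by simp
  then have "lim (\<lambda>m. exit_approx c g D m (W t \<omega>, future W t \<omega>)) = 0"
    by (simp add: limI)
  then show ?thesis using B by (simp add: exit_functional_def)
qed

section \<open>Interior regularity\<close>

definition payoff :: "(real \<Rightarrow> 'w \<Rightarrow> 'a::topological_space) \<Rightarrow> real \<Rightarrow> 'a set \<Rightarrow> ('a \<Rightarrow> real) \<Rightarrow> 'w \<Rightarrow> real" where
  "payoff W c D g \<omega> = (if exit_time W D \<omega> < \<infinity> \<and> exit_point W D \<omega> \<in> frontier D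
     then exp (- c * enn2real (exit_time W D \<omega>)) * g (exit_point W D \<omega>) else 0)"

lemma yukawa_expectation_eq: "yukawa_expectation P W \<mu> D f x = (\<integral>\<omega>. payoff W (\<mu>\<^sup>2 / 2) D f \<omega> \<partial>P x)"
  unfolding yukawa_expectation_def payoff_def ..

lemma payoff_cong: "(\<And>z. z \<in> frontier D \<Longrightarrow> f z = g z) \<Longrightarrow> payoff W c D f = payoff W c D g"
  by (auto simp: payoff_def)

lemma payoff_bound:
  assumes "\<And>z. z \<in> frontier D \<Longrightarrow> \<bar>g z\<bar> \<le> B" "0 \<le> B" "0 \<le> c"
  shows "\<bar>payoff W c D g \<omega>\<bar> \<le> B"
proof -
  have "\<bar>exp (- c * r) * g z\<bar> \<le> 1 * B" if "z \<in> frontier D" "0 \<le> r" for r z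
    unfolding abs_mult using assms that by (intro mult_mono) auto
  then show ?thesis using assms by (auto simp: payoff_def)
qed

lemma payoff_exit:
  fixes W :: "real \<Rightarrow> 'w \<Rightarrow> 'a::metric_space"
  assumes D: "open D" and W: "continuous_on {0..} (\<lambda>s. W s \<omega>)" and D0: "W 0 \<omega> \<in> D" and fin: "exit_time W D \<omega> < \<infinity>"
  shows "payoff W c D g \<omega> = exp (- c * enn2real (exit_time W D \<omega>)) * g (W (enn2real (exit_time W D \<omega>)) \<omega>)"
  using exit_time_finite(4)[of D W \<omega>, OF D W D0 fin] fin by (simp add: payoff_def exit_point_def)

text \<open>While the path has not left \<open>D\<close> by time \<open>t\<close>, the remaining
  exit time is the old one minus \<open>t\<close> and the exit point is unchanged, so the discount
  factors multiply. If the path never leaves, both sides are 0. The identity may fail once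
  \<open>t\<close> has passed the exit time; that event is left to the maximal inequality.\<close>

lemma payoff_shift:
  fixes W :: "real \<Rightarrow> 'w \<Rightarrow> 'a::euclidean_space"
  assumes D: "open D" and W: "continuous_on {0..} (\<lambda>s. W s \<omega>)" and D0: "W 0 \<omega> \<in> D"
    and g: "continuous_on UNIV g" "\<And>z. \<bar>g z\<bar> \<le> B" and c: "0 \<le> c"
    and t: "0 \<le> t" "ennreal t < exit_time W D \<omega>"
  shows "payoff W c D g \<omega> = exp (- c * t) * exit_functional c g B D (W t \<omega>, future W t \<omega>)"
proof (cases "exit_time W D \<omega> < \<infinity>")
  case True
  define T where "T = enn2real (exit_time W D \<omega>)"
  note E = exit_time_finite[of D W \<omega>, OF D W D0 True, folded T_def]
  have tT: "t < T" using t unfolding E(5) by (simp add: ennreal_less_iff)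
  have "exit_functional c g B D (W t \<omega>, future W t \<omega>) = exp (- c * (T - t)) * g (W (t + (T - t)) \<omega>)"
    by (rule exit_functional_exit[of D W \<omega>, OF D W t(1) g c]) (use tT t E in auto)
  then have "exp (- c * t) * exit_functional c g B D (W t \<omega>, future W t \<omega>) = exp (- c * t + - c * (T - t)) * g (W T \<omega>)"
    by (simp only: exp_add mult.assoc) simp
  also have "- c * t + - c * (T - t) = - c * T" by (simp add: algebra_simps)
  finally show ?thesis unfolding payoff_exit[of D W \<omega>, OF D W D0 True] T_def ..
next
  case False
  then have top: "exit_time W D \<omega> = \<infinity>" by (metis infinity_ennreal_def less_top)
  have "W s \<omega> \<in> D" if "0 \<le> s" for s
    using less_exit_time_iff[of D W \<omega>, OF D W D0 that] that unfolding top by simp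
  then have "exit_functional c g B D (W t \<omega>, future W t \<omega>) = 0"
    using t(1) g(2)[of 0] by (intro exit_functional_stay[of D W \<omega>, OF D W]) auto
  then show ?thesis using False by (simp add: payoff_def)
qed

lemma (in brownian) payoff_measurable:
  assumes D: "open D" and [measurable]: "g \<in> borel_measurable borel"
  shows "payoff W c D g \<in> borel_measurable M"
proof -
  note [measurable] = measurable_exit_time[OF D] measurable_exit_point[OF D]
  have [measurable]: "frontier D \<in> sets borel" by (rule borel_closed[OF frontier_closed])
  show ?thesis unfolding payoff_def by measurable
qed

text \<open>The data \<open>g\<close> live on the whole space and are continuous there, because
  \<open>exit_functional\<close> evaluates them at points of the path just before the exit, which
  lie inside \<open>D\<close>.\<close>

locale brownian_payoff = brownian_fam P W
  for P :: "'a::euclidean_space \<Rightarrow> 'w measure" and W +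
  fixes D :: "'a set" and c B :: real and g :: "'a \<Rightarrow> real"
  assumes open_D: "open D" and c: "0 \<le> c" and continuous_g: "continuous_on UNIV g" and g_bound: "\<And>z. \<bar>g z\<bar> \<le> B"
begin

lemma B_nonneg: "0 \<le> B"
  using g_bound[of 0] by linarith

lemma g_measurable [measurable]: "g \<in> borel_measurable borel"
  by (rule borel_measurable_continuous_onI[OF continuous_g])

definition u :: "'a \<Rightarrow> real" where
  "u x = (\<integral>\<omega>. payoff W c D g \<omega> \<partial>P x)"

definition F :: "'a \<times> (real \<Rightarrow> 'a) \<Rightarrow> real" where
  "F p = (if fst p \<in> D then exit_functional c g B D p else 0)"

definition U :: "'a \<Rightarrow> real" where
  "U z = (\<integral>w. F (z, w) \<partial>path_law)"

lemma F_measurable [measurable]: "F \<in> borel_measurable (borel \<Otimes>\<^sub>M path_space)"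
proof -
  have [measurable]: "D \<in> sets borel" using open_D by simp
  show ?thesis unfolding F_def by measurable
qed

lemma F_bound: "\<bar>F p\<bar> \<le> B"
  using exit_functional_bound[OF B_nonneg, of c g D p] B_nonneg by (simp add: F_def)

lemma bounded_borel_U: "bounded_borel U B"
  unfolding U_def by (rule bounded_borel_path_integral[OF F_measurable F_bound])

lemma payoff_le: "\<bar>payoff W c D g \<omega>\<bar> \<le> B"
  by (rule payoff_bound) (use g_bound B_nonneg c in auto)

lemma u_bound: "\<bar>u x\<bar> \<le> B"
proof -
  interpret brownian "P x" W x by (rule brownian)
  have "\<bar>u x\<bar> \<le> (\<integral>\<omega>. B \<partial>P x)"
    unfolding u_def
    by (rule abs_integral_le, rule integrable_const_bound[where B=B])
      (use payoff_le payoff_measurable[OF open_D] in auto)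
  then show ?thesis using prob_space by simp
qed

lemma u_eq_U:
  assumes x: "x \<in> D"
  shows "u x = U x"
proof -
  interpret brownian "P x" W x by (rule brownian)
  note [measurable] = measurable_future[OF order_refl] measurable_W[OF order_refl] payoff_measurable[OF open_D]
  have "u x = (\<integral>\<omega>. F (W 0 \<omega>, future W 0 \<omega>) \<partial>P x)"
    unfolding u_def
  proof (rule integral_cong_AE)
    show "AE \<omega> in P x. payoff W c D g \<omega> = F (W 0 \<omega>, future W 0 \<omega>)"
      using W_0 AE_space
    proof eventually_elim
      case (elim \<omega>)
      then have D0: "W 0 \<omega> \<in> D" and W: "continuous_on {0..} (\<lambda>s. W s \<omega>)" using x continuous_W by auto
      have "ennreal 0 < exit_time W D \<omega>"
        using less_exit_time_iff[of D W \<omega>, OF open_D W D0 order_refl] D0 by simp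
      then show ?case
        using payoff_shift[of D W \<omega>, OF open_D W D0 continuous_g g_bound c order_refl] D0 by (simp add: F_def)
    qed
  qed measurable
  also have "\<dots> = U x" unfolding U_def by (rule integral_start[OF F_measurable])
  finally show ?thesis .
qed

text \<open>By \<open>payoff_shift\<close> the two integrands agree unless the path moves by
  \<open>\<delta>\<close> before time \<open>t\<close>. On that event they differ by at most
  \<open>2 * B\<close>, and the maximal inequality bounds its probability.\<close>

lemma U_approx:
  assumes \<delta>: "0 < \<delta>" "ball x \<delta> \<subseteq> D" and t: "0 < t"
  shows "\<bar>U x - exp (- c * t) * heat t U x\<bar> \<le> 2 * B * (512 * moment TYPE('a) 4 / \<delta> ^ 4) * t\<^sup>2"
proof -
  interpret brownian "P x" W x by (rule brownian)
  have t0: "0 \<le> t" using t by simp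
  have x: "x \<in> D" using \<delta> by auto
  note [measurable] = measurable_future[OF t0] measurable_W[OF t0] payoff_measurable[OF open_D]
  let ?F = "\<lambda>\<omega>. F (W t \<omega>, future W t \<omega>)"
  obtain A where A[measurable]: "A \<in> sets (P x)" and PA: "prob A \<le> 512 * moment TYPE('a) 4 / \<delta> ^ 4 * t\<^sup>2"
    and close: "\<And>\<omega> s. \<omega> \<in> space (P x) - A \<Longrightarrow> 0 \<le> s \<Longrightarrow> s \<le> t \<Longrightarrow> norm (W s \<omega> - W 0 \<omega>) < \<delta>"
    using maximal_inequality[OF t0 \<delta>(1)] by metis
  have i1: "integrable (P x) (payoff W c D g)"
    by (rule integrable_const_bound[where B=B]) (use payoff_le in auto)
  have i2: "integrable (P x) ?F"
    by (rule integrable_const_bound[where B=B]) (use F_bound in auto)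
  have e: "0 < exp (- c * t)" "exp (- c * t) \<le> 1" using c t by auto
  have "heat t U x = (\<integral>\<omega>. ?F \<omega> \<partial>P x)"
    unfolding U_def by (rule integral_markov[OF F_measurable F_bound t, symmetric])
  then have "U x - exp (- c * t) * heat t U x = (\<integral>\<omega>. payoff W c D g \<omega> - exp (- c * t) * ?F \<omega> \<partial>P x)"
    unfolding u_eq_U[OF x, symmetric] u_def using i1 i2 by simp
  then have "\<bar>U x - exp (- c * t) * heat t U x\<bar> \<le> (\<integral>\<omega>. \<bar>payoff W c D g \<omega> - exp (- c * t) * ?F \<omega>\<bar> \<partial>P x)"
    by (simp only: integral_abs_bound)
  also have "\<dots> \<le> (\<integral>\<omega>. 2 * B * indicator A \<omega> \<partial>P x)"
  proof (rule integral_mono_AE)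
    show "integrable (P x) (\<lambda>\<omega>. \<bar>payoff W c D g \<omega> - exp (- c * t) * ?F \<omega>\<bar>)" using i1 i2 by simp
    show "integrable (P x) (\<lambda>\<omega>. 2 * B * indicator A \<omega>)" by (intro integrable_mult_right integrable_real_indicator) (auto simp: emeasure_eq_measure)
    show "AE \<omega> in P x. \<bar>payoff W c D g \<omega> - exp (- c * t) * ?F \<omega>\<bar> \<le> 2 * B * indicator A \<omega>"
      using W_0 AE_space
    proof eventually_elim
      case (elim \<omega>)
      show ?case
      proof (cases "\<omega> \<in> A")
        case True
        have "\<bar>exp (- c * t) * ?F \<omega>\<bar> \<le> 1 * B" unfolding abs_mult using e F_bound by (intro mult_mono) auto
        then show ?thesis using True payoff_le[of \<omega>] by simp
      next
        case False
        have W: "continuous_on {0..} (\<lambda>s. W s \<omega>)" and D0: "W 0 \<omega> \<in> D" using continuous_W elim x by auto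
        have in_D: "W s \<omega> \<in> D" if "s \<in> {0..t}" for s
        proof -
          have "norm (W s \<omega> - x) < \<delta>" using close[of \<omega> s] elim False that by simp
          then show ?thesis using \<delta>(2) by (auto simp: subset_iff dist_norm norm_minus_commute)
        qed
        then have lt: "ennreal t < exit_time W D \<omega>" using less_exit_time_iff[of D W \<omega>, OF open_D W D0 t0] by blast
        have "?F \<omega> = exit_functional c g B D (W t \<omega>, future W t \<omega>)" using in_D[of t] t0 by (simp add: F_def)
        then show ?thesis
          using payoff_shift[of D W \<omega>, OF open_D W D0 continuous_g g_bound c t0 lt] False by simp
      qed
    qed
  qed
  also have "\<dots> = 2 * B * prob A" by simp
  also have "\<dots> \<le> 2 * B * (512 * moment TYPE('a) 4 / \<delta> ^ 4 * t\<^sup>2)" using B_nonneg PA by (intro mult_left_mono) auto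
  finally show ?thesis by (simp add: mult.assoc)
qed

lemma U_eigenfunction:
  assumes a: "a \<in> D"
  obtains \<delta> where "0 < \<delta>" "ball a \<delta> \<subseteq> D" "C2_on (ball a \<delta>) U" "\<And>x. x \<in> ball a \<delta> \<Longrightarrow> laplacian U x = 2 * c * U x"
proof -
  obtain e where e: "e > 0" "ball a e \<subseteq> D" using open_D a unfolding open_contains_ball by blast
  \<comment> \<open>Points at distance below \<open>3 * \<delta>\<close> from \<open>a\<close> need
    a further ball of radius \<open>\<delta>\<close> around them inside \<open>D\<close>.\<close>
  define \<delta> where "\<delta> = e / 4"
  have \<delta>: "\<delta> > 0" "4 * \<delta> = e" using e by (auto simp: \<delta>_def)
  define C where "C = 2 * B * (512 * moment TYPE('a) 4 / \<delta> ^ 4)"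
  have C: "C \<ge> 0" using B_nonneg moment_nonneg[where 'a='a] by (simp add: C_def)
  have approx: "\<bar>U y - exp (- c * t) * heat t U y\<bar> \<le> C * t\<^sup>2" if "0 < t" "t \<le> 1" "y \<in> ball a (3 * \<delta>)" for t y
  proof -
    have "ball y \<delta> \<subseteq> ball a e"
    proof
      fix z assume "z \<in> ball y \<delta>"
      then show "z \<in> ball a e" using that(3) \<delta> dist_triangle[of a z y] by simp
    qed
    then show ?thesis unfolding C_def using e(2) that by (intro U_approx \<delta>) auto
  qed
  have sub: "ball a \<delta> \<subseteq> D"
  proof -
    have "ball a \<delta> \<subseteq> ball a e" using \<delta> by (intro subset_ball) linarith
    then show ?thesis using e(2) by blast
  qed
  show thesis
    by (rule that[OF \<delta>(1) sub]) (rule eigenfunction_of_heat_approx[OF bounded_borel_U C c \<delta>(1) approx]; assumption)+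
qed

end

section \<open>Panharmonicity is a local property\<close>

lemma partial_deriv_cong:
  assumes "open S" "x \<in> S" "\<And>y. y \<in> S \<Longrightarrow> f y = g y"
  shows "partial_deriv b f x = partial_deriv b g x"
proof -
  have "((\<lambda>s. f (x + s *\<^sub>R b)) has_real_derivative d) (at 0) \<longleftrightarrow> ((\<lambda>s. g (x + s *\<^sub>R b)) has_real_derivative d) (at 0)" for d
    by (rule directional_deriv_cong[OF assms])
  then show ?thesis unfolding partial_deriv_def deriv_def by simp
qed

lemma C1_on_cong:
  assumes S: "open S" and eq: "\<And>y. y \<in> S \<Longrightarrow> f y = g y" and f: "C1_on S f"
  shows "C1_on S g"
  unfolding C1_on_def
proof (intro conjI ballI)
  show "continuous_on S g" using f eq by (auto simp: C1_on_def cong: continuous_on_cong)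
  fix b :: 'a assume b: "b \<in> Basis"
  show "continuous_on S (partial_deriv b g)"
    using f b partial_deriv_cong[OF S _ eq] by (auto simp: C1_on_def cong: continuous_on_cong)
  show "(\<lambda>s. g (x + s *\<^sub>R b)) differentiable at 0" if "x \<in> S" for x
  proof -
    have "((\<lambda>s. f (x + s *\<^sub>R b)) has_real_derivative d) (at 0) \<longleftrightarrow> ((\<lambda>s. g (x + s *\<^sub>R b)) has_real_derivative d) (at 0)" for d
      by (rule directional_deriv_cong[OF S that eq])
    then show ?thesis using f b that unfolding C1_on_def real_differentiable_def by blast
  qed
qed

lemma panharmonic_on_cong:
  assumes S: "open S" and eq: "\<And>y. y \<in> S \<Longrightarrow> f y = g y" and f: "panharmonic_on \<mu> S f"
  shows "panharmonic_on \<mu> S g"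
proof -
  have p: "partial_deriv b f x = partial_deriv b g x" if "x \<in> S" for b x
    by (rule partial_deriv_cong[OF S that eq])
  have "C1_on S g" using f by (intro C1_on_cong[OF S eq]) (auto simp: panharmonic_on_def C2_on_def)
  moreover have "C1_on S (partial_deriv b g)" if "b \<in> Basis" for b
    using f that by (intro C1_on_cong[OF S p]) (auto simp: panharmonic_on_def C2_on_def)
  moreover have "laplacian g x = laplacian f x" if "x \<in> S" for x
    unfolding laplacian_def using partial_deriv_cong[OF S that p] by simp
  ultimately show ?thesis using f eq by (simp add: panharmonic_on_def C2_on_def)
qed

lemma continuous_on_local:
  fixes f :: "'a::metric_space \<Rightarrow> real"
  assumes "open S" "\<And>a. a \<in> S \<Longrightarrow> \<exists>e>0. continuous_on (ball a e) f"
  shows "continuous_on S f"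
  unfolding continuous_on_eq_continuous_at[OF assms(1)]
  using assms(2) continuous_on_eq_continuous_at[OF open_ball] by (metis centre_in_ball)

lemma C1_on_local:
  assumes "open S" "\<And>a. a \<in> S \<Longrightarrow> \<exists>e>0. C1_on (ball a e) f"
  shows "C1_on S f"
  unfolding C1_on_def
proof (intro conjI ballI continuous_on_local[OF assms(1)])
  show "\<exists>e>0. continuous_on (ball a e) f" if "a \<in> S" for a
    using assms(2)[OF that] by (auto simp: C1_on_def)
  show "\<exists>e>0. continuous_on (ball a e) (partial_deriv b f)" if "a \<in> S" "b \<in> Basis" for a b
    using assms(2)[OF that(1)] that(2) by (auto simp: C1_on_def)
  show "(\<lambda>s. f (a + s *\<^sub>R b)) differentiable at 0" if "a \<in> S" "b \<in> Basis" for a b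
    using assms(2)[OF that(1)] that(2) by (auto simp: C1_on_def)
qed

lemma panharmonic_on_local:
  assumes S: "open S" and loc: "\<And>a. a \<in> S \<Longrightarrow> \<exists>e>0. panharmonic_on \<mu> (ball a e) f"
  shows "panharmonic_on \<mu> S f"
  unfolding panharmonic_on_def C2_on_def
proof (intro conjI ballI C1_on_local[OF S])
  show "\<exists>e>0. C1_on (ball a e) f" if "a \<in> S" for a
    using loc[OF that] by (auto simp: panharmonic_on_def C2_on_def)
  show "\<exists>e>0. C1_on (ball a e) (partial_deriv b f)" if "b \<in> Basis" "a \<in> S" for a b
    using loc[OF that(2)] that(1) by (auto simp: panharmonic_on_def C2_on_def)
  show "laplacian f a = \<mu>\<^sup>2 * f a" if "a \<in> S" for a
    using loc[OF that] by (auto simp: panharmonic_on_def)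
qed

lemma (in brownian_payoff) panharmonic_u:
  assumes \<mu>: "2 * c = \<mu>\<^sup>2"
  shows "panharmonic_on \<mu> D u"
proof -
  have "panharmonic_on \<mu> D U"
  proof (rule panharmonic_on_local[OF open_D])
    fix a assume "a \<in> D"
    then obtain \<delta> where "0 < \<delta>" "ball a \<delta> \<subseteq> D" "C2_on (ball a \<delta>) U" "\<And>x. x \<in> ball a \<delta> \<Longrightarrow> laplacian U x = 2 * c * U x"
      using U_eigenfunction by metis
    then show "\<exists>e>0. panharmonic_on \<mu> (ball a e) U" using \<mu> by (auto simp: panharmonic_on_def)
  qed
  then show ?thesis by (rule panharmonic_on_cong[OF open_D, rotated]) (simp add: u_eq_U)
qed

section \<open>Boundary values\<close>

context brownian_payoff
begin

text \<open>By the Markov property at a small time \<open>\<epsilon>\<close>, the probability of staying in \<open>D\<close> during \<open>[\<epsilon>, \<delta>]\<close> is of the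
  form \<open>P\<^sub>\<epsilon> \<psi>\<close>, hence continuous in the starting point.\<close>

lemma exit_time_upper_semicontinuous:
  assumes y: "\<P>(\<omega> in P y. exit_time W D \<omega> = 0) = 1" and \<delta>: "0 < \<delta>" and \<eta>: "0 < \<eta>"
  shows "\<exists>d>0. \<forall>x\<in>D. dist x y < d \<longrightarrow> \<P>(\<omega> in P x. ennreal \<delta> < exit_time W D \<omega>) < \<eta>"
proof -
  \<comment> \<open>Waiting times decreasing to 0; the denominator starts at 2 so that each is
    strictly below \<open>\<delta>\<close>.\<close>
  define a where "a n = \<delta> / real (n + 2)" for n
  have a: "0 < a n" "a n < \<delta>" for n using \<delta> by (auto simp: a_def field_simps intro!: add_pos_nonneg)
  have a_dec: "a n \<le> a m" if "m \<le> n" for m n using \<delta> that by (auto simp: a_def intro!: divide_left_mono)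
  have a0: "a \<longlonglongrightarrow> 0"
    unfolding a_def by (rule LIMSEQ_ignore_initial_segment[OF lim_const_over_n])
  define G where "G n p = (if lasting D (\<delta> - a n) p then 1 else 0 :: real)" for n p
  have G_meas[measurable]: "G n \<in> borel_measurable (borel \<Otimes>\<^sub>M path_space)" for n
    unfolding G_def by measurable
  have G_bound: "\<bar>G n p\<bar> \<le> 1" for n p by (simp add: G_def)
  define \<psi> where "\<psi> n z = (\<integral>w. G n (z, w) \<partial>path_law)" for n z
  have \<psi>: "bounded_borel (\<psi> n) 1" for n
    unfolding \<psi>_def by (rule bounded_borel_path_integral[OF G_meas G_bound])
  define A where "A n x = {\<omega> \<in> space (P x). \<forall>s\<in>{a n..\<delta>}. W s \<omega> \<in> D}" for n x
  have A: "A n x \<in> sets (P x)" "measure (P x) (A n x) = heat (a n) (\<psi> n) x" for n x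
  proof -
    interpret brownian "P x" W x by (rule brownian)
    have an: "0 \<le> a n" using a[of n] by simp
    note [measurable] = measurable_future[OF an] measurable_W[OF an]
    have eq: "A n x = {\<omega> \<in> space (P x). lasting D (\<delta> - a n) (W (a n) \<omega>, future W (a n) \<omega>)}"
    proof -
      have last: "lasting D r (W (a n) \<omega>, future W (a n) \<omega>) \<longleftrightarrow> (\<forall>s\<in>{0..r}. W (a n + s) \<omega> \<in> D)"
        if "\<omega> \<in> space (P x)" for \<omega> r
        by (rule lasting_iff[of D W \<omega>, OF open_D continuous_W[OF that] an])
      have shift: "(\<forall>s\<in>{a n..\<delta>}. W s \<omega> \<in> D) \<longleftrightarrow> (\<forall>s\<in>{0..\<delta> - a n}. W (a n + s) \<omega> \<in> D)" for \<omega>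
      proof
        assume *: "\<forall>s\<in>{0..\<delta> - a n}. W (a n + s) \<omega> \<in> D"
        show "\<forall>s\<in>{a n..\<delta>}. W s \<omega> \<in> D"
        proof
          fix s assume "s \<in> {a n..\<delta>}"
          then have "s - a n \<in> {0..\<delta> - a n}" by simp
          then have "W (a n + (s - a n)) \<omega> \<in> D" using * by blast
          then show "W s \<omega> \<in> D" by simp
        qed
      qed simp
      show ?thesis
        unfolding A_def by (intro Collect_cong conj_cong refl) (simp only: last shift)
    qed
    show meas: "A n x \<in> sets (P x)" unfolding eq by measurable
    have "heat (a n) (\<psi> n) x = (\<integral>\<omega>. G n (W (a n) \<omega>, future W (a n) \<omega>) \<partial>P x)"
      unfolding \<psi>_def by (rule integral_markov[OF G_meas G_bound a(1), symmetric])
    also have "\<dots> = (\<integral>\<omega>. indicator (A n x) \<omega> \<partial>P x)"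
      by (rule Bochner_Integration.integral_cong) (auto simp: G_def eq)
    also have "\<dots> = measure (P x) (A n x)" using meas by simp
    finally show "measure (P x) (A n x) = heat (a n) (\<psi> n) x" ..
  qed
  interpret Y: brownian "P y" W y by (rule brownian)
  \<comment> \<open>As the waiting time shrinks, the events decrease to staying in \<open>D\<close>
    at all positive times up to \<open>\<delta>\<close>, which is a null event at the regular point
    \<open>y\<close>.\<close>
  have "(\<lambda>n. measure (P y) (A n y)) \<longlonglongrightarrow> measure (P y) (\<Inter>n. A n y)"
  proof (rule Y.finite_Lim_measure_decseq)
    show "range (\<lambda>n. A n y) \<subseteq> sets (P y)" using A(1) by auto
    show "decseq (\<lambda>n. A n y)"
      unfolding decseq_def A_def
    proof (intro allI impI)
      fix m n :: nat assume "m \<le> n"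
      then have "{a m..\<delta>} \<subseteq> {a n..\<delta>}" using a_dec[of m n] by simp
      then show "{\<omega> \<in> space (P y). \<forall>s\<in>{a n..\<delta>}. W s \<omega> \<in> D} \<subseteq> {\<omega> \<in> space (P y). \<forall>s\<in>{a m..\<delta>}. W s \<omega> \<in> D}"
        by blast
    qed
  qed
  moreover have "measure (P y) (\<Inter>n. A n y) = 0"
  proof -
    note [measurable] = Y.measurable_exit_time[OF open_D]
    have m: "{\<omega> \<in> space (P y). exit_time W D \<omega> = 0} \<in> sets (P y)" by measurable
    have "(\<Inter>n. A n y) \<subseteq> space (P y) - {\<omega> \<in> space (P y). exit_time W D \<omega> = 0}"
    proof
      fix \<omega> assume \<omega>: "\<omega> \<in> (\<Inter>n. A n y)"
      have "ennreal \<delta> \<le> exit_time W D \<omega>"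
      proof (subst le_exit_time_iff)
        show "\<forall>s. 0 < s \<longrightarrow> s < \<delta> \<longrightarrow> W s \<omega> \<in> D"
        proof (intro allI impI)
          fix s assume s: "0 < s" "s < \<delta>"
          have "\<forall>\<^sub>F n in sequentially. a n < s" using a0 s(1) by (rule order_tendstoD)
          then obtain n where "a n < s" by (auto simp: eventually_sequentially)
          then have "s \<in> {a n..\<delta>}" using s by simp
          moreover have "\<omega> \<in> A n y" using \<omega> by blast
          ultimately show "W s \<omega> \<in> D" unfolding A_def by blast
        qed
      qed (use \<delta> in simp)
      moreover have "ennreal 0 < ennreal \<delta>" using \<delta> by (simp only: ennreal_less_iff order_refl)
      ultimately have "exit_time W D \<omega> \<noteq> 0" by auto
      then show "\<omega> \<in> space (P y) - {\<omega> \<in> space (P y). exit_time W D \<omega> = 0}" using \<omega> by (auto simp: A_def)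
    qed
    then have "measure (P y) (\<Inter>n. A n y) \<le> measure (P y) (space (P y) - {\<omega> \<in> space (P y). exit_time W D \<omega> = 0})"
      using m by (intro Y.finite_measure_mono) auto
    also have "\<dots> = 0" using Y.prob_compl[OF m] y by simp
    finally show ?thesis by (simp add: measure_le_0_iff)
  qed
  ultimately have "(\<lambda>n. measure (P y) (A n y)) \<longlonglongrightarrow> 0" by simp
  then have "\<forall>\<^sub>F n in sequentially. measure (P y) (A n y) < \<eta> / 2" using \<eta> by (intro order_tendstoD) auto
  then obtain n where n: "measure (P y) (A n y) < \<eta> / 2" by (auto simp: eventually_sequentially)
  \<comment> \<open>Now \<open>n\<close> is fixed, so the probability is a continuous function of
    the starting point and its smallness at \<open>y\<close> spreads to a neighbourhood.\<close>
  have "continuous_on UNIV (heat (a n) (\<psi> n))" by (rule bounded_borel.heat_continuous[OF \<psi> a(1)])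
  then obtain d where d: "d > 0" "\<And>x. dist x y < d \<Longrightarrow> dist (heat (a n) (\<psi> n) x) (heat (a n) (\<psi> n) y) < \<eta> / 2"
    unfolding continuous_on_iff using \<eta> by (metis UNIV_I half_gt_zero)
  show ?thesis
  proof (intro exI[of _ d] conjI ballI impI d(1))
    fix x assume x: "x \<in> D" "dist x y < d"
    interpret X: brownian "P x" W x by (rule brownian)
    have "measure (P x) {\<omega> \<in> space (P x). ennreal \<delta> < exit_time W D \<omega>} \<le> measure (P x) (A n x)"
    proof (rule X.finite_measure_mono_AE[OF _ A(1)])
      show "AE \<omega> in P x. \<omega> \<in> {\<omega> \<in> space (P x). ennreal \<delta> < exit_time W D \<omega>} \<longrightarrow> \<omega> \<in> A n x"
        using X.W_0 AE_space
      proof eventually_elim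
        case (elim \<omega>)
        have "\<forall>s\<in>{0..\<delta>}. W s \<omega> \<in> D" if "ennreal \<delta> < exit_time W D \<omega>"
          using less_exit_time_iff[of D W \<omega> \<delta>, OF open_D X.continuous_W[OF elim(2)]] elim x(1) \<delta> that by simp
        then show ?case using elim a[of n] by (auto simp: A_def)
      qed
    qed
    also have "\<dots> < \<eta>" using d(2)[OF x(2)] n unfolding A(2) dist_real_def by linarith
    finally show "measure (P x) {\<omega> \<in> space (P x). ennreal \<delta> < exit_time W D \<omega>} < \<eta>" .
  qed
qed

text \<open>Off two unlikely events, moving by \<open>\<rho>\<close> before time
  \<open>\<delta>\<close> (\<open>A\<close>) and surviving beyond \<open>\<delta>\<close>
  (\<open>L\<close>), the path exits by time \<open>\<delta>\<close> within
  \<open>2 * \<rho>\<close> of \<open>y\<close>. The error is split into four parts of size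
  \<open>e / 4\<close>: the oscillation of \<open>g\<close>, the discount factor, and the two
  events.\<close>

lemma boundary_limit:
  assumes y: "\<P>(\<omega> in P y. exit_time W D \<omega> = 0) = 1" and e: "0 < e"
  shows "\<exists>d>0. \<forall>x\<in>D. dist x y < d \<longrightarrow> \<bar>u x - g y\<bar> < e"
proof -
  have e4: "e / 4 > 0" using e by simp
  obtain \<rho>' where \<rho>': "\<rho>' > 0" "\<And>z. dist z y < \<rho>' \<Longrightarrow> dist (g z) (g y) < e / 4"
    using continuous_g[unfolded continuous_on_iff] e4 by (metis UNIV_I)
  define \<rho> where "\<rho> = \<rho>' / 2"
  have \<rho>: "\<rho> > 0" using \<rho>' by (simp add: \<rho>_def)
  \<comment> \<open>\<open>K\<close> depends on \<open>\<rho>\<close>, so \<open>\<delta>\<close> is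
    chosen after \<open>\<rho>\<close>, and the radius \<open>d\<close> after
    \<open>\<delta>\<close>.\<close>
  define K where "K = 512 * moment TYPE('a) 4 / \<rho> ^ 4"
  have "((\<lambda>\<delta>. B * (1 - exp (- c * \<delta>))) \<longlongrightarrow> B * (1 - exp (- c * 0))) (at_right 0)" by (intro tendsto_intros)
  then have 1: "\<forall>\<^sub>F \<delta> in at_right 0. B * (1 - exp (- c * \<delta>)) < e / 4" by (rule order_tendstoD) (use e in simp)
  have "((\<lambda>\<delta>. 2 * B * (K * \<delta>\<^sup>2)) \<longlongrightarrow> 2 * B * (K * 0\<^sup>2)) (at_right 0)" by (intro tendsto_intros)
  then have 2: "\<forall>\<^sub>F \<delta> in at_right 0. 2 * B * (K * \<delta>\<^sup>2) < e / 4" by (rule order_tendstoD) (use e in simp)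
  have "\<forall>\<^sub>F \<delta>::real in at_right 0. 0 < \<delta> \<and> B * (1 - exp (- c * \<delta>)) < e / 4 \<and> 2 * B * (K * \<delta>\<^sup>2) < e / 4"
    using 1 2 eventually_at_right_less[of "0::real"] by eventually_elim simp
  then obtain \<delta> where \<delta>: "0 < \<delta>" "B * (1 - exp (- c * \<delta>)) < e / 4" "2 * B * (K * \<delta>\<^sup>2) < e / 4"
    using eventually_happens'[OF trivial_limit_at_right_real] by blast
  \<comment> \<open>Makes \<open>2 * B * \<eta>\<close> at most \<open>e / 4\<close>; the summand 8
    keeps the denominator positive if \<open>B = 0\<close>.\<close>
  define \<eta> where "\<eta> = e / (8 * B + 8)"
  have \<eta>: "\<eta> > 0" "2 * B * \<eta> \<le> e / 4" using e B_nonneg by (auto simp: \<eta>_def field_simps)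
  obtain d where d: "d > 0" "\<And>x. x \<in> D \<Longrightarrow> dist x y < d \<Longrightarrow> \<P>(\<omega> in P x. ennreal \<delta> < exit_time W D \<omega>) < \<eta>"
    using exit_time_upper_semicontinuous[OF y \<delta>(1) \<eta>(1)] by blast
  show ?thesis
  proof (intro exI[of _ "min d \<rho>"] conjI ballI impI)
    show "min d \<rho> > 0" using d \<rho> by simp
    fix x assume x: "x \<in> D" "dist x y < min d \<rho>"
    interpret brownian "P x" W x by (rule brownian)
    note [measurable] = payoff_measurable[OF open_D] measurable_exit_time[OF open_D]
    have \<delta>0: "0 \<le> \<delta>" using \<delta> by simp
    obtain A where A[measurable]: "A \<in> sets (P x)" and PA: "prob A \<le> 512 * moment TYPE('a) 4 / \<rho> ^ 4 * \<delta>\<^sup>2"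
      and close: "\<And>\<omega> s. \<omega> \<in> space (P x) - A \<Longrightarrow> 0 \<le> s \<Longrightarrow> s \<le> \<delta> \<Longrightarrow> norm (W s \<omega> - W 0 \<omega>) < \<rho>"
      using maximal_inequality[OF \<delta>0 \<rho>] by metis
    define L where "L = {\<omega> \<in> space (P x). ennreal \<delta> < exit_time W D \<omega>}"
    have [measurable]: "L \<in> sets (P x)" unfolding L_def by measurable
    have PL: "prob L < \<eta>" unfolding L_def using d(2)[OF x(1)] x(2) by simp
    have i1: "integrable (P x) (payoff W c D g)"
      by (rule integrable_const_bound[where B=B]) (use payoff_le in auto)
    have ind: "integrable (P x) (\<lambda>\<omega>. 2 * B * indicator S \<omega>)" if "S \<in> sets (P x)" for S
      using that by (intro integrable_mult_right integrable_real_indicator) (auto simp: emeasure_eq_measure)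
    have "u x - g y = (\<integral>\<omega>. payoff W c D g \<omega> - g y \<partial>P x)"
      unfolding u_def using i1 prob_space by simp
    then have "\<bar>u x - g y\<bar> \<le> (\<integral>\<omega>. \<bar>payoff W c D g \<omega> - g y\<bar> \<partial>P x)" by (simp only: integral_abs_bound)
    also have "\<dots> \<le> (\<integral>\<omega>. e / 2 + 2 * B * indicator A \<omega> + 2 * B * indicator L \<omega> \<partial>P x)"
    proof (rule integral_mono_AE)
      show "integrable (P x) (\<lambda>\<omega>. \<bar>payoff W c D g \<omega> - g y\<bar>)" using i1 by simp
      show "integrable (P x) (\<lambda>\<omega>. e / 2 + 2 * B * indicator A \<omega> + 2 * B * indicator L \<omega>)"
        by (intro Bochner_Integration.integrable_add ind) simp_all
      show "AE \<omega> in P x. \<bar>payoff W c D g \<omega> - g y\<bar> \<le> e / 2 + 2 * B * indicator A \<omega> + 2 * B * indicator L \<omega>"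
        using W_0 AE_space
      proof eventually_elim
        case (elim \<omega>)
        show ?case
        proof (cases "\<omega> \<in> A \<or> \<omega> \<in> L")
          case True
          have "\<bar>payoff W c D g \<omega> - g y\<bar> \<le> 2 * B" using payoff_le[of \<omega>] g_bound[of y] by linarith
          then show ?thesis using True e B_nonneg by (auto simp: indicator_def)
        next
          case False
          have W: "continuous_on {0..} (\<lambda>s. W s \<omega>)" and D0: "W 0 \<omega> \<in> D" using continuous_W elim x by auto
          define T where "T = enn2real (exit_time W D \<omega>)"
          have le: "exit_time W D \<omega> \<le> ennreal \<delta>" using False elim by (auto simp: L_def)
          then have fin: "exit_time W D \<omega> < \<infinity>" by (simp add: le_less_trans)
          note E = exit_time_finite[of D W \<omega>, OF open_D W D0 fin, folded T_def]
          have T: "0 \<le> T" "T \<le> \<delta>" using le E(1) \<delta>0 unfolding E(5) by (simp_all add: ennreal_le_iff)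
          have "norm (W T \<omega> - x) < \<rho>" using close[of \<omega> T] False elim T by simp
          then have "dist (W T \<omega>) y < \<rho> + \<rho>"
            using x(2) dist_triangle[of "W T \<omega>" y x] by (simp add: dist_norm)
          then have gg: "\<bar>g (W T \<omega>) - g y\<bar> < e / 4" using \<rho>'(2)[of "W T \<omega>"] by (simp add: \<rho>_def dist_real_def)
          have ex: "0 \<le> 1 - exp (- c * T)" "1 - exp (- c * T) \<le> 1 - exp (- c * \<delta>)"
            using c T by (auto simp: mult_left_mono)
          have "\<bar>(1 - exp (- c * T)) * g (W T \<omega>)\<bar> \<le> (1 - exp (- c * \<delta>)) * B"
            unfolding abs_mult using ex g_bound by (intro mult_mono) auto
          then have *: "\<bar>(1 - exp (- c * T)) * g (W T \<omega>)\<bar> < e / 4" using \<delta>(2) by (simp add: mult.commute)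
          have "payoff W c D g \<omega> - g y = (g (W T \<omega>) - g y) - (1 - exp (- c * T)) * g (W T \<omega>)"
            unfolding payoff_exit[of D W \<omega>, OF open_D W D0 fin] T_def[symmetric] by (simp add: algebra_simps)
          then have "\<bar>payoff W c D g \<omega> - g y\<bar> < e / 2" using gg * by linarith
          then show ?thesis using False by simp
        qed
      qed
    qed
    also have "\<dots> = e / 2 + 2 * B * prob A + 2 * B * prob L"
      using prob_space ind by simp
    also have "\<dots> < e"
    proof -
      have "2 * B * prob A \<le> 2 * B * (K * \<delta>\<^sup>2)" unfolding K_def using B_nonneg PA by (intro mult_left_mono) auto
      moreover have "2 * B * prob L \<le> 2 * B * \<eta>" using B_nonneg PL by (intro mult_left_mono) auto
      ultimately show ?thesis using \<delta>(3) \<eta>(2) by linarith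
    qed
    finally show "\<bar>u x - g y\<bar> < e" .
  qed
qed

lemma u_frontier:
  assumes y: "y \<in> frontier D" "\<P>(\<omega> in P y. exit_time W D \<omega> = 0) = 1"
  shows "u y = g y"
proof -
  interpret brownian "P y" W y by (rule brownian)
  note [measurable] = payoff_measurable[OF open_D] measurable_exit_time[OF open_D]
  have "AE \<omega> in P y. exit_time W D \<omega> = 0" using y(2) by (subst (asm) prob_Collect_eq_1) auto
  then have "u y = (\<integral>\<omega>. g y \<partial>P y)"
    unfolding u_def
  proof (intro integral_cong_AE)
    assume "AE \<omega> in P y. exit_time W D \<omega> = 0"
    then show "AE \<omega> in P y. payoff W c D g \<omega> = g y"
      using W_0 by eventually_elim (simp add: payoff_def exit_point_def y(1))
  qed measurable
  then show ?thesis using prob_space by simp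
qed

text \<open>Near a frontier point two kinds of points of the closure occur: those in
  \<open>D\<close> are covered by \<open>boundary_limit\<close>, those on the frontier by continuity
  of \<open>g\<close>, with which \<open>u\<close> agrees there.\<close>

lemma continuous_on_u:
  assumes \<mu>: "2 * c = \<mu>\<^sup>2" and reg: "\<And>y. y \<in> frontier D \<Longrightarrow> \<P>(\<omega> in P y. exit_time W D \<omega> = 0) = 1"
  shows "continuous_on (closure D) u"
  unfolding continuous_on_iff
proof (intro ballI allI impI)
  fix y and e :: real assume y: "y \<in> closure D" and e: "0 < e"
  show "\<exists>d>0. \<forall>x\<in>closure D. dist x y < d \<longrightarrow> dist (u x) (u y) < e"
  proof (cases "y \<in> D")
    case True
    have "continuous_on D u" using panharmonic_u[OF \<mu>] by (simp add: panharmonic_on_def C2_on_def C1_on_def)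
    then obtain d where d: "d > 0" "\<And>x. x \<in> D \<Longrightarrow> dist x y < d \<Longrightarrow> dist (u x) (u y) < e"
      unfolding continuous_on_iff using True e by metis
    obtain r where r: "r > 0" "ball y r \<subseteq> D" using open_D True unfolding open_contains_ball by blast
    have "x \<in> D" if "dist x y < r" for x using r(2) that by (auto simp: subset_iff dist_commute)
    then show ?thesis using d r by (intro exI[of _ "min d r"]) auto
  next
    case False
    then have fr: "y \<in> frontier D" using y open_D by (simp add: frontier_def interior_open)
    obtain d where d: "d > 0" "\<And>x. x \<in> D \<Longrightarrow> dist x y < d \<Longrightarrow> \<bar>u x - g y\<bar> < e"
      using boundary_limit[OF reg[OF fr] e] by blast
    obtain d' where d': "d' > 0" "\<And>x. dist x y < d' \<Longrightarrow> dist (g x) (g y) < e"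
      using continuous_g[unfolded continuous_on_iff] e by (metis UNIV_I)
    show ?thesis
    proof (intro exI[of _ "min d d'"] conjI ballI impI)
      fix x assume x: "x \<in> closure D" "dist x y < min d d'"
      show "dist (u x) (u y) < e"
      proof (cases "x \<in> D")
        case True
        then show ?thesis using d(2) x(2) u_frontier[OF fr reg[OF fr]] by (simp add: dist_real_def)
      next
        case False
        then have "x \<in> frontier D" using x open_D by (simp add: frontier_def interior_open)
        then show ?thesis using d'(2)[of x] x(2) u_frontier reg fr by simp
      qed
    qed (use d d' in simp)
  qed
qed

end

lemma extend_from_frontier:
  fixes f :: "'a::euclidean_space \<Rightarrow> real"
  assumes f: "continuous_on (frontier D) f" "\<And>z. z \<in> frontier D \<Longrightarrow> \<bar>f z\<bar> \<le> B" and B: "0 \<le> B"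
  obtains g where "continuous_on UNIV g" "\<And>z. z \<in> frontier D \<Longrightarrow> g z = f z" "\<And>z. \<bar>g z\<bar> \<le> B"
proof -
  have "closedin (top_of_set UNIV) (frontier D)" by (simp add: frontier_closed)
  then show thesis using Tietze[OF f(1) _ B] f(2) that by (metis UNIV_I real_norm_def)
qed

text \<open>The payoff sees \<open>f\<close> on the frontier only, so a Tietze extension with the
  same bound may take its place.\<close>

lemma yukawa_solution:
  fixes P :: "'a::euclidean_space \<Rightarrow> 'w measure"
  assumes fam: "brownian_family P W" and reg: "regular_domain P W D"
    and f: "continuous_on (frontier D) f" "\<And>z. z \<in> frontier D \<Longrightarrow> \<bar>f z\<bar> \<le> B" and B: "0 \<le> B"
  shows "yukawa_dirichlet_solution \<mu> D f (yukawa_expectation P W \<mu> D f)"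
    and "\<bar>yukawa_expectation P W \<mu> D f x\<bar> \<le> B"
proof -
  obtain g where g: "continuous_on UNIV g" "\<And>z. z \<in> frontier D \<Longrightarrow> g z = f z" "\<And>z. \<bar>g z\<bar> \<le> B"
    using extend_from_frontier[OF f B] by metis
  have D: "open D" using reg by (simp add: regular_domain_def domain_def)
  interpret brownian_payoff P W D "\<mu>\<^sup>2 / 2" B g
    by unfold_locales (use fam D g in auto)
  have eq: "yukawa_expectation P W \<mu> D f = u"
    unfolding yukawa_expectation_eq u_def using payoff_cong[of D f g] g(2) by metis
  have r: "\<P>(\<omega> in P y. exit_time W D \<omega> = 0) = 1" if "y \<in> frontier D" for y
    using reg that by (simp add: regular_domain_def)
  have \<mu>: "2 * (\<mu>\<^sup>2 / 2) = \<mu>\<^sup>2" by simp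
  show "yukawa_dirichlet_solution \<mu> D f (yukawa_expectation P W \<mu> D f)"
    unfolding eq yukawa_dirichlet_solution_def
    using continuous_on_u[OF \<mu> r] panharmonic_u[OF \<mu>] u_frontier[OF _ r] g(2) by auto
  show "\<bar>yukawa_expectation P W \<mu> D f x\<bar> \<le> B" unfolding eq by (rule u_bound)
qed

section \<open>The maximum principle and uniqueness\<close>

lemma C2_onD:
  assumes "C2_on S f"
  shows "continuous_on S f"
    and "x \<in> S \<Longrightarrow> b \<in> Basis \<Longrightarrow> ((\<lambda>s. f (x + s *\<^sub>R b)) has_real_derivative partial_deriv b f x) (at 0)"
    and "b \<in> Basis \<Longrightarrow> continuous_on S (partial_deriv b f)"
    and "x \<in> S \<Longrightarrow> b \<in> Basis \<Longrightarrow> b' \<in> Basis \<Longrightarrow>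
      ((\<lambda>s. partial_deriv b f (x + s *\<^sub>R b')) has_real_derivative partial_deriv b' (partial_deriv b f) x) (at 0)"
    and "b \<in> Basis \<Longrightarrow> b' \<in> Basis \<Longrightarrow> continuous_on S (partial_deriv b' (partial_deriv b f))"
  using assms unfolding C2_on_def C1_on_def partial_deriv_def
  by (auto simp: DERIV_deriv_iff_real_differentiable)

lemma
  assumes S: "open S" and f: "C2_on S f" and g: "C2_on S g"
  shows C2_on_linear: "C2_on S (\<lambda>x. p * f x + q * g x + r)"
    and laplacian_linear: "x \<in> S \<Longrightarrow> laplacian (\<lambda>x. p * f x + q * g x + r) x = p * laplacian f x + q * laplacian g x"
proof -
  let ?h = "\<lambda>x. p * f x + q * g x + r"
  let ?d1 = "\<lambda>b x. p * partial_deriv b f x + q * partial_deriv b g x"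
  let ?d2 = "\<lambda>b b' x. p * partial_deriv b' (partial_deriv b f) x + q * partial_deriv b' (partial_deriv b g) x"
  have c0: "continuous_on S ?h"
    by (intro continuous_intros C2_onD[OF f] C2_onD[OF g])
  have d1: "((\<lambda>s. ?h (x + s *\<^sub>R b)) has_real_derivative ?d1 b x) (at 0)" if "x \<in> S" "b \<in> Basis" for x b
    using C2_onD(2)[OF f that] C2_onD(2)[OF g that] by (auto intro!: derivative_eq_intros)
  have c1: "continuous_on S (?d1 b)" if "b \<in> Basis" for b
    by (intro continuous_intros C2_onD(3)[OF f that] C2_onD(3)[OF g that])
  have d2: "((\<lambda>s. ?d1 b (x + s *\<^sub>R b')) has_real_derivative ?d2 b b' x) (at 0)" if "x \<in> S" "b \<in> Basis" "b' \<in> Basis" for x b b'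
    using C2_onD(4)[OF f that] C2_onD(4)[OF g that] by (auto intro!: derivative_eq_intros)
  have c2: "continuous_on S (?d2 b b')" if "b \<in> Basis" "b' \<in> Basis" for b b'
    by (intro continuous_intros C2_onD(5)[OF f that] C2_onD(5)[OF g that])
  show "C2_on S ?h"
    by (rule C2_on_intro(1)[OF S c0, where ?d1.0="?d1" and ?d2.0="?d2"]) (fact d1 c1 d2 c2)+
  assume x: "x \<in> S"
  have "laplacian ?h x = (\<Sum>b\<in>Basis. ?d2 b b x)"
    by (rule C2_on_intro(2)[OF S c0, where ?d1.0="?d1" and ?d2.0="?d2"]) (fact d1 c1 d2 c2 x)+
  then show "laplacian ?h x = p * laplacian f x + q * laplacian g x"
    by (simp add: laplacian_def sum.distrib sum_distrib_left)
qed

text \<open>If \<open>d\<close> were positive, the first derivative, which vanishes at the maximum,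
  would be positive just to the right of 0, and the function would increase there.\<close>

lemma second_deriv_nonpos_at_max:
  fixes \<phi> \<phi>' :: "real \<Rightarrow> real"
  assumes e: "0 < e" and d1: "\<And>s. \<bar>s\<bar> < e \<Longrightarrow> (\<phi> has_real_derivative \<phi>' s) (at s)"
    and d2: "(\<phi>' has_real_derivative d) (at 0)" and max: "\<And>s. \<bar>s\<bar> < e \<Longrightarrow> \<phi> s \<le> \<phi> 0"
  shows "d \<le> 0"
proof (rule ccontr)
  assume "\<not> d \<le> 0"
  then have d: "d > 0" by simp
  have "\<phi>' 0 = 0"
    by (rule DERIV_local_max[OF d1[of 0] e]) (use e max in auto)
  moreover obtain \<delta> where \<delta>: "\<delta> > 0" "\<And>h. 0 < h \<Longrightarrow> h < \<delta> \<Longrightarrow> \<phi>' 0 < \<phi>' (0 + h)"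
    using DERIV_pos_inc_right[OF d2 d] by blast
  ultimately have pos: "0 < \<phi>' h" if "0 < h" "h < \<delta>" for h using that by simp
  define h where "h = min \<delta> e / 2"
  have h: "0 < h" "h < \<delta>" "h < e" using \<delta>(1) e by (auto simp: h_def min_def)
  have "\<exists>\<xi>. 0 < \<xi> \<and> \<xi> < h \<and> \<phi> h - \<phi> 0 = (h - 0) * \<phi>' \<xi>"
    by (rule MVT2[OF h(1)]) (use d1 h in auto)
  then obtain \<xi> where "0 < \<xi>" "\<xi> < h" "\<phi> h - \<phi> 0 = h * \<phi>' \<xi>" by auto
  then have "\<phi> 0 < \<phi> h" using pos[of \<xi>] h by (simp add: zero_less_mult_iff algebra_simps)
  then show False using max[of h] h by simp
qed

lemma laplacian_nonpos_at_max:
  fixes w :: "'a::euclidean_space \<Rightarrow> real"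
  assumes S: "open S" and w: "C2_on S w" and x: "x \<in> S" and max: "\<And>y. y \<in> S \<Longrightarrow> w y \<le> w x"
  shows "laplacian w x \<le> 0"
  unfolding laplacian_def
proof (rule sum_nonpos)
  fix b :: 'a assume b: "b \<in> Basis"
  obtain e where e: "e > 0" "ball x e \<subseteq> S" using S x unfolding open_contains_ball by blast
  have in_S: "x + s *\<^sub>R b \<in> S" if "\<bar>s\<bar> < e" for s
    using e(2) b that by (auto simp: subset_iff dist_norm)
  show "partial_deriv b (partial_deriv b w) x \<le> 0"
  proof (rule second_deriv_nonpos_at_max[OF e(1)])
    show "((\<lambda>s. w (x + s *\<^sub>R b)) has_real_derivative partial_deriv b w (x + s *\<^sub>R b)) (at s)" if "\<bar>s\<bar> < e" for s
    proof -
      have "((\<lambda>r. w (x + s *\<^sub>R b + (r - s) *\<^sub>R b)) has_real_derivative partial_deriv b w (x + s *\<^sub>R b)) (at s)"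
        using C2_onD(2)[OF w in_S[OF that] b]
          DERIV_shift[of "\<lambda>r. w (x + s *\<^sub>R b + (r - s) *\<^sub>R b)" "partial_deriv b w (x + s *\<^sub>R b)" 0 s] by simp
      moreover have "x + s *\<^sub>R b + (r - s) *\<^sub>R b = x + r *\<^sub>R b" for r by (simp add: algebra_simps)
      ultimately show ?thesis by (simp only:)
    qed
    show "((\<lambda>s. partial_deriv b w (x + s *\<^sub>R b)) has_real_derivative partial_deriv b (partial_deriv b w) x) (at 0)"
      by (rule C2_onD(4)[OF w x b b])
    show "w (x + s *\<^sub>R b) \<le> w (x + 0 *\<^sub>R b)" if "\<bar>s\<bar> < e" for s
      using max[OF in_S[OF that]] by simp
  qed
qed

definition cosh_sum :: "real \<Rightarrow> 'a::euclidean_space \<Rightarrow> real" where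
  "cosh_sum l x = (\<Sum>b\<in>Basis. cosh (l * (x \<bullet> b)))"

lemma
  shows C2_on_cosh_sum: "C2_on UNIV (cosh_sum l :: 'a::euclidean_space \<Rightarrow> real)"
    and laplacian_cosh_sum: "laplacian (cosh_sum l) (x::'a) = l\<^sup>2 * cosh_sum l x"
proof -
  let ?d1 = "\<lambda>b x::'a. l * sinh (l * (x \<bullet> b))"
  let ?d2 = "\<lambda>b b' x::'a. if b = b' then l\<^sup>2 * cosh (l * (x \<bullet> b)) else 0"
  have c0: "continuous_on UNIV (cosh_sum l :: 'a \<Rightarrow> real)"
    unfolding cosh_sum_def by (intro continuous_intros)
  have d1: "((\<lambda>s. cosh_sum l (x + s *\<^sub>R b)) has_real_derivative ?d1 b x) (at 0)" if b: "b \<in> Basis" for x b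
  proof -
    have "((\<lambda>s. cosh_sum l (x + s *\<^sub>R b)) has_real_derivative (\<Sum>b'\<in>Basis. sinh (l * (x \<bullet> b')) * (l * (b \<bullet> b')))) (at 0)"
      unfolding cosh_sum_def by (auto intro!: derivative_eq_intros simp: inner_add_left ac_simps)
    also have "(\<Sum>b'\<in>Basis. sinh (l * (x \<bullet> b')) * (l * (b \<bullet> b'))) = (\<Sum>b'\<in>Basis. if b = b' then l * sinh (l * (x \<bullet> b')) else 0)"
      using b by (intro sum.cong refl) (auto simp: inner_Basis)
    also have "\<dots> = ?d1 b x" using b by simp
    finally show ?thesis .
  qed
  have c1: "continuous_on UNIV (?d1 b)" for b by (intro continuous_intros)
  have d2: "((\<lambda>s. ?d1 b (x + s *\<^sub>R b')) has_real_derivative ?d2 b b' x) (at 0)" if b: "b \<in> Basis" "b' \<in> Basis" for x b b'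
  proof -
    have "((\<lambda>s. ?d1 b (x + s *\<^sub>R b')) has_real_derivative l * (cosh (l * (x \<bullet> b)) * (l * (b' \<bullet> b)))) (at 0)"
      by (auto intro!: derivative_eq_intros simp: inner_add_left)
    also have "l * (cosh (l * (x \<bullet> b)) * (l * (b' \<bullet> b))) = ?d2 b b' x"
      using b by (auto simp: inner_Basis power2_eq_square)
    finally show ?thesis .
  qed
  have c2: "continuous_on UNIV (?d2 b b')" for b b' by (cases "b = b'") (auto intro!: continuous_intros)
  show "C2_on UNIV (cosh_sum l :: 'a \<Rightarrow> real)"
    by (rule C2_on_intro(1)[OF open_UNIV c0, where ?d1.0="?d1" and ?d2.0="?d2"]) (rule d1 c1 d2 c2; assumption)+
  have "laplacian (cosh_sum l) x = (\<Sum>b\<in>Basis. ?d2 b b x)"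
    by (rule C2_on_intro(2)[OF open_UNIV c0, where ?d1.0="?d1" and ?d2.0="?d2"]) (rule d1 c1 d2 c2 UNIV_I; assumption)+
  then show "laplacian (cosh_sum l) x = l\<^sup>2 * cosh_sum l x"
    by (simp add: cosh_sum_def sum_distrib_left)
qed

lemma C2_on_subset: "C2_on S f \<Longrightarrow> T \<subseteq> S \<Longrightarrow> C2_on T f"
  unfolding C2_on_def C1_on_def by (meson continuous_on_subset subset_iff)

text \<open>Yields both properties required of the barrier: positivity, and growth in each
  coordinate, which makes its sublevel sets bounded.\<close>

lemma cosh_sum_ge:
  assumes l: "0 < l" and b: "b \<in> Basis"
  shows "1 + l * \<bar>x \<bullet> b\<bar> \<le> 2 * cosh_sum l (x :: 'a::euclidean_space)"
proof -
  have "1 + l * \<bar>x \<bullet> b\<bar> \<le> exp (l * \<bar>x \<bullet> b\<bar>)" by (rule exp_ge_add_one_self)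
  also have "\<dots> \<le> 2 * cosh (l * (x \<bullet> b))"
    by (cases "x \<bullet> b \<ge> 0") (simp_all add: cosh_def)
  also have "cosh (l * (x \<bullet> b)) \<le> cosh_sum l x"
    unfolding cosh_sum_def by (rule member_le_sum) (use b cosh_real_nonneg in auto)
  finally show ?thesis by simp
qed

text \<open>A small multiple of \<^term>\<open>cosh_sum l\<close>, which is itself a solution, forces the maximum to be attained.\<close>

lemma maximum_principle:
  fixes z :: "'a::euclidean_space \<Rightarrow> real"
  assumes D: "open D" and l: "0 < l" and cont: "continuous_on (closure D) z" and C2: "C2_on D z"
    and sub: "\<And>x. x \<in> D \<Longrightarrow> l\<^sup>2 * z x \<le> laplacian z x"
    and bdry: "\<And>x. x \<in> frontier D \<Longrightarrow> z x \<le> 0" and bound: "\<And>x. x \<in> closure D \<Longrightarrow> z x \<le> C"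
    and x0: "x0 \<in> closure D"
  shows "z x0 \<le> 0"
proof (rule ccontr)
  assume "\<not> z x0 \<le> 0"
  then have z0: "0 < z x0" by simp
  obtain b0 :: 'a where b0: "b0 \<in> Basis" using nonempty_Basis by blast
  have ps_pos: "0 < cosh_sum l x" for x :: 'a
  proof -
    have "0 \<le> l * \<bar>x \<bullet> b0\<bar>" using l by simp
    then show ?thesis using cosh_sum_ge[OF l b0, of x] by linarith
  qed
  \<comment> \<open>Chosen such that \<open>w x0 = z x0 / 2\<close>, which is still
    positive.\<close>
  define \<epsilon> where "\<epsilon> = z x0 / (2 * cosh_sum l x0)"
  have \<epsilon>: "0 < \<epsilon>" using z0 ps_pos by (simp add: \<epsilon>_def)
  define w where "w x = 1 * z x + (- \<epsilon>) * cosh_sum l x + 0" for x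
  have w0: "0 < w x0" using z0 ps_pos[of x0] by (simp add: w_def \<epsilon>_def)
  define K where "K = {x \<in> closure D. w x0 \<le> w x}"
  have contw: "continuous_on (closure D) w"
    unfolding w_def using cont C2_onD(1)[OF C2_on_cosh_sum[of l]]
    by (intro continuous_intros) (auto intro: continuous_on_subset)
  have "closed K"
    unfolding K_def by (intro continuous_closed_preimage_constant continuous_on_closed_Collect_le continuous_on_const contw closed_closure)
  moreover have "bounded K"
  proof (rule boundedI)
    fix x assume x: "x \<in> K"
    then have "\<epsilon> * cosh_sum l x \<le> C" using bound[of x] w0 by (simp add: K_def w_def)
    then have ps: "cosh_sum l x \<le> C / \<epsilon>" using \<epsilon> by (simp add: field_simps)
    have "\<bar>x \<bullet> b\<bar> \<le> 2 * (C / \<epsilon>) / l" if "b \<in> Basis" for b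
    proof -
      have "l * \<bar>x \<bullet> b\<bar> \<le> 2 * (C / \<epsilon>)" using cosh_sum_ge[OF l that, of x] ps by linarith
      from divide_right_mono[OF this, of l] show ?thesis using l by simp
    qed
    then have "(\<Sum>b\<in>Basis. \<bar>x \<bullet> b\<bar>) \<le> (\<Sum>b\<in>(Basis::'a set). 2 * (C / \<epsilon>) / l)" by (rule sum_mono)
    then show "norm x \<le> (\<Sum>b\<in>(Basis::'a set). 2 * (C / \<epsilon>) / l)" using norm_le_l1[of x] by linarith
  qed
  ultimately have "compact K" by (simp add: compact_eq_bounded_closed)
  moreover have "K \<noteq> {}" using x0 by (auto simp: K_def)
  moreover have "continuous_on K w" by (rule continuous_on_subset[OF contw]) (auto simp: K_def)
  ultimately obtain x1 where x1: "x1 \<in> K" "\<And>y. y \<in> K \<Longrightarrow> w y \<le> w x1"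
    using continuous_attains_sup by metis
  have w1: "0 < w x1" using x1(1) w0 by (simp add: K_def)
  have "x1 \<notin> frontier D"
  proof
    assume "x1 \<in> frontier D"
    moreover have "0 \<le> \<epsilon> * cosh_sum l x1" using \<epsilon> ps_pos[of x1] by simp
    ultimately show False using bdry[of x1] w1 by (simp add: w_def)
  qed
  then have x1D: "x1 \<in> D" using x1(1) D by (simp add: K_def frontier_def interior_open)
  have C2p: "C2_on D (cosh_sum l)" by (rule C2_on_subset[OF C2_on_cosh_sum]) simp
  \<comment> \<open>At the interior maximum the Laplacian of \<open>w\<close> is nonpositive, yet it
    is at least \<open>l\<^sup>2 * w x1\<close>, which is positive.\<close>
  have "laplacian w x1 \<le> 0"
  proof (rule laplacian_nonpos_at_max[OF D _ x1D])
    show "C2_on D w" unfolding w_def by (rule C2_on_linear[OF D C2 C2p])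
    show "w y \<le> w x1" if "y \<in> D" for y
      using x1 that closure_subset[of D] by (cases "y \<in> K") (auto simp: K_def)
  qed
  moreover have "laplacian w x1 = 1 * laplacian z x1 + (- \<epsilon>) * laplacian (cosh_sum l) x1"
    unfolding w_def by (rule laplacian_linear[OF D C2 C2p x1D])
  moreover have "l\<^sup>2 * w x1 \<le> 1 * laplacian z x1 + (- \<epsilon>) * laplacian (cosh_sum l) x1"
    using sub[OF x1D] by (simp add: laplacian_cosh_sum w_def algebra_simps)
  moreover have "0 < l\<^sup>2 * w x1" using l w1 by simp
  ultimately show False by linarith
qed

section \<open>Comparison of solutions and uniqueness\<close>

lemma bounded_image_real: "bounded (f ` S) \<longleftrightarrow> (\<exists>M\<ge>0. \<forall>x\<in>S. \<bar>f x\<bar> \<le> (M::real))"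
proof
  assume "bounded (f ` S)"
  then obtain M where "\<forall>x\<in>S. \<bar>f x\<bar> \<le> M" unfolding bounded_iff by auto
  then have "\<forall>x\<in>S. \<bar>f x\<bar> \<le> max M 0" by auto
  then show "\<exists>M\<ge>0. \<forall>x\<in>S. \<bar>f x\<bar> \<le> M" by (intro exI[of _ "max M 0"]) auto
qed (auto simp: bounded_iff)

lemma yukawa_dirichlet_le:
  fixes D :: "'a::euclidean_space set"
  assumes D: "open D" and \<mu>: "0 < \<mu>"
    and v: "yukawa_dirichlet_solution \<mu> D f v" "bounded (v ` closure D)"
    and w: "yukawa_dirichlet_solution \<mu> D f w" "bounded (w ` closure D)" and x: "x \<in> closure D"
  shows "v x \<le> w x"
proof -
  have C2: "C2_on D v" "C2_on D w" using v w by (auto simp: yukawa_dirichlet_solution_def panharmonic_on_def)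
  obtain M N where MN: "\<And>x. x \<in> closure D \<Longrightarrow> \<bar>v x\<bar> \<le> M" "\<And>x. x \<in> closure D \<Longrightarrow> \<bar>w x\<bar> \<le> N"
    using v(2) w(2) unfolding bounded_image_real by blast
  \<comment> \<open>The coefficients stay explicit so that the expression matches
    \<open>C2_on_linear\<close> and \<open>laplacian_linear\<close>.\<close>
  have "1 * v x + (-1) * w x + 0 \<le> 0"
  proof (rule maximum_principle[OF D \<mu> _ C2_on_linear[OF D C2] _ _ _ x])
    show "continuous_on (closure D) (\<lambda>x. 1 * v x + (-1) * w x + 0)"
      using v w by (auto simp: yukawa_dirichlet_solution_def intro!: continuous_intros)
    show "\<mu>\<^sup>2 * (1 * v x + (-1) * w x + 0) \<le> laplacian (\<lambda>x. 1 * v x + (-1) * w x + 0) x" if "x \<in> D" for x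
      using v w that unfolding laplacian_linear[OF D C2 that]
      by (simp add: yukawa_dirichlet_solution_def panharmonic_on_def algebra_simps)
    show "1 * v x + (-1) * w x + 0 \<le> 0" if "x \<in> frontier D" for x
      using v w that by (simp add: yukawa_dirichlet_solution_def)
    show "1 * v x + (-1) * w x + 0 \<le> M + N" if "x \<in> closure D" for x
      using MN[OF that] by linarith
  qed
  then show ?thesis by simp
qed

text \<open>Dominated convergence. Paths with infinite exit time contribute 0 for every parameter,
  including 0, so the integrands converge pointwise.\<close>

lemma yukawa_expectation_limit:
  fixes P :: "'a::euclidean_space \<Rightarrow> 'w measure"
  assumes fam: "brownian_family P W" and D: "open D"
    and f: "continuous_on (frontier D) f" "\<And>z. z \<in> frontier D \<Longrightarrow> \<bar>f z\<bar> \<le> B" and B: "0 \<le> B"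
  shows "(\<lambda>n. yukawa_expectation P W (1 / real (Suc n)) D f x) \<longlonglongrightarrow> yukawa_expectation P W 0 D f x"
proof -
  obtain g where g: "continuous_on UNIV g" "\<And>z. z \<in> frontier D \<Longrightarrow> g z = f z" "\<And>z. \<bar>g z\<bar> \<le> B"
    using extend_from_frontier[OF f B] by metis
  interpret brownian_fam P W by unfold_locales (rule fam)
  interpret brownian "P x" W x by (rule brownian)
  have [measurable]: "g \<in> borel_measurable borel" by (rule borel_measurable_continuous_onI[OF g(1)])
  note [measurable] = payoff_measurable[OF D]
  have eq: "payoff W c D f = payoff W c D g" for c by (rule payoff_cong) (simp add: g(2))
  let ?c = "\<lambda>n. (1 / real (Suc n))\<^sup>2 / 2"
  have c0: "?c \<longlonglongrightarrow> 0\<^sup>2 / 2" by (intro tendsto_intros LIMSEQ_Suc[OF lim_1_over_n]) simp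
  show ?thesis
    unfolding yukawa_expectation_eq eq
  proof (rule integral_dominated_convergence[where w="\<lambda>_. B"])
    show "AE \<omega> in P x. (\<lambda>n. payoff W (?c n) D g \<omega>) \<longlonglongrightarrow> payoff W (0\<^sup>2 / 2) D g \<omega>"
    proof (rule AE_I2)
      fix \<omega>
      have "(\<lambda>n. exp (- ?c n * enn2real (exit_time W D \<omega>)) * g (exit_point W D \<omega>)) \<longlonglongrightarrow>
          exp (- (0\<^sup>2 / 2) * enn2real (exit_time W D \<omega>)) * g (exit_point W D \<omega>)"
        by (intro tendsto_intros c0)
      then show "(\<lambda>n. payoff W (?c n) D g \<omega>) \<longlonglongrightarrow> payoff W (0\<^sup>2 / 2) D g \<omega>"
        unfolding payoff_def by (cases "exit_time W D \<omega> < \<infinity> \<and> exit_point W D \<omega> \<in> frontier D") (simp_all only: simp_thms if_True if_False tendsto_const)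
    qed
    show "AE \<omega> in P x. norm (payoff W (?c n) D g \<omega>) \<le> B" for n
      unfolding real_norm_def by (intro AE_I2 payoff_bound) (use f g B in auto)
  qed simp_all
qed

text \<open>Since infinite exit times are cut off in the expectation, the value 1 expresses that
  exit is certain. It removes the error term in the comparison of harmonic functions.\<close>

lemma yukawa_expectation_small:
  fixes P :: "'a::euclidean_space \<Rightarrow> 'w measure"
  assumes fam: "brownian_family P W" and small: "small_domain P W D" and x: "x \<in> D"
  shows "yukawa_expectation P W 0 D (\<lambda>_. 1) x = 1"
proof -
  interpret brownian_fam P W by unfold_locales (rule fam)
  interpret brownian "P x" W x by (rule brownian)
  have D: "open D" using small by (simp add: small_domain_def regular_domain_def domain_def)
  note [measurable] = payoff_measurable[OF D] measurable_exit_time[OF D]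
  have "AE \<omega> in P x. exit_time W D \<omega> < \<infinity>"
    using small x by (subst prob_Collect_eq_1[symmetric]) (auto simp: small_domain_def)
  then have "yukawa_expectation P W 0 D (\<lambda>_. 1) x = (\<integral>\<omega>. 1 \<partial>P x)"
    unfolding yukawa_expectation_eq
  proof (intro integral_cong_AE)
    assume "AE \<omega> in P x. exit_time W D \<omega> < \<infinity>"
    then show "AE \<omega> in P x. payoff W (0\<^sup>2 / 2) D (\<lambda>_. 1) \<omega> = 1"
      using W_0 AE_space
    proof eventually_elim
      case (elim \<omega>)
      then show ?case using payoff_exit[of D W \<omega>, OF D continuous_W] x by simp
    qed
  qed measurable
  then show ?thesis using prob_space by simp
qed

text \<open>For \<open>\<mu> = 0\<close>, a bounded harmonic \<open>v\<close> is compared with the solutions \<open>u\<^sub>l\<close> for small \<open>l > 0\<close>: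
  if \<open>|v| \<le> M\<close> then \<open>v \<le> u\<^sub>l + M (1 - E (exp (- l\<^sup>2 \<tau> / 2)))\<close> by the maximum principle.\<close>

lemma harmonic_le:
  fixes P :: "'a::euclidean_space \<Rightarrow> 'w measure"
  assumes fam: "brownian_family P W" and small: "small_domain P W D"
    and f: "continuous_on (frontier D) f"
    and v: "yukawa_dirichlet_solution 0 D f v" "bounded (v ` closure D)" and x: "x \<in> D"
  shows "v x \<le> yukawa_expectation P W 0 D f x"
proof -
  have reg: "regular_domain P W D" using small by (simp add: small_domain_def)
  then have D: "open D" by (simp add: regular_domain_def domain_def)
  obtain M where M: "M \<ge> 0" "\<And>x. x \<in> closure D \<Longrightarrow> \<bar>v x\<bar> \<le> M" using v(2) unfolding bounded_image_real by blast
  have vf: "v y = f y" if "y \<in> frontier D" for y using v that by (simp add: yukawa_dirichlet_solution_def)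
  have fM: "\<bar>f y\<bar> \<le> M" if "y \<in> frontier D" for y using M(2)[of y] vf[OF that] that by (auto simp: frontier_def)
  let ?u = "\<lambda>l. yukawa_expectation P W l D f" and ?e = "\<lambda>l. yukawa_expectation P W l D (\<lambda>_. 1)"
  have le: "v x \<le> ?u l x + M * (1 - ?e l x)" if l: "0 < l" for l
  proof -
    have U: "yukawa_dirichlet_solution l D f (?u l)" "\<And>x. \<bar>?u l x\<bar> \<le> M"
      by (rule yukawa_solution[OF fam reg f fM M(1)], assumption)+
    have E: "yukawa_dirichlet_solution l D (\<lambda>_. 1) (?e l)" "\<And>x. \<bar>?e l x\<bar> \<le> 1"
      by (rule yukawa_solution[OF fam reg], auto)+
    let ?z1 = "\<lambda>x. 1 * v x + (-1) * ?u l x + 0"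
    let ?z = "\<lambda>x. 1 * ?z1 x + M * ?e l x + (- M)"
    have C2: "C2_on D v" "C2_on D (?u l)" "C2_on D (?e l)"
      using v U E by (auto simp: yukawa_dirichlet_solution_def panharmonic_on_def)
    note C2z1 = C2_on_linear[OF D C2(1,2), of 1 "-1" 0]
    have "?z x \<le> 0"
    proof (rule maximum_principle[OF D l _ C2_on_linear[OF D C2z1 C2(3)]])
      show "continuous_on (closure D) ?z"
        using v U E by (auto simp: yukawa_dirichlet_solution_def intro!: continuous_intros)
      \<comment> \<open>The harmonic \<open>v\<close> contributes nothing to the Laplacian, and
        \<open>v - M\<close> is nonpositive, so dropping it from \<open>?z\<close> can only increase
        the value; this makes \<open>?z\<close> a subsolution.\<close>
      show "l\<^sup>2 * ?z y \<le> laplacian ?z y" if y: "y \<in> D" for y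
      proof -
        have "laplacian ?z y = l\<^sup>2 * (M * ?e l y - ?u l y)"
          unfolding laplacian_linear[OF D C2z1 C2(3) y] laplacian_linear[OF D C2(1,2) y]
          using v U E y by (simp add: yukawa_dirichlet_solution_def panharmonic_on_def algebra_simps)
        moreover have "?z y \<le> M * ?e l y - ?u l y" using M(2)[of y] closure_subset y by force
        ultimately show ?thesis by (simp add: mult_left_mono)
      qed
      show "?z y \<le> 0" if "y \<in> frontier D" for y
        using v U E that by (simp add: yukawa_dirichlet_solution_def)
      show "?z y \<le> 3 * M" if "y \<in> closure D" for y
      proof -
        have "M * ?e l y \<le> M * 1" using M(1) E(2)[of y] by (intro mult_left_mono) auto
        then show ?thesis using M(2)[OF that] U(2)[of y] by (simp add: abs_le_iff)
      qed
      show "x \<in> closure D" using x closure_subset by blast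
    qed
    then show ?thesis by (simp add: algebra_simps)
  qed
  have "(\<lambda>n. ?u (1 / real (Suc n)) x + M * (1 - ?e (1 / real (Suc n)) x)) \<longlonglongrightarrow> ?u 0 x + M * (1 - ?e 0 x)"
    by (intro tendsto_intros yukawa_expectation_limit[OF fam D f fM M(1)] yukawa_expectation_limit[OF fam D, where B=1]) auto
  then have "v x \<le> ?u 0 x + M * (1 - ?e 0 x)"
    by (rule LIMSEQ_le_const) (auto intro!: le)
  then show ?thesis by (simp add: yukawa_expectation_small[OF fam small x])
qed

lemma yukawa_unique:
  fixes P :: "'a::euclidean_space \<Rightarrow> 'w measure"
  assumes fam: "brownian_family P W" and reg: "regular_domain P W D" and \<mu>: "small_domain P W D \<or> 0 < \<mu>" "0 \<le> \<mu>"
    and f: "continuous_on (frontier D) f"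
    and v: "yukawa_dirichlet_solution \<mu> D f v" "bounded (v ` closure D)" and x: "x \<in> closure D"
  shows "v x = yukawa_expectation P W \<mu> D f x"
proof -
  have D: "open D" using reg by (simp add: regular_domain_def domain_def)
  obtain M where M: "M \<ge> 0" "\<And>x. x \<in> closure D \<Longrightarrow> \<bar>v x\<bar> \<le> M" using v(2) unfolding bounded_image_real by blast
  have vf: "v y = f y" if "y \<in> frontier D" for y using v that by (simp add: yukawa_dirichlet_solution_def)
  have fM: "\<bar>f y\<bar> \<le> M" if "y \<in> frontier D" for y using M(2)[of y] vf[OF that] that by (auto simp: frontier_def)
  let ?u = "yukawa_expectation P W \<mu> D f"
  have U: "yukawa_dirichlet_solution \<mu> D f ?u" "\<And>x. \<bar>?u x\<bar> \<le> M"
    by (rule yukawa_solution[OF fam reg f fM M(1)], assumption)+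
  have bU: "bounded (?u ` closure D)" unfolding bounded_image_real using U(2) M(1) by blast
  show ?thesis
  proof (cases "0 < \<mu>")
    case True
    show ?thesis
      using yukawa_dirichlet_le[OF D True v U(1) bU x] yukawa_dirichlet_le[OF D True U(1) bU v x] by simp
  next
    case False
    then have \<mu>0: "\<mu> = 0" and small: "small_domain P W D" using \<mu> by auto
    show ?thesis
    proof (cases "x \<in> D")
      case False
      then have "x \<in> frontier D" using x D by (simp add: frontier_def interior_open)
      then show ?thesis using U(1) vf by (simp add: yukawa_dirichlet_solution_def)
    next
      case True
      \<comment> \<open>\<open>harmonic_le\<close> is one-sided; applied to \<open>- v\<close> it
        gives the lower bound.\<close>
      have "yukawa_dirichlet_solution 0 D (\<lambda>y. - f y) (\<lambda>y. - v y)"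
      proof -
        have C2: "C2_on D v" using v by (simp add: yukawa_dirichlet_solution_def panharmonic_on_def)
        have "C2_on D (\<lambda>y. - v y)" using C2_on_linear[OF D C2 C2, of "-1" 0 0] by simp
        moreover have "laplacian (\<lambda>y. - v y) y = - laplacian v y" if "y \<in> D" for y
          using laplacian_linear[OF D C2 C2 that, of "-1" 0 0] by simp
        ultimately show ?thesis
          using v \<mu>0 by (auto simp: yukawa_dirichlet_solution_def panharmonic_on_def intro!: continuous_intros)
      qed
      moreover have "bounded ((\<lambda>y. - v y) ` closure D)" using M unfolding bounded_image_real by auto
      ultimately have "- v x \<le> yukawa_expectation P W 0 D (\<lambda>y. - f y) x"
        by (intro harmonic_le[OF fam small _ _ _ True] continuous_intros f)
      also have "\<dots> = - yukawa_expectation P W 0 D f x"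
        unfolding yukawa_expectation_def by (subst integral_minus[symmetric]) (rule Bochner_Integration.integral_cong; simp)
      finally show ?thesis using harmonic_le[OF fam small f v[unfolded \<mu>0] True] \<mu>0 by simp
    qed
  qed
qed

section \<open>The panharmonic measure\<close>

text \<open>For closed nonempty \<open>C\<close> the functions
  \<open>max 0 (1 - real n * infdist z C)\<close> decrease to the indicator of \<open>C\<close>, and
  the closed sets form a generator stable under intersections.\<close>

lemma measure_eqI_bounded_continuous:
  fixes M N :: "'a::metric_space measure"
  assumes "finite_measure M" "finite_measure N" and sets: "sets M = sets borel" "sets N = sets borel"
    and eq: "\<And>f. continuous_on UNIV f \<Longrightarrow> (\<And>z. 0 \<le> f z \<and> f z \<le> (1::real)) \<Longrightarrow> (\<integral>z. f z \<partial>M) = (\<integral>z. f z \<partial>N)"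
  shows "M = N"
proof -
  interpret M: finite_measure M by fact
  interpret N: finite_measure N by fact
  note [measurable_cong] = sets
  have lim: "(\<lambda>n. \<integral>z. max 0 (1 - real n * infdist z C) \<partial>K) \<longlonglongrightarrow> measure K C"
    if K: "finite_measure K" "sets K = sets borel" and C: "closed C" "C \<noteq> {}" for K and C :: "'a set"
  proof -
    interpret K: finite_measure K by fact
    note [measurable_cong] = K(2)
    have [measurable]: "C \<in> sets borel" by (rule borel_closed[OF C(1)])
    have [measurable]: "(\<lambda>z. infdist z C) \<in> borel_measurable borel"
      by (intro borel_measurable_continuous_onI continuous_intros)
    have "(\<lambda>n. \<integral>z. max 0 (1 - real n * infdist z C) \<partial>K) \<longlonglongrightarrow> (\<integral>z. indicator C z \<partial>K)"
    proof (rule integral_dominated_convergence[where w="\<lambda>_. 1"])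
      show "AE z in K. (\<lambda>n. max 0 (1 - real n * infdist z C)) \<longlonglongrightarrow> indicator C z"
      proof (rule AE_I2)
        fix z
        show "(\<lambda>n. max 0 (1 - real n * infdist z C)) \<longlonglongrightarrow> indicator C z"
        proof (cases "z \<in> C")
          case True
          then show ?thesis by simp
        next
          case False
          then have pos: "0 < infdist z C"
            using in_closed_iff_infdist_zero[OF C] infdist_nonneg[of z C] by (metis order_le_less)
          obtain n0 :: nat where n0: "1 / infdist z C < real n0" using reals_Archimedean2 by blast
          have "max 0 (1 - real n * infdist z C) = 0" if "n \<ge> n0" for n
          proof -
            have "1 / infdist z C < real n" using n0 that by simp
            then have "1 < real n * infdist z C" using pos by (simp add: pos_divide_less_eq)
            then show ?thesis by simp
          qed
          then have "\<forall>\<^sub>F n in sequentially. max 0 (1 - real n * infdist z C) = indicator C z"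
            using False by (auto simp: eventually_sequentially)
          then show ?thesis by (rule tendsto_eventually)
        qed
      qed
      show "AE z in K. norm (max 0 (1 - real n * infdist z C)) \<le> 1" for n
        by (intro AE_I2) (auto intro!: mult_nonneg_nonneg infdist_nonneg)
    qed (simp, measurable)
    then show ?thesis by simp
  qed
  have closed_eq: "emeasure M C = emeasure N C" if C: "closed C" for C
  proof (cases "C = {}")
    case False
    have "(\<integral>z. max 0 (1 - real n * infdist z C) \<partial>M) = (\<integral>z. max 0 (1 - real n * infdist z C) \<partial>N)" for n
      by (rule eq) (auto intro!: continuous_intros simp: infdist_nonneg)
    then have "measure M C = measure N C"
      using lim[OF assms(1) sets(1) C False] lim[OF assms(2) sets(2) C False] by (simp add: LIMSEQ_unique)
    then show ?thesis by (simp add: M.emeasure_eq_measure N.emeasure_eq_measure)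
  qed simp
  show ?thesis
  proof (rule measure_eqI_generator_eq[where E="Collect closed" and \<Omega>=UNIV and A="\<lambda>_. UNIV"])
    show "Int_stable (Collect closed :: 'a set set)" by (auto simp: Int_stable_def)
    show "sets M = sigma_sets UNIV (Collect closed)" "sets N = sigma_sets UNIV (Collect closed)"
      unfolding sets borel_eq_closed by simp_all
  qed (use closed_eq in auto)
qed

text \<open>The explicit candidate for the panharmonic measure: the hitting measure with each path
  discounted. It is built like \<open>hitting_measure\<close>, so that \<open>c = 0\<close> gives
  the latter back. On paths with infinite exit time the density is 1, as \<open>enn2real\<close>
  sends infinity to 0, but the restriction removes those paths.\<close>

definition yukawa_measure ::
  "('a::euclidean_space \<Rightarrow> 'w measure) \<Rightarrow> (real \<Rightarrow> 'w \<Rightarrow> 'a) \<Rightarrow> real \<Rightarrow> 'a set \<Rightarrow> 'a \<Rightarrow> 'a measure" where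
  "yukawa_measure P W c D x =
     distr (restrict_space (density (P x) (\<lambda>\<omega>. ennreal (exp (- c * enn2real (exit_time W D \<omega>)))))
              {\<omega> \<in> space (P x). exit_time W D \<omega> < \<infinity> \<and> exit_point W D \<omega> \<in> frontier D})
           (restrict_space borel (frontier D)) (exit_point W D)"

lemma sets_yukawa_measure [simp]: "sets (yukawa_measure P W c D x) = sets (restrict_space borel (frontier D))"
  by (simp add: yukawa_measure_def)

lemma space_yukawa_measure [simp]: "space (yukawa_measure P W c D x) = frontier D"
  by (simp add: yukawa_measure_def space_restrict_space)

lemma hitting_measure_eq: "hitting_measure P W D x = yukawa_measure P W 0 D x"
  by (simp add: hitting_measure_def yukawa_measure_def density_1)

context brownian_fam
begin

lemma
  assumes D: "open D" and c: "0 \<le> c"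
  shows emeasure_yukawa_measure: "A \<in> sets (restrict_space borel (frontier D)) \<Longrightarrow> emeasure (yukawa_measure P W c D x) A =
      (\<integral>\<^sup>+\<omega>. ennreal (exp (- c * enn2real (exit_time W D \<omega>))) *
         indicator {\<omega> \<in> space (P x). exit_time W D \<omega> < \<infinity> \<and> exit_point W D \<omega> \<in> A} \<omega> \<partial>P x)"
    and integral_yukawa_measure: "continuous_on (frontier D) f \<Longrightarrow>
      (\<integral>z. f z \<partial>yukawa_measure P W c D x) = (\<integral>\<omega>. payoff W c D f \<omega> \<partial>P x)"
    and finite_yukawa_measure: "finite_measure (yukawa_measure P W c D x)"
proof -
  interpret brownian "P x" W x by (rule brownian)
  note [measurable] = measurable_exit_time[OF D] measurable_exit_point[OF D]
  have F[measurable]: "frontier D \<in> sets borel" by (rule borel_closed[OF frontier_closed])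
  let ?e = "\<lambda>\<omega>. exp (- c * enn2real (exit_time W D \<omega>))"
  let ?S = "{\<omega> \<in> space (P x). exit_time W D \<omega> < \<infinity> \<and> exit_point W D \<omega> \<in> frontier D}"
  let ?M = "density (P x) (\<lambda>\<omega>. ennreal (?e \<omega>))"
  have S: "?S \<in> sets (P x)" by measurable
  have X: "exit_point W D \<in> restrict_space ?M ?S \<rightarrow>\<^sub>M restrict_space borel (frontier D)"
    by (rule measurable_restrict_space3) auto
  show em: "emeasure (yukawa_measure P W c D x) A =
      (\<integral>\<^sup>+\<omega>. ennreal (?e \<omega>) * indicator {\<omega> \<in> space (P x). exit_time W D \<omega> < \<infinity> \<and> exit_point W D \<omega> \<in> A} \<omega> \<partial>P x)"
    if A: "A \<in> sets (restrict_space borel (frontier D))" for A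
  proof -
    have AF: "A \<subseteq> frontier D" using A sets.sets_into_space by (fastforce simp: space_restrict_space)
    have [measurable]: "A \<in> sets borel" using A F by (simp add: sets_restrict_space_iff)
    have "emeasure (yukawa_measure P W c D x) A = emeasure (restrict_space ?M ?S) (exit_point W D -` A \<inter> space (restrict_space ?M ?S))"
      unfolding yukawa_measure_def by (rule emeasure_distr[OF X A])
    also have "exit_point W D -` A \<inter> space (restrict_space ?M ?S) =
        {\<omega> \<in> space (P x). exit_time W D \<omega> < \<infinity> \<and> exit_point W D \<omega> \<in> A}"
      using AF by (auto simp: space_restrict_space)
    also have "emeasure (restrict_space ?M ?S) \<dots> = emeasure ?M \<dots>"
      using S AF by (intro emeasure_restrict_space) auto
    also have "\<dots> = (\<integral>\<^sup>+\<omega>. ennreal (?e \<omega>) * indicator {\<omega> \<in> space (P x). exit_time W D \<omega> < \<infinity> \<and> exit_point W D \<omega> \<in> A} \<omega> \<partial>P x)"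
      by (rule emeasure_density) measurable
    finally show ?thesis .
  qed
  show "(\<integral>z. f z \<partial>yukawa_measure P W c D x) = (\<integral>\<omega>. payoff W c D f \<omega> \<partial>P x)" if f: "continuous_on (frontier D) f" for f
  proof -
    have fm: "f \<in> borel_measurable (restrict_space borel (frontier D))"
      by (rule borel_measurable_continuous_on_restrict[OF f])
    have fX: "(\<lambda>\<omega>. f (exit_point W D \<omega>)) \<in> borel_measurable (restrict_space ?M ?S)"
      using measurable_compose[OF X fm] .
    have "(\<integral>z. f z \<partial>yukawa_measure P W c D x) = (\<integral>\<omega>. f (exit_point W D \<omega>) \<partial>restrict_space ?M ?S)"
      unfolding yukawa_measure_def by (rule integral_distr[OF X fm])
    also have "\<dots> = (\<integral>\<omega>. indicator ?S \<omega> *\<^sub>R f (exit_point W D \<omega>) \<partial>?M)"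
      using S by (subst integral_restrict_space) auto
    also have "\<dots> = (\<integral>\<omega>. ?e \<omega> *\<^sub>R (indicator ?S \<omega> *\<^sub>R f (exit_point W D \<omega>)) \<partial>P x)"
    proof (rule integral_density)
      show "(\<lambda>\<omega>. indicator ?S \<omega> *\<^sub>R f (exit_point W D \<omega>)) \<in> borel_measurable (P x)"
        using fX S by (subst (asm) borel_measurable_restrict_space_iff) auto
    qed auto
    also have "\<dots> = (\<integral>\<omega>. payoff W c D f \<omega> \<partial>P x)"
      by (rule Bochner_Integration.integral_cong) (auto simp: payoff_def)
    finally show ?thesis .
  qed
  show "finite_measure (yukawa_measure P W c D x)"
  proof
    have "frontier D \<in> sets (restrict_space borel (frontier D))" by (simp add: sets_restrict_space_iff F)
    from em[OF this] have "emeasure (yukawa_measure P W c D x) (frontier D) =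
        (\<integral>\<^sup>+\<omega>. ennreal (?e \<omega>) * indicator ?S \<omega> \<partial>P x)" .
    also have "\<dots> \<le> (\<integral>\<^sup>+\<omega>. 1 \<partial>P x)"
    proof (rule nn_integral_mono)
      fix \<omega>
      have "?e \<omega> \<le> 1" using c by simp
      then show "ennreal (?e \<omega>) * indicator ?S \<omega> \<le> 1" by (simp add: indicator_def)
    qed
    also have "\<dots> = 1" by (simp add: emeasure_space_1)
    finally show "emeasure (yukawa_measure P W c D x) (space (yukawa_measure P W c D x)) \<noteq> \<infinity>"
      by (auto simp: top_unique)
  qed
qed

text \<open>A bounded panharmonic function solves the problem with its own boundary values as data.
  Uniqueness equates it with the expectation, which is the integral against the candidate.\<close>

lemma represents_yukawa_measure:
  assumes reg: "regular_domain P W D" and \<mu>: "small_domain P W D \<or> 0 < \<mu>" "0 \<le> \<mu>" and x: "x \<in> D"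
  shows "represents_panharmonic \<mu> D x (yukawa_measure P W (\<mu>\<^sup>2 / 2) D x)"
  unfolding represents_panharmonic_def
proof (intro conjI allI impI)
  show "sets (yukawa_measure P W (\<mu>\<^sup>2 / 2) D x) = sets (restrict_space borel (frontier D))" by simp
  fix v assume v: "continuous_on (closure D) v \<and> bounded (v ` closure D) \<and> panharmonic_on \<mu> D v"
  have D: "open D" using reg by (simp add: regular_domain_def domain_def)
  have c: "0 \<le> \<mu>\<^sup>2 / 2" by simp
  have vf: "continuous_on (frontier D) v" using v by (auto intro: continuous_on_subset simp: frontier_def)
  have "yukawa_dirichlet_solution \<mu> D v v" using v by (simp add: yukawa_dirichlet_solution_def)
  moreover have "x \<in> closure D" using x closure_subset by blast
  ultimately show "v x = (\<integral>y. v y \<partial>yukawa_measure P W (\<mu>\<^sup>2 / 2) D x)"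
    using v unfolding integral_yukawa_measure[OF D c vf] yukawa_expectation_eq[symmetric]
    by (intro yukawa_unique[OF family reg \<mu> vf]) auto
  interpret finite_measure "yukawa_measure P W (\<mu>\<^sup>2 / 2) D x" by (rule finite_yukawa_measure[OF D c])
  obtain M where M: "\<And>y. y \<in> closure D \<Longrightarrow> \<bar>v y\<bar> \<le> M" using v unfolding bounded_image_real by blast
  show "integrable (yukawa_measure P W (\<mu>\<^sup>2 / 2) D x) v"
  proof (rule integrable_const_bound[where B=M])
    show "AE y in yukawa_measure P W (\<mu>\<^sup>2 / 2) D x. norm (v y) \<le> M"
      using M by (intro AE_I2) (auto simp: frontier_def)
    show "v \<in> borel_measurable (yukawa_measure P W (\<mu>\<^sup>2 / 2) D x)"
      using borel_measurable_continuous_on_restrict[OF vf] by (simp cong: measurable_cong_sets)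
  qed
qed

text \<open>By existence, every continuous function with values between 0 and 1 is on the frontier
  the boundary value of a bounded panharmonic function, so its integral against a representing
  measure is prescribed. The measures are moved to the Borel sets of the whole space for the
  comparison and then back.\<close>

lemma represents_panharmonic_unique:
  assumes reg: "regular_domain P W D" and x: "x \<in> D"
    and H: "represents_panharmonic \<mu> D x H" and K: "represents_panharmonic \<mu> D x K"
  shows "H = K"
proof -
  have D: "open D" using reg by (simp add: regular_domain_def domain_def)
  have F: "frontier D \<in> sets borel" by (rule borel_closed[OF frontier_closed])
  have integral: "(\<integral>z. f z \<partial>H) = yukawa_expectation P W \<mu> D f x \<and> integrable H f"
    if H: "represents_panharmonic \<mu> D x H" and f: "continuous_on UNIV f" "\<And>z. 0 \<le> f z \<and> f z \<le> 1" for H f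
  proof -
    have fF: "continuous_on (frontier D) f" using f(1) by (rule continuous_on_subset) simp
    have fb: "\<bar>f z\<bar> \<le> 1" for z using f(2)[of z] by simp
    let ?u = "yukawa_expectation P W \<mu> D f"
    have u: "yukawa_dirichlet_solution \<mu> D f ?u" "\<And>y. \<bar>?u y\<bar> \<le> 1"
      by (rule yukawa_solution[OF family reg fF fb], simp)+
    have "bounded (?u ` closure D)" unfolding bounded_image_real using u(2) by (intro exI[of _ 1]) auto
    then have *: "integrable H ?u" "?u x = (\<integral>y. ?u y \<partial>H)"
      using H u(1) unfolding represents_panharmonic_def yukawa_dirichlet_solution_def by blast+
    have sp: "space H = frontier D"
      using H sets_eq_imp_space_eq[of H "restrict_space borel (frontier D)"]
      by (simp add: represents_panharmonic_def space_restrict_space)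
    have eq: "?u z = f z" if "z \<in> space H" for z using u(1) that sp by (simp add: yukawa_dirichlet_solution_def)
    have "(\<integral>y. ?u y \<partial>H) = (\<integral>y. f y \<partial>H)" by (rule Bochner_Integration.integral_cong[OF refl eq])
    moreover have "integrable H ?u \<longleftrightarrow> integrable H f" by (rule Bochner_Integration.integrable_cong[OF refl eq])
    ultimately show ?thesis using * by simp
  qed
  \<comment> \<open>Finiteness comes from the integrability demanded in
    \<open>represents_panharmonic\<close>, used for the solution with boundary value 1.\<close>
  have fin: "finite_measure H" if H: "represents_panharmonic \<mu> D x H" for H
  proof
    have "integrable H (\<lambda>_. 1 :: real)" using integral[OF H, of "\<lambda>_. 1"] by simp
    then show "emeasure H (space H) \<noteq> \<infinity>" by (simp add: integrable_iff_bounded)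
  qed
  have id: "(\<lambda>z. z) \<in> H \<rightarrow>\<^sub>M borel" if "represents_panharmonic \<mu> D x H" for H
  proof -
    have "(\<lambda>z. z) \<in> restrict_space borel (frontier D) \<rightarrow>\<^sub>M (borel :: 'a measure)"
      by (rule measurable_restrict_space1) simp
    moreover have "sets H = sets (restrict_space borel (frontier D))" using that by (simp add: represents_panharmonic_def)
    ultimately show ?thesis by (simp cong: measurable_cong_sets)
  qed
  have eq: "distr H borel (\<lambda>z. z) = distr K borel (\<lambda>z. z)"
  proof (rule measure_eqI_bounded_continuous)
    show "finite_measure (distr H borel (\<lambda>z. z))" by (rule finite_measure.finite_measure_distr[OF fin[OF H] id[OF H]])
    show "finite_measure (distr K borel (\<lambda>z. z))" by (rule finite_measure.finite_measure_distr[OF fin[OF K] id[OF K]])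
    fix f :: "'a \<Rightarrow> real" assume f: "continuous_on UNIV f" "\<And>z. 0 \<le> f z \<and> f z \<le> 1"
    have fm: "f \<in> borel_measurable borel" by (rule borel_measurable_continuous_onI[OF f(1)])
    show "(\<integral>z. f z \<partial>distr H borel (\<lambda>z. z)) = (\<integral>z. f z \<partial>distr K borel (\<lambda>z. z))"
      using integral[OF H f] integral[OF K f] by (simp add: integral_distr[OF id[OF H] fm] integral_distr[OF id[OF K] fm])
  qed simp_all
  show ?thesis
  proof (rule measure_eqI)
    show sets: "sets H = sets K" using H K by (simp add: represents_panharmonic_def)
    fix A assume A: "A \<in> sets H"
    then have "A \<in> sets (restrict_space borel (frontier D))" using H by (simp add: represents_panharmonic_def)
    then have AB: "A \<in> sets borel" using F by (simp add: sets_restrict_space_iff)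
    have "emeasure H A = emeasure (distr H borel (\<lambda>z. z)) A"
      using sets.sets_into_space[OF A] by (subst emeasure_distr[OF id[OF H] AB]) (simp add: Int_absorb2)
    also have "\<dots> = emeasure K A"
      using sets.sets_into_space[of A K] A sets unfolding eq by (subst emeasure_distr[OF id[OF K] AB]) (simp add: Int_absorb2)
    finally show "emeasure H A = emeasure K A" .
  qed
qed

lemma panharmonic_measure_eq:
  assumes reg: "regular_domain P W D" and \<mu>: "0 \<le> \<mu>" and x: "x \<in> D"
  shows "panharmonic_measure P W \<mu> D x = yukawa_measure P W (\<mu>\<^sup>2 / 2) D x"
proof (cases "small_domain P W D \<or> 0 < \<mu>")
  case True
  note Y = represents_yukawa_measure[OF reg True \<mu> x]
  have "(THE H. represents_panharmonic \<mu> D x H) = yukawa_measure P W (\<mu>\<^sup>2 / 2) D x"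
    by (rule the_equality, rule Y) (rule represents_panharmonic_unique[OF reg x _ Y])
  then show ?thesis using True by (simp add: panharmonic_measure_def)
next
  case False
  then have "\<mu> = 0" using \<mu> by simp
  then show ?thesis using False by (simp add: panharmonic_measure_def hitting_measure_eq)
qed

text \<open>Restricted to exits through \<open>A\<close>, the exit time has the density
  \<open>?d\<close>, the product of \<open>q\<close> and the conditional probability of
  \<open>A\<close>; this is fact \<open>\<nu>\<close>. Integrating the discount factor against that
  density gives the formula. On positive times \<open>h t\<close> is the same product, whichever
  version of the kernel is taken.\<close>

lemma yukawa_measure_kernel:
  assumes D: "open D" and c: "0 \<le> c" and x: "x \<in> D" and h: "harmonic_kernel (P x) W D h"
    and A: "A \<in> sets (restrict_space borel (frontier D))"
  shows "emeasure (yukawa_measure P W c D x) A =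
    (\<integral>\<^sup>+t\<in>{0<..}. ennreal (exp (- c * t)) * emeasure (h t) A \<partial>lborel)"
proof -
  interpret brownian "P x" W x by (rule brownian)
  note [measurable] = measurable_exit_time[OF D] measurable_exit_point[OF D]
  have [measurable]: "A \<in> sets borel"
    using A borel_closed[OF frontier_closed[of D]] by (simp add: sets_restrict_space_iff)
  obtain \<kappa> q where \<kappa>: "exit_point_rcd (P x) W D \<kappa>" and q: "exit_time_density (P x) W D q"
    and ht: "\<And>t. 0 < t \<Longrightarrow> h t = scale_measure (q t) (\<kappa> t)"
    using h unfolding harmonic_kernel_def by blast
  have q_meas[measurable]: "q \<in> borel_measurable borel"
    and law: "exit_time_law (P x) W D = density lborel (\<lambda>t. q t * indicator {0<..} t)"
    using q by (auto simp: exit_time_density_def)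
  have "\<kappa> \<in> borel \<rightarrow>\<^sub>M subprob_algebra borel"
    using \<kappa> by (intro measurable_prob_algebraD) (simp add: exit_point_rcd_def)
  then have \<kappa>_meas[measurable]: "(\<lambda>t. emeasure (\<kappa> t) A) \<in> borel_measurable borel"
    by (rule measurable_emeasure_kernel) measurable
  let ?T = "\<lambda>\<omega>. enn2real (exit_time W D \<omega>)"
  let ?S = "{\<omega> \<in> space (P x). exit_time W D \<omega> < \<infinity> \<and> 0 < ?T \<omega> \<and> exit_point W D \<omega> \<in> A}"
  let ?d = "\<lambda>t. q t * indicator {0<..} t * emeasure (\<kappa> t) A"
  have S: "?S \<in> sets (P x)" by measurable
  have T: "?T \<in> restrict_space (P x) ?S \<rightarrow>\<^sub>M borel" by (rule measurable_restrict_space1) measurable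
  have \<nu>: "distr (restrict_space (P x) ?S) borel ?T = density lborel ?d"
  proof (rule measure_eqI)
    fix B assume "B \<in> sets (distr (restrict_space (P x) ?S) borel ?T)"
    then have [measurable]: "B \<in> sets borel" by simp
    have "emeasure (distr (restrict_space (P x) ?S) borel ?T) B =
        emeasure (restrict_space (P x) ?S) (?T -` B \<inter> space (restrict_space (P x) ?S))"
      by (rule emeasure_distr[OF T]) measurable
    also have "?T -` B \<inter> space (restrict_space (P x) ?S) =
        {\<omega> \<in> space (P x). exit_time W D \<omega> < \<infinity> \<and> ?T \<omega> \<in> B \<inter> {0<..} \<and> exit_point W D \<omega> \<in> A}"
      by (auto simp: space_restrict_space)
    also have "emeasure (restrict_space (P x) ?S) \<dots> = emeasure (P x) \<dots>"
      using S by (intro emeasure_restrict_space) auto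
    also have "\<dots> = (\<integral>\<^sup>+t\<in>B \<inter> {0<..}. emeasure (\<kappa> t) A \<partial>exit_time_law (P x) W D)"
    proof -
      have "B \<inter> {0<..} \<in> sets borel" "A \<in> sets borel" by measurable
      then show ?thesis using \<kappa> unfolding exit_point_rcd_def by (meson Int_lower2)
    qed
    also have "\<dots> = (\<integral>\<^sup>+t. q t * indicator {0<..} t * (emeasure (\<kappa> t) A * indicator (B \<inter> {0<..}) t) \<partial>lborel)"
      unfolding law by (rule nn_integral_density) measurable
    also have "\<dots> = (\<integral>\<^sup>+t. ?d t * indicator B t \<partial>lborel)"
      by (rule nn_integral_cong) (auto simp: indicator_def)
    also have "\<dots> = emeasure (density lborel ?d) B"
      by (rule emeasure_density[symmetric]) measurable
    finally show "emeasure (distr (restrict_space (P x) ?S) borel ?T) B = emeasure (density lborel ?d) B" .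
  qed simp
  have "emeasure (yukawa_measure P W c D x) A =
      (\<integral>\<^sup>+\<omega>. ennreal (exp (- c * ?T \<omega>)) * indicator {\<omega> \<in> space (P x). exit_time W D \<omega> < \<infinity> \<and> exit_point W D \<omega> \<in> A} \<omega> \<partial>P x)"
    by (rule emeasure_yukawa_measure[OF D c A])
  \<comment> \<open>The kernel concerns positive times only; for a start in the open set
    \<open>D\<close> the exit time is almost surely positive, so nothing is lost.\<close>
  also have "\<dots> = (\<integral>\<^sup>+\<omega>. ennreal (exp (- c * ?T \<omega>)) * indicator ?S \<omega> \<partial>P x)"
  proof (rule nn_integral_cong_AE)
    show "AE \<omega> in P x. ennreal (exp (- c * ?T \<omega>)) * indicator {\<omega> \<in> space (P x). exit_time W D \<omega> < \<infinity> \<and> exit_point W D \<omega> \<in> A} \<omega> =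
        ennreal (exp (- c * ?T \<omega>)) * indicator ?S \<omega>"
      using W_0 AE_space
    proof eventually_elim
      case (elim \<omega>)
      have "0 < ?T \<omega>" if "exit_time W D \<omega> < \<infinity>"
        using exit_time_finite(1)[of D W \<omega>, OF D continuous_W[OF elim(2)] _ that] elim x by simp
      then show ?case by (auto simp: indicator_def)
    qed
  qed
  also have "\<dots> = (\<integral>\<^sup>+\<omega>. ennreal (exp (- c * ?T \<omega>)) \<partial>restrict_space (P x) ?S)"
    using S by (subst nn_integral_restrict_space) auto
  also have "\<dots> = (\<integral>\<^sup>+t. ennreal (exp (- c * t)) \<partial>distr (restrict_space (P x) ?S) borel ?T)"
    by (rule nn_integral_distr[OF T, symmetric]) measurable
  also have "\<dots> = (\<integral>\<^sup>+t. ?d t * ennreal (exp (- c * t)) \<partial>lborel)"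
    unfolding \<nu> by (rule nn_integral_density) measurable
  also have "\<dots> = (\<integral>\<^sup>+t\<in>{0<..}. ennreal (exp (- c * t)) * emeasure (h t) A \<partial>lborel)"
    by (rule nn_integral_cong) (auto simp: indicator_def ht ac_simps)
  finally show ?thesis .
qed

end

theorem theorem2p5:
  fixes P :: "real ^ 'n \<Rightarrow> 'w measure"
    and W :: "real \<Rightarrow> 'w \<Rightarrow> real ^ 'n"
    and D :: "(real ^ 'n) set"
    and \<mu> :: real
    and f :: "real ^ 'n \<Rightarrow> real"
  assumes "CARD('n) \<ge> 2"
    and "brownian_family P W"
    and "regular_domain P W D"
    and "\<mu> \<ge> 0"
    and "continuous_on (frontier D) f"
    and "bounded (f ` frontier D)"
  shows "yukawa_dirichlet_solution \<mu> D f (yukawa_expectation P W \<mu> D f) \<and>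
    (small_domain P W D \<longrightarrow>
       bounded (yukawa_expectation P W \<mu> D f ` closure D) \<and>
       (\<forall>v. yukawa_dirichlet_solution \<mu> D f v \<and> bounded (v ` closure D) \<longrightarrow>
            (\<forall>x\<in>closure D. v x = yukawa_expectation P W \<mu> D f x))) \<and>
    (\<forall>x\<in>D. \<forall>h. harmonic_kernel (P x) W D h \<longrightarrow>
       (\<forall>A\<in>sets (restrict_space borel (frontier D)).
          emeasure (panharmonic_measure P W \<mu> D x) A =
          (\<integral>\<^sup>+t\<in>{0<..}. ennreal (exp (- (\<mu>\<^sup>2 / 2) * t)) * emeasure (h t) A \<partial>lborel)))"
proof -
  interpret brownian_fam P W by unfold_locales (rule assms(2))
  have D: "open D" using assms(3) by (simp add: regular_domain_def domain_def)
  obtain B where B: "0 \<le> B" "\<And>z. z \<in> frontier D \<Longrightarrow> \<bar>f z\<bar> \<le> B"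
    using assms(6) unfolding bounded_image_real by blast
  have "yukawa_dirichlet_solution \<mu> D f (yukawa_expectation P W \<mu> D f)"
    by (rule yukawa_solution(1)[OF assms(2,3,5) B(2,1)])
  moreover have "bounded (yukawa_expectation P W \<mu> D f ` closure D)"
    unfolding bounded_image_real using yukawa_solution(2)[OF assms(2,3,5) B(2,1)] B(1) by blast
  moreover have "v x = yukawa_expectation P W \<mu> D f x"
    if "small_domain P W D" "yukawa_dirichlet_solution \<mu> D f v" "bounded (v ` closure D)" "x \<in> closure D" for v x
    using yukawa_unique[OF assms(2,3) _ assms(4,5)] that by blast
  moreover have "emeasure (panharmonic_measure P W \<mu> D x) A =
      (\<integral>\<^sup>+t\<in>{0<..}. ennreal (exp (- (\<mu>\<^sup>2 / 2) * t)) * emeasure (h t) A \<partial>lborel)"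
    if "x \<in> D" "harmonic_kernel (P x) W D h" "A \<in> sets (restrict_space borel (frontier D))" for x h A
    unfolding panharmonic_measure_eq[OF assms(3,4) that(1)]
    by (rule yukawa_measure_kernel[OF D _ that]) simp
  ultimately show ?thesis by blast
qed

end
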